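(* Suppose that $I$ is an $\omega_1$-complete ideal over some set $\kappa$. Then the forcing with $I$, i.e. $\mathcal{P}(\kappa)/I$, cannot be isomorphic to $\mathrm{Cohen}\times\mathrm{Random}$ or to $\mathrm{Random}\times\mathrm{Cohen}$.
   Context: Forcing with an ideal $I$ over $\kappa$ means forcing with the Boolean algebra $\mathcal{P}(\kappa)/I$ of $I$-positive sets modulo $I$. $\mathrm{Cohen}$ is the forcing adding one Cohen real (finite binary sequences ordered by extension) and $\mathrm{Random}$ is the forcing adding one random real (Borel subsets of $2^\omega$ of positive Lebesgue measure modulo null sets); $\mathrm{Cohen}\times\mathrm{Random}$ and $\mathrm{Random}\times\mathrm{Cohen}$ denote their product forcing (in the two orders of iteration/product as written). Isomorphism means isomorphism of Boolean completions. *)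

theory Defs
  imports "HOL-Probability.Probability" "HOL-Library.Sublist" "HOL-Library.Countable_Set"
begin

text \<open>
  A forcing notion is a partial order given as a relation \<open>r\<close>: its set of conditions is
  \<open>Field r\<close>, and \<open>(q, p) \<in> r\<close> means \<open>q \<le> p\<close>, that is, \<open>q\<close> is the stronger condition.
\<close>

section \<open>Ideals\<close>

text \<open>Properness (\<open>\<kappa> \<notin> I\<close>) is not part of the definition.\<close>

definition ideal_over :: "'a set \<Rightarrow> 'a set set \<Rightarrow> bool" where
  "ideal_over \<kappa> I \<longleftrightarrow>
     I \<subseteq> Pow \<kappa> \<and> {} \<in> I \<and>
     (\<forall>A\<in>I. \<forall>B. B \<subseteq> A \<longrightarrow> B \<in> I) \<and>
     (\<forall>A\<in>I. \<forall>B\<in>I. A \<union> B \<in> I)"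

definition omega1_complete :: "'a set set \<Rightarrow> bool" where
  "omega1_complete I \<longleftrightarrow> (\<forall>F. F \<subseteq> I \<longrightarrow> countable F \<longrightarrow> \<Union>F \<in> I)"

section \<open>Forcing with the positive sets of an algebra of sets modulo an ideal\<close>

definition mod_ideal :: "'a set set \<Rightarrow> 'a set set \<Rightarrow> 'a set rel" where
  "mod_ideal \<A> N = {(A, B). A \<in> \<A> \<and> B \<in> \<A> \<and> (A - B) \<union> (B - A) \<in> N}"

definition quotient_forcing :: "'a set set \<Rightarrow> 'a set set \<Rightarrow> 'a set set rel" where
  "quotient_forcing \<A> N =
     {(mod_ideal \<A> N `` {A}, mod_ideal \<A> N `` {B}) | A B.
        A \<in> \<A> - N \<and> B \<in> \<A> - N \<and> A - B \<in> N}"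

definition ideal_forcing :: "'a set \<Rightarrow> 'a set set \<Rightarrow> 'a set set rel" where
  "ideal_forcing \<kappa> I = quotient_forcing (Pow \<kappa>) I"

lemma ideal_forcing_iff:
  assumes I: "ideal_over \<kappa> I" and "A \<subseteq> \<kappa>" "A \<notin> I" "B \<subseteq> \<kappa>" "B \<notin> I"
  shows "(mod_ideal (Pow \<kappa>) I `` {A}, mod_ideal (Pow \<kappa>) I `` {B}) \<in> ideal_forcing \<kappa> I
           \<longleftrightarrow> A - B \<in> I" (is "?l \<longleftrightarrow> ?r")
proof
  assume ?l
  then obtain A' B' where
    eqA: "mod_ideal (Pow \<kappa>) I `` {A} = mod_ideal (Pow \<kappa>) I `` {A'}" and
    eqB: "mod_ideal (Pow \<kappa>) I `` {B} = mod_ideal (Pow \<kappa>) I `` {B'}" and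
    sub: "A' \<subseteq> \<kappa>" "B' \<subseteq> \<kappa>" and d: "A' - B' \<in> I"
    unfolding ideal_forcing_def quotient_forcing_def by blast
  have e: "{} \<in> I" using I by (simp add: ideal_over_def)
  have down: "\<And>X Y. X \<in> I \<Longrightarrow> Y \<subseteq> X \<Longrightarrow> Y \<in> I" and
    un: "\<And>X Y. X \<in> I \<Longrightarrow> Y \<in> I \<Longrightarrow> X \<union> Y \<in> I"
    using I unfolding ideal_over_def by blast+
  have "A \<in> mod_ideal (Pow \<kappa>) I `` {A'}" "B \<in> mod_ideal (Pow \<kappa>) I `` {B'}"
    using assms e unfolding eqA[symmetric] eqB[symmetric] by (auto simp: mod_ideal_def)
  then have "(A' - A) \<union> (A - A') \<in> I" "(B' - B) \<union> (B - B') \<in> I"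
    by (auto simp: mod_ideal_def)
  then have "((A' - A) \<union> (A - A')) \<union> ((B' - B) \<union> (B - B')) \<union> (A' - B') \<in> I"
    using d un by blast
  then show ?r by (rule down) blast
next
  assume ?r
  then show ?l using assms unfolding ideal_forcing_def quotient_forcing_def by blast
qed

section \<open>Cohen and random forcing, products\<close>

definition cohen_forcing :: "bool list rel" where
  "cohen_forcing = {(q, p). prefix p q}"

text \<open>Lebesgue measure on the Cantor space is the fair coin-tossing measure.\<close>

definition cantor_measure :: "(nat \<Rightarrow> bool) measure" where
  "cantor_measure = Pi\<^sub>M UNIV (\<lambda>_. uniform_count_measure (UNIV :: bool set))"

instance bool :: second_countable_topology
proof
  show "\<exists>B :: bool set set. countable B \<and> open = generate_topology B"
    by (intro exI[of _ UNIV]) (auto simp: fun_eq_iff Topological_Spaces.open_discrete intro: generate_topology.Basis)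
qed

lemma sets_cantor_measure: "sets cantor_measure = sets (borel :: (nat \<Rightarrow> bool) measure)"
proof -
  have "sets cantor_measure = sets (Pi\<^sub>M UNIV (\<lambda>_::nat. borel :: bool measure))"
    unfolding cantor_measure_def
    by (rule sets_PiM_cong) (simp_all add: sets_uniform_count_measure sets_borel_eq_count_space)
  then show ?thesis by (simp add: sets_PiM_equal_borel)
qed

lemma prob_space_cantor_measure: "prob_space cantor_measure"
  unfolding cantor_measure_def
  by (intro prob_space_PiM prob_space_uniform_count_measure) auto

definition random_forcing :: "(nat \<Rightarrow> bool) set set rel" where
  "random_forcing = quotient_forcing (sets cantor_measure) (null_sets cantor_measure)"

definition prod_forcing :: "'a rel \<Rightarrow> 'b rel \<Rightarrow> ('a \<times> 'b) rel" where
  "prod_forcing r s = {((p', q'), (p, q)). (p', p) \<in> r \<and> (q', q) \<in> s}"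

section \<open>Boolean completion and isomorphism of forcing notions\<close>

text \<open>
  The Boolean completion is the algebra of regular open sets of the topology whose open sets
  are the sets of conditions closed under strengthening.
\<close>

definition forcing_topology :: "'a rel \<Rightarrow> 'a topology" where
  "forcing_topology r = topology (\<lambda>U. U \<subseteq> Field r \<and> (\<forall>p\<in>U. \<forall>q. (q, p) \<in> r \<longrightarrow> q \<in> U))"

lemma openin_forcing_topology:
  "openin (forcing_topology r) U \<longleftrightarrow> U \<subseteq> Field r \<and> (\<forall>p\<in>U. \<forall>q. (q, p) \<in> r \<longrightarrow> q \<in> U)"
proof -
  have "istopology (\<lambda>U. U \<subseteq> Field r \<and> (\<forall>p\<in>U. \<forall>q. (q, p) \<in> r \<longrightarrow> q \<in> U))"
    unfolding istopology_def by blast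
  then show ?thesis unfolding forcing_topology_def by (simp add: topology_inverse')
qed

definition boolean_completion :: "'a rel \<Rightarrow> 'a set set" where
  "boolean_completion r =
     {U. U \<subseteq> Field r \<and> forcing_topology r interior_of (forcing_topology r closure_of U) = U}"

text \<open>
  The order of the completion is inclusion. The Boolean operations are determined by the order,
  so the isomorphisms of Boolean algebras are exactly the order isomorphisms.
\<close>

definition forcing_isomorphic :: "'a rel \<Rightarrow> 'b rel \<Rightarrow> bool" where
  "forcing_isomorphic r s \<longleftrightarrow>
     (\<exists>f. bij_betw f (boolean_completion r) (boolean_completion s) \<and>
        (\<forall>U\<in>boolean_completion r. \<forall>V\<in>boolean_completion r. f U \<subseteq> f V \<longleftrightarrow> U \<subseteq> V))"

end

theory Submission
  imports Defs
begin

text \<open>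
  Suppose that \<open>\<P>(X)/I\<close> is isomorphic to the product. The two generic reals are induced by
  maps \<open>c, s : X \<rightarrow> 2\<^sup>\<omega>\<close> with the following property: every \<open>I\<close>-positive set contains, up to a null set,
  one of the positive sets \<open>{x. t \<subseteq> c x, s x \<in> P}\<close>. Let \<open>\<theta>\<close> be the least number of sets in \<open>I\<close> with a
  positive union and index such a family by a set \<open>L \<subseteq> 2\<^sup>\<omega>\<close> of size \<open>\<theta>\<close>; this gives a map \<open>h\<close> from a
  positive set to \<open>L\<close> under which proper initial segments of \<open>L\<close> have null preimages. There are two cases.

  If, below some condition, membership of \<open>h x\<close> in any \<open>Y \<subseteq> L\<close> is determined by the random real alone,
  then \<open>L\<close> carries a countably additive atomless total measure. The Cohen real provides, for every \<open>i \<in> L\<close>,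
  a null set that covers the initial segment below \<open>i\<close>, and these null sets form a set that is measurable
  in the square of \<open>L\<close>. This contradicts Fubini's theorem.

  Otherwise every condition can be extended in two ways that decide some \<open>Y \<subseteq> L\<close> differently over the
  random real. Finitely many such splittings give many reachable values in a finite set, and a random
  2-colouring of these values makes both colours reachable with high probability. Hence there are
  functions \<open>f\<^sub>n : L \<rightarrow> \<nat>\<close> such that \<open>(f\<^sub>n (h x))\<^sub>n\<close> is a Cohen real over the extension by the random real.
  Read \<open>f\<^sub>n z\<close> as the code of a clopen function of the random real that guesses \<open>n\<close> bits. Since fewer than \<open>\<theta>\<close>
  guesses can be evaded by a random real, there is a name for a real that eventually evades the guesses
  of all \<open>z\<close> below \<open>h x\<close>. By genericity some fixed \<open>z\<close> guesses this name correctly infinitely often, although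
  \<open>z\<close> lies below \<open>h x\<close> for almost all \<open>x\<close>.
\<close>

section \<open>The coin-tossing measure on the Cantor space\<close>

definition pr :: "nat \<Rightarrow> (nat \<Rightarrow> bool) \<Rightarrow> bool list" where
  "pr n w = map w [0..<n]"

definition pre :: "bool list \<Rightarrow> (nat \<Rightarrow> bool) \<Rightarrow> bool" where
  "pre t w \<longleftrightarrow> pr (length t) w = t"

lemma length_pr [simp]: "length (pr n w) = n"
  by (simp add: pr_def)

lemma nth_pr [simp]: "i < n \<Longrightarrow> pr n w ! i = w i"
  by (simp add: pr_def)

lemma take_pr: "m \<le> n \<Longrightarrow> take m (pr n w) = pr m w"
  by (simp add: pr_def take_map)

lemma pre_iff: "pre t w \<longleftrightarrow> (\<forall>i<length t. w i = t ! i)"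
  by (auto simp: pre_def list_eq_iff_nth_eq)

lemma pre_prefix: "prefix t t' \<Longrightarrow> pre t' w \<Longrightarrow> pre t w"
  by (auto simp: pre_iff prefix_def nth_append)

lemma pre_comparable: "pre t w \<Longrightarrow> pre t' w \<Longrightarrow> prefix t t' \<or> prefix t' t"
  by (metis nat_le_linear pre_def take_is_prefix take_pr)

interpretation cantor: prob_space cantor_measure
  by (rule prob_space_cantor_measure)

lemma space_cantor [simp]: "space cantor_measure = UNIV"
  by (simp add: cantor_measure_def space_PiM space_uniform_count_measure)

lemma measurable_cantor_bit [measurable]: "(\<lambda>w. w i) \<in> measurable cantor_measure (count_space UNIV)"
proof -
  have "(\<lambda>w. w i) \<in> measurable cantor_measure (uniform_count_measure UNIV)"
    unfolding cantor_measure_def by (rule measurable_component_singleton) simp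
  then show ?thesis
    by (subst measurable_cong_sets[OF refl]) (auto simp: sets_uniform_count_measure)
qed

lemma measurable_pr [measurable]: "pr n \<in> measurable cantor_measure (count_space UNIV)"
proof (induction n)
  case 0
  then show ?case by (simp add: pr_def[abs_def])
next
  case (Suc n)
  have eq: "pr (Suc n) = (\<lambda>w. pr n w @ [w n])"
    by (auto simp: pr_def)
  have "(\<lambda>w. (pr n w, w n)) \<in> measurable cantor_measure (count_space UNIV \<Otimes>\<^sub>M count_space UNIV)"
    using Suc by measurable
  then have "(\<lambda>w. (pr n w, w n)) \<in> measurable cantor_measure (count_space UNIV)"
    by (simp add: pair_measure_countable)
  then have "(\<lambda>w. (\<lambda>(u, b). u @ [b]) (pr n w, w n)) \<in> measurable cantor_measure (count_space UNIV)"
    by (rule measurable_compose) simp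
  then show ?case by (simp add: eq)
qed

lemma sets_pre [measurable]: "{w. pre t w} \<in> sets cantor_measure"
proof -
  have "{w. pre t w} = pr (length t) -` {t} \<inter> space cantor_measure"
    by (auto simp: pre_def)
  also have "\<dots> \<in> sets cantor_measure"
    by (rule measurable_sets[OF measurable_pr]) simp
  finally show ?thesis .
qed

lemma measure_pre: "measure cantor_measure {w. pre t w} = (1/2) ^ length t"
proof -
  interpret product_prob_space "\<lambda>_::nat. uniform_count_measure (UNIV :: bool set)" UNIV
    by (intro product_prob_spaceI prob_space_uniform_count_measure) auto
  have eq: "{w. pre t w} = prod_emb UNIV (\<lambda>_. uniform_count_measure (UNIV :: bool set)) {..<length t}
      (Pi\<^sub>E {..<length t} (\<lambda>i. {t ! i}))"
    by (auto simp: prod_emb_def pre_iff space_PiM PiE_iff extensional_def restrict_def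
        space_uniform_count_measure)
  have "emeasure cantor_measure {w. pre t w}
      = (\<Prod>i<length t. emeasure (uniform_count_measure (UNIV :: bool set)) {t ! i})"
    unfolding eq cantor_measure_def by (rule emeasure_PiM_emb) (auto simp: sets_uniform_count_measure)
  also have "\<dots> = (\<Prod>i<length t. ennreal (1/2))"
    by (intro prod.cong refl) (simp add: emeasure_uniform_count_measure UNIV_bool)
  also have "\<dots> = ennreal ((1/2) ^ length t)"
    by (subst prod_ennreal) auto
  finally show ?thesis by (simp add: measure_def)
qed

text \<open>A countable subfamily whose union has the largest possible measure must absorb every
  other member up to a null set, since adjoining that member cannot increase the measure. This
  provides essential unions of uncountable families.\<close>

lemma (in finite_measure) exhaustion:
  assumes "\<C> \<subseteq> sets M"
  shows "\<exists>\<C>'. countable \<C>' \<and> \<C>' \<subseteq> \<C> \<and> (\<forall>C\<in>\<C>. C - \<Union>\<C>' \<in> null_sets M)"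
proof -
  define F where "F = {\<D>. countable \<D> \<and> \<D> \<subseteq> \<C>}"
  define m where "m = (SUP \<D>\<in>F. measure M (\<Union>\<D>))"
  have ne: "F \<noteq> {}" by (auto simp: F_def)
  have bdd: "bdd_above ((\<lambda>\<D>. measure M (\<Union>\<D>)) ` F)"
    by (auto intro!: bdd_aboveI2 bounded_measure)
  have le: "measure M (\<Union>\<D>) \<le> m" if "\<D> \<in> F" for \<D>
    unfolding m_def using that bdd by (rule cSUP_upper)
  have Fs: "\<Union>\<D> \<in> sets M" if "\<D> \<in> F" for \<D>
    using that assms by (auto simp: F_def intro!: sets.countable_Union)
  have "\<exists>\<D>\<in>F. m - 1 / Suc n < measure M (\<Union>\<D>)" for n
    using less_cSUP_iff[OF ne bdd, of "m - 1 / Suc n"] by (simp add: m_def)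
  then obtain \<D> where D: "\<And>n. \<D> n \<in> F" "\<And>n. m - 1 / Suc n < measure M (\<Union>(\<D> n))"
    by metis
  define \<C>' where "\<C>' = (\<Union>n. \<D> n)"
  have C': "\<C>' \<in> F" using D(1) by (auto simp: \<C>'_def F_def)
  have h: "m - 1 / Suc n \<le> measure M (\<Union>\<C>')" for n
  proof -
    have "measure M (\<Union>(\<D> n)) \<le> measure M (\<Union>\<C>')"
      using Fs[OF C'] by (intro finite_measure_mono) (auto simp: \<C>'_def)
    then show ?thesis using D(2)[of n] by simp
  qed
  have m: "m \<le> measure M (\<Union>\<C>')"
  proof (rule field_le_epsilon)
    fix e :: real assume "0 < e"
    then obtain n where "1 / Suc n < e" using nat_approx_posE by blast
    then show "m \<le> measure M (\<Union>\<C>') + e" using h[of n] by linarith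
  qed
  show ?thesis
  proof (intro exI[of _ \<C>'] conjI ballI)
    show "countable \<C>'" "\<C>' \<subseteq> \<C>" using C' by (auto simp: F_def)
    fix C assume C: "C \<in> \<C>"
    have "insert C \<C>' \<in> F" using C' C by (auto simp: F_def)
    from le[OF this] have "measure M (\<Union>\<C>' \<union> (C - \<Union>\<C>')) \<le> measure M (\<Union>\<C>')"
      using m by (simp add: Un_commute)
    moreover have "measure M (\<Union>\<C>' \<union> (C - \<Union>\<C>')) = measure M (\<Union>\<C>') + measure M (C - \<Union>\<C>')"
      using Fs[OF C'] C assms by (intro finite_measure_Union) auto
    ultimately have "measure M (C - \<Union>\<C>') = 0"
      using measure_nonneg[of M "C - \<Union>\<C>'"] by linarith
    then show "C - \<Union>\<C>' \<in> null_sets M"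
      using Fs[OF C'] C assms by (auto simp: null_sets_def emeasure_eq_measure)
  qed
qed

text \<open>Dominated convergence applied to the indicators. It makes exceptional sets small once
  almost every point leaves them eventually.\<close>

lemma (in finite_measure) measure_eventually_avoided:
  assumes E [measurable]: "\<And>n. E n \<in> sets M"
    and ae: "AE w in M. \<forall>\<^sub>F n in sequentially. w \<notin> E n"
  shows "(\<lambda>n. measure M (E n)) \<longlonglongrightarrow> 0"
proof -
  have "(\<lambda>n. \<integral>w. indicator (E n) w \<partial>M) \<longlonglongrightarrow> (\<integral>w. (0::real) \<partial>M)"
  proof (rule integral_dominated_convergence[where w = "\<lambda>_. 1"])
    show "AE w in M. (\<lambda>n. indicator (E n) w) \<longlonglongrightarrow> (0::real)"
      using ae
    proof eventually_elim
      case (elim w)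
      then have "\<forall>\<^sub>F n in sequentially. indicator (E n) w = (0::real)"
        by eventually_elim simp
      then show ?case by (rule tendsto_eventually)
    qed
  qed auto
  then show ?thesis by simp
qed

text \<open>Borel-Cantelli, with the geometric bound as the standard summable error.\<close>

lemma (in finite_measure) AE_eventually_not_in:
  assumes "\<And>n. E n \<in> sets M" "\<And>n. measure M (E n) \<le> (1/2) ^ n"
  shows "AE w in M. \<forall>\<^sub>F n in sequentially. w \<notin> E n"
proof -
  have "summable (\<lambda>n. measure M (E n))"
    by (rule summable_comparison_test[OF _ summable_geometric[of "1/2::real"]])
       (use assms(2) in auto)
  from borel_cantelli_AE1[OF assms(1) _ this]
  have "AE w in M. \<forall>\<^sub>F n in sequentially. w \<in> space M - E n"
    by (simp add: emeasure_eq_measure)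
  then show ?thesis
    by eventually_elim (auto elim: eventually_mono)
qed

section \<open>Clopen functions and their density\<close>

definition cyl :: "bool list list \<Rightarrow> (nat \<Rightarrow> bool) set" where
  "cyl us = {w. \<exists>u\<in>set us. pre u w}"

text \<open>\<open>k\<close> decodes to a list of finite unions of cylinders, one for each output
  bit. Thus natural numbers code the clopen functions from the Cantor space to finite words, and a
  number can serve as a guess that depends on the random real.\<close>

definition clopen_fun :: "nat \<Rightarrow> (nat \<Rightarrow> bool) \<Rightarrow> bool list" where
  "clopen_fun k w = map (\<lambda>us. w \<in> cyl us) (from_nat k)"

lemma sets_cyl [measurable]: "cyl us \<in> sets cantor_measure"
proof -
  have "cyl us = (\<Union>u\<in>set us. {w. pre u w})" by (auto simp: cyl_def)
  then show ?thesis by (auto intro!: sets.finite_UN sets_pre)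
qed

lemma sets_pr_in [measurable]: "{w. pr n w \<in> U} \<in> sets cantor_measure"
  using measurable_sets[OF measurable_pr[of n], of U] by (simp add: vimage_def)

lemma pr_in_eq_cyl: "\<exists>us. {w. pr n w \<in> U} = cyl us"
proof -
  have "finite {u \<in> U. length u = n}"
    by (rule finite_subset[OF _ finite_lists_length_eq[of UNIV n]]) auto
  then obtain us where us: "set us = {u \<in> U. length u = n}"
    using finite_list by blast
  have "{w. pr n w \<in> U} = cyl us"
    by (auto simp: cyl_def us pre_def)
  then show ?thesis by blast
qed

lemma sets_cantor_sigma_sets:
  "sets cantor_measure = sigma_sets UNIV {{f. f i \<in> A} |(i::nat) (A :: bool set). True}"
  unfolding cantor_measure_def
  by (subst sets_PiM_single) (simp add: space_uniform_count_measure sets_uniform_count_measure)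

text \<open>The sets approximable by conditions on finitely many bits contain the coordinate sets
  and are closed under complements and countable unions, so they exhaust the sigma-algebra.\<close>

lemma cantor_clopen_approx:
  assumes "B \<in> sets cantor_measure" "0 < \<epsilon>"
  shows "\<exists>us. measure cantor_measure (sym_diff B (cyl us)) < \<epsilon>"
proof -
  let ?M = cantor_measure
  define G where "G = {{f. f i \<in> A} |(i::nat) (A :: bool set). True}"
  have sG: "sets ?M = sigma_sets UNIV G"
    unfolding G_def by (rule sets_cantor_sigma_sets)
  have "\<forall>\<epsilon>>0. \<exists>n U. measure ?M (sym_diff B {w. pr n w \<in> U}) < \<epsilon>"
    if "B \<in> sigma_sets UNIV G" for B
    using that
  proof (induction rule: sigma_sets.induct)
    case (Basic a)
    then obtain i A where a: "a = {f. f i \<in> A}" by (auto simp: G_def)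
    then have "sym_diff a {w. pr (Suc i) w \<in> {u. u ! i \<in> A}} = {}" by auto
    then have "measure ?M (sym_diff a {w. pr (Suc i) w \<in> {u. u ! i \<in> A}}) = 0" by (simp only: measure_empty)
    then show ?case by (intro allI impI exI[of _ "Suc i"] exI[of _ "{u. u ! i \<in> A}"]) simp
  next
    case Empty
    show ?case by (intro allI impI exI[of _ 0] exI[of _ "{}"]) simp
  next
    case (Compl a)
    have eq: "sym_diff (UNIV - a) {w. pr n w \<in> - U} = sym_diff a {w. pr n w \<in> U}" for n U
      by auto
    show ?case
    proof (intro allI impI)
      fix \<epsilon> :: real assume "0 < \<epsilon>"
      then obtain n U where "measure ?M (sym_diff a {w. pr n w \<in> U}) < \<epsilon>" using Compl.IH by blast
      then show "\<exists>n U. measure ?M (sym_diff (UNIV - a) {w. pr n w \<in> U}) < \<epsilon>"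
        unfolding eq[symmetric] by blast
    qed
  next
    case (Union a)
    have a [measurable]: "a i \<in> sets ?M" for i using Union.hyps sG by auto
    show ?case
    proof (intro allI impI)
      fix \<epsilon> :: real assume e: "0 < \<epsilon>"
      \<comment> \<open>Half of the error pays for cutting the union after \<open>k\<close> sets,
        the other half for approximating these \<open>k\<close> sets by conditions on one common
        length.\<close>
      have "(\<lambda>k. measure ?M (\<Union>(range a) - (\<Union>i<k. a i))) \<longlonglongrightarrow> 0"
      proof (rule cantor.measure_eventually_avoided)
        have "\<forall>\<^sub>F k in sequentially. w \<notin> \<Union>(range a) - (\<Union>i<k. a i)" for w
        proof (cases "w \<in> \<Union>(range a)")
          case True
          then obtain i where "w \<in> a i" by blast
          then show ?thesis unfolding eventually_sequentially by (intro exI[of _ "Suc i"]) auto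
        qed simp
        then show "AE w in ?M. \<forall>\<^sub>F k in sequentially. w \<notin> \<Union>(range a) - (\<Union>i<k. a i)" by simp
      qed simp
      then obtain k where k: "measure ?M (\<Union>(range a) - (\<Union>i<k. a i)) < \<epsilon> / 2"
        using e order_tendstoD(2)[of _ 0 sequentially "\<epsilon> / 2"] eventually_sequentially by fastforce
      have "\<exists>n U. measure ?M (sym_diff (a i) {w. pr n w \<in> U}) < \<epsilon> / 2 / Suc k" for i
        using Union.IH[of i] e by simp
      then obtain n U where nU: "\<And>i. measure ?M (sym_diff (a i) {w. pr (n i) w \<in> U i}) < \<epsilon> / 2 / Suc k"
        by metis
      define N where "N = Max (insert 0 (n ` {..<k}))"
      have N: "n i \<le> N" if "i < k" for i
        using that unfolding N_def by (intro Max_ge) auto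
      define V where "V = {u. \<exists>i<k. take (n i) u \<in> U i}"
      have V: "pr N w \<in> V \<longleftrightarrow> (\<exists>i<k. pr (n i) w \<in> U i)" for w
        unfolding V_def using N by (auto simp: take_pr)
      have "sym_diff (\<Union>(range a)) {w. pr N w \<in> V} \<subseteq>
        (\<Union>(range a) - (\<Union>i<k. a i)) \<union> (\<Union>i<k. sym_diff (a i) {w. pr (n i) w \<in> U i})"
        by (auto simp: V)
      then have "measure ?M (sym_diff (\<Union>(range a)) {w. pr N w \<in> V}) \<le>
        measure ?M ((\<Union>(range a) - (\<Union>i<k. a i)) \<union> (\<Union>i<k. sym_diff (a i) {w. pr (n i) w \<in> U i}))"
        by (rule cantor.finite_measure_mono) auto
      also have "\<dots> \<le> measure ?M (\<Union>(range a) - (\<Union>i<k. a i))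
          + measure ?M (\<Union>i<k. sym_diff (a i) {w. pr (n i) w \<in> U i})"
        by (rule measure_Un_le) auto
      also have "measure ?M (\<Union>i<k. sym_diff (a i) {w. pr (n i) w \<in> U i})
          \<le> (\<Sum>i<k. measure ?M (sym_diff (a i) {w. pr (n i) w \<in> U i}))"
        by (rule measure_UNION_le) auto
      also have "\<dots> \<le> (\<Sum>i<k. \<epsilon> / 2 / Suc k)"
        by (intro sum_mono less_imp_le nU)
      also have "\<dots> \<le> \<epsilon> / 2"
        using e by (simp add: field_simps)
      finally show "\<exists>n U. measure ?M (sym_diff (\<Union>(range a)) {w. pr n w \<in> U}) < \<epsilon>"
        using k by (intro exI[of _ N] exI[of _ V]) simp
    qed
  qed
  then obtain n U where "measure ?M (sym_diff B {w. pr n w \<in> U}) < \<epsilon>"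
    using assms sG by blast
  then show ?thesis using pr_in_eq_cyl[of n U] by auto
qed

lemma measurable_clopen_fun [measurable]:
  "clopen_fun k \<in> measurable cantor_measure (count_space UNIV)"
proof -
  have "(\<lambda>w. map (\<lambda>us. w \<in> cyl us) uss) \<in> measurable cantor_measure (count_space UNIV)" for uss
  proof (induction uss)
    case (Cons us uss)
    have m: "(\<lambda>w. w \<in> cyl us) \<in> measurable cantor_measure (count_space UNIV)"
      by measurable
    have "(\<lambda>w. (w \<in> cyl us, map (\<lambda>us. w \<in> cyl us) uss)) \<in>
        measurable cantor_measure (count_space UNIV \<Otimes>\<^sub>M count_space UNIV)"
      by (rule measurable_Pair[OF m Cons])
    then have "(\<lambda>w. (w \<in> cyl us, map (\<lambda>us. w \<in> cyl us) uss)) \<in>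
        measurable cantor_measure (count_space UNIV)"
      by (simp add: pair_measure_countable)
    then have "(\<lambda>w. (\<lambda>(b, v). b # v) (w \<in> cyl us, map (\<lambda>us. w \<in> cyl us) uss))
        \<in> measurable cantor_measure (count_space UNIV)"
      by (rule measurable_compose) simp
    then show ?case by simp
  qed simp
  then show ?thesis by (simp add: clopen_fun_def[abs_def])
qed

text \<open>Approximate the event behind each of the \<open>n\<close> output bits separately and add
  the errors; the divisor \<open>Suc n\<close> also covers \<open>n = 0\<close>.\<close>

lemma clopen_fun_dense:
  assumes [measurable]: "\<kappa> \<in> measurable cantor_measure (count_space UNIV)"
    and len: "\<And>w. length (\<kappa> w) = n" and "0 < \<epsilon>"
  shows "\<exists>k. measure cantor_measure {w. clopen_fun k w \<noteq> \<kappa> w} \<le> \<epsilon>"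
proof -
  let ?M = cantor_measure
  define B where "B i = {w. \<kappa> w ! i}" for i
  have B [measurable]: "B i \<in> sets ?M" for i
    using measurable_sets[OF assms(1), of "{v. v ! i}"] by (simp add: B_def vimage_def)
  have "\<exists>us. measure ?M (sym_diff (B i) (cyl us)) < \<epsilon> / Suc n" for i
    using assms(3) by (intro cantor_clopen_approx) auto
  then obtain us where us: "\<And>i. measure ?M (sym_diff (B i) (cyl (us i))) < \<epsilon> / Suc n"
    by metis
  have c: "clopen_fun (to_nat (map us [0..<n])) w = map (\<lambda>i. w \<in> cyl (us i)) [0..<n]" for w
    by (simp add: clopen_fun_def)
  have "{w. clopen_fun (to_nat (map us [0..<n])) w \<noteq> \<kappa> w} \<subseteq> (\<Union>i<n. sym_diff (B i) (cyl (us i)))"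
    by (auto simp: c list_eq_iff_nth_eq len B_def)
  then have "measure ?M {w. clopen_fun (to_nat (map us [0..<n])) w \<noteq> \<kappa> w}
      \<le> measure ?M (\<Union>i<n. sym_diff (B i) (cyl (us i)))"
    by (rule cantor.finite_measure_mono) measurable
  also have "\<dots> \<le> (\<Sum>i<n. measure ?M (sym_diff (B i) (cyl (us i))))"
    by (rule measure_UNION_le) auto
  also have "\<dots> \<le> (\<Sum>i<n. \<epsilon> / Suc n)"
    by (intro sum_mono less_imp_le us)
  also have "\<dots> \<le> \<epsilon>"
    using assms(3) by (simp add: field_simps)
  finally show ?thesis by blast
qed

section \<open>Deciding sets over the random real\<close>

text \<open>\<open>c\<close> and \<open>s\<close> stand for the generic Cohen and random reals. By
  \<open>dense\<close>, the events given by a finite word \<open>t\<close> and a positive measurable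
  set \<open>P\<close> are dense below every positive set, so questions about \<open>I\<close>
  become questions about words and measure.\<close>

locale cohen_random_rep =
  fixes X :: "'a set" and I :: "'a set set" and c s :: "'a \<Rightarrow> nat \<Rightarrow> bool"
  assumes I_carrier: "A \<in> I \<Longrightarrow> A \<subseteq> X"
    and I_subset: "A \<in> I \<Longrightarrow> B \<subseteq> A \<Longrightarrow> B \<in> I"
    and I_Union: "countable F \<Longrightarrow> F \<subseteq> I \<Longrightarrow> \<Union>F \<in> I"
    and null_in_I: "N \<in> null_sets cantor_measure \<Longrightarrow> {x \<in> X. s x \<in> N} \<in> I"
    and positive_notin_I: "P \<in> sets cantor_measure - null_sets cantor_measure \<Longrightarrow>
      {x \<in> X. pre t (c x) \<and> s x \<in> P} \<notin> I"
    and dense: "A \<subseteq> X \<Longrightarrow> A \<notin> I \<Longrightarrow>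
      \<exists>t. \<exists>P\<in>sets cantor_measure - null_sets cantor_measure. {x \<in> X. pre t (c x) \<and> s x \<in> P} - A \<in> I"
begin

abbreviation "M \<equiv> cantor_measure"

definition ev :: "bool list \<Rightarrow> (nat \<Rightarrow> bool) set \<Rightarrow> 'a set" where
  "ev t P = {x \<in> X. pre t (c x) \<and> s x \<in> P}"

lemma ev_subset: "ev t P \<subseteq> X"
  by (auto simp: ev_def)

lemma ev_prefix: "prefix t t' \<Longrightarrow> ev t' P \<subseteq> ev t P"
  by (auto simp: ev_def dest: pre_prefix)

lemma I_UN: "countable J \<Longrightarrow> (\<And>j. j \<in> J \<Longrightarrow> A j \<in> I) \<Longrightarrow> (\<Union>j\<in>J. A j) \<in> I"
  by (rule I_Union) auto

lemma I_empty [simp]: "{} \<in> I"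
  using I_Union[of "{}"] by simp

lemma I_Un: "A \<in> I \<Longrightarrow> B \<in> I \<Longrightarrow> A \<union> B \<in> I"
  using I_Union[of "{A, B}"] by simp

lemma ev_notin_I: "P \<in> sets M - null_sets M \<Longrightarrow> ev t P \<notin> I"
  unfolding ev_def by (rule positive_notin_I)

lemma dense_ev:
  assumes "A \<subseteq> X" "A \<notin> I"
  obtains t P where "P \<in> sets M - null_sets M" "ev t P - A \<in> I"
  using dense[OF assms] unfolding ev_def by blast

lemma X_notin_I: "X \<notin> I"
proof -
  have "UNIV \<in> sets M - null_sets M"
    using cantor.emeasure_space_1 sets.top[of M] by (auto simp: null_sets_def)
  from ev_notin_I[OF this, of "[]"] show ?thesis
    using I_subset[OF _ ev_subset] by blast
qed

lemma not_AE_positive: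
  assumes "{w. \<phi> w} \<in> sets M" "\<not> (AE w in M. \<not> \<phi> w)"
  shows "{w. \<phi> w} \<in> sets M - null_sets M"
  using assms AE_iff_null[of M "\<lambda>w. \<not> \<phi> w"] by auto

text \<open>
  In the extension by the random real \<open>w\<close>, the condition \<open>t\<close> forces the generic point into \<open>A\<close> iff
  \<open>w \<in> dec t A\<close>. The set is determined only up to null sets.
\<close>

definition dec :: "bool list \<Rightarrow> 'a set \<Rightarrow> (nat \<Rightarrow> bool) set" where
  "dec t A = (SOME Q. Q \<in> sets M \<and> ev t Q - A \<in> I \<and>
     (\<forall>Q'\<in>sets M. ev t Q' - A \<in> I \<longrightarrow> Q' - Q \<in> null_sets M))"

text \<open>Exhaustion provides a countable union that absorbs all candidates, and countable
  completeness of \<open>I\<close> makes this union a candidate itself.\<close>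

lemma dec:
  "dec t A \<in> sets M" "ev t (dec t A) - A \<in> I"
  "Q' \<in> sets M \<Longrightarrow> ev t Q' - A \<in> I \<Longrightarrow> Q' - dec t A \<in> null_sets M"
proof -
  let ?C = "{Q \<in> sets M. ev t Q - A \<in> I}"
  have "?C \<subseteq> sets M" by auto
  from cantor.exhaustion[OF this] obtain \<C>' where
    C': "countable \<C>'" "\<C>' \<subseteq> ?C" "\<forall>C\<in>?C. C - \<Union>\<C>' \<in> null_sets M"
    by (elim exE conjE)
  have "ev t (\<Union>\<C>') - A = (\<Union>Q\<in>\<C>'. ev t Q - A)"
    by (auto simp: ev_def)
  also have "\<dots> \<in> I" using C' by (intro I_UN) auto
  finally have "\<exists>Q. Q \<in> sets M \<and> ev t Q - A \<in> I \<and>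
     (\<forall>Q'\<in>sets M. ev t Q' - A \<in> I \<longrightarrow> Q' - Q \<in> null_sets M)"
    using C' by (intro exI[of _ "\<Union>\<C>'"]) auto
  from someI_ex[OF this, folded dec_def]
  show "dec t A \<in> sets M" "ev t (dec t A) - A \<in> I"
    "Q' \<in> sets M \<Longrightarrow> ev t Q' - A \<in> I \<Longrightarrow> Q' - dec t A \<in> null_sets M"
    by blast+
qed

lemma sets_dec [measurable]: "dec t A \<in> sets M"
  by (rule dec)

lemma AE_dec:
  assumes "Q \<in> sets M" "ev t Q - A \<in> I"
  shows "AE w in M. w \<in> Q \<longrightarrow> w \<in> dec t A"
  by (rule AE_I'[OF dec(3)[OF assms]]) auto

lemma AE_dec_mono:
  assumes "prefix t t'" "A - B \<in> I"
  shows "AE w in M. w \<in> dec t A \<longrightarrow> w \<in> dec t' B"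
proof (rule AE_dec)
  have "ev t' (dec t A) - B \<subseteq> (ev t (dec t A) - A) \<union> (A - B)"
    using ev_prefix[OF assms(1)] by blast
  then show "ev t' (dec t A) - B \<in> I"
    by (rule I_subset[OF I_Un[OF dec(2) assms(2)]])
qed simp

text \<open>There are only countably many words, so one null set serves all of them. Such facts are
  collected first, and the argument then runs for a fixed \<open>w\<close>.\<close>

lemma AE_dec_ext: "AE w in M. \<forall>t t'. prefix t t' \<longrightarrow> w \<in> dec t A \<longrightarrow> w \<in> dec t' A"
  unfolding AE_all_countable by (auto intro: AE_dec_mono)

lemma AE_dec_Int: "AE w in M. w \<in> dec t A \<and> w \<in> dec t B \<longrightarrow> w \<in> dec t (A \<inter> B)"
proof -
  have "ev t (dec t A \<inter> dec t B) - A \<inter> B \<subseteq> (ev t (dec t A) - A) \<union> (ev t (dec t B) - B)"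
    by (auto simp: ev_def)
  from AE_dec[OF _ I_subset[OF I_Un[OF dec(2) dec(2)] this]] show ?thesis by simp
qed

lemma ev_subset_dec:
  assumes "Q \<subseteq> dec t A"
  shows "ev t Q - A \<in> I"
proof (rule I_subset[OF dec(2)])
  show "ev t Q - A \<subseteq> ev t (dec t A) - A" using assms by (auto simp: ev_def)
qed

lemma AE_dec_in_I:
  assumes "A \<in> I"
  shows "AE w in M. w \<notin> dec t A"
proof (rule ccontr)
  assume "\<not> ?thesis"
  then have "{w. w \<in> dec t A} \<in> sets M - null_sets M"
    by (intro not_AE_positive) auto
  then have "ev t (dec t A) \<notin> I" by (intro ev_notin_I) simp
  moreover have "ev t (dec t A) \<in> I"
    by (rule I_subset[OF I_Un[OF dec(2)[of t A] assms]]) blast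
  ultimately show False by blast
qed

lemma AE_dec_disjoint:
  assumes "A \<inter> B \<in> I"
  shows "AE w in M. \<not> (w \<in> dec t A \<and> w \<in> dec t B)"
  using AE_dec_Int[of t A B] AE_dec_in_I[OF assms, of t] by eventually_elim auto

text \<open>This is genericity. If the set \<open>R\<close> of counterexamples were positive,
  countable completeness would make \<open>ev t R\<close> meet some \<open>A j\<close> positively,
  and a condition inside that intersection would decide \<open>A j\<close> on part of
  \<open>R\<close>.\<close>

lemma AE_dec_dense:
  assumes J: "countable J"
  shows "AE w in M. w \<in> dec t (\<Union>j\<in>J. A j) \<longrightarrow> (\<exists>t'. prefix t t' \<and> (\<exists>j\<in>J. w \<in> dec t' (A j)))"
proof (rule ccontr)
  let ?E = "\<lambda>w. w \<in> dec t (\<Union>j\<in>J. A j) \<and> \<not> (\<exists>t'. prefix t t' \<and> (\<exists>j\<in>J. w \<in> dec t' (A j)))"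
  define R where "R = {w. ?E w}"
  have R_eq: "R = dec t (\<Union>j\<in>J. A j) - (\<Union>t'\<in>{t'. prefix t t'}. \<Union>j\<in>J. dec t' (A j))"
    by (auto simp: R_def)
  have sR: "R \<in> sets M"
    unfolding R_eq using J by (intro sets.Diff sets.countable_UN'') auto
  assume "\<not> ?thesis"
  then have R: "R \<in> sets M - null_sets M"
    unfolding R_def by (intro not_AE_positive) (use sR in \<open>auto simp: R_def\<close>)
  have RA: "ev t R - (\<Union>j\<in>J. A j) \<in> I"
    by (rule ev_subset_dec) (auto simp: R_def)
  have "\<exists>j\<in>J. ev t R \<inter> A j \<notin> I"
  proof (rule ccontr)
    assume "\<not> ?thesis"
    then have "(\<Union>j\<in>J. ev t R \<inter> A j) \<in> I" by (intro I_UN J) auto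
    from I_Un[OF this RA] have "ev t R \<in> I" by (rule I_subset) blast
    then show False using ev_notin_I[OF R] by blast
  qed
  then obtain j where j: "j \<in> J" "ev t R \<inter> A j \<notin> I" by blast
  moreover have "ev t R \<inter> A j \<subseteq> X" using ev_subset by blast
  ultimately obtain u P where P: "P \<in> sets M - null_sets M" and u: "ev u P - ev t R \<inter> A j \<in> I"
    using dense_ev by metis
  have PR: "P - R \<in> null_sets M"
  proof (rule ccontr)
    assume "P - R \<notin> null_sets M"
    then have "ev u (P - R) \<notin> I" using P R by (intro ev_notin_I) auto
    moreover have "ev u (P - R) \<in> I" by (rule I_subset[OF u]) (auto simp: ev_def)
    ultimately show False by blast
  qed
  have "prefix t u \<or> prefix u t"
  proof (rule ccontr)
    assume "\<not> ?thesis"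
    then have "ev u P \<inter> ev t R = {}" using pre_comparable by (auto simp: ev_def)
    then have "ev u P \<in> I" using u by (metis Diff_triv Int_assoc Int_empty_left)
    then show False using ev_notin_I[OF P] by blast
  qed
  then obtain t' where t': "prefix t t'" "prefix u t'" by auto
  have "ev t' P - A j \<in> I"
    by (rule I_subset[OF u]) (use ev_prefix[OF t'(2)] in blast)
  then have "P - dec t' (A j) \<in> null_sets M"
    using P by (intro dec(3)) auto
  from null_sets.Un[OF this PR]
  have "P - dec t' (A j) \<union> (P - R) \<in> null_sets M" .
  moreover have "R \<inter> dec t' (A j) = {}" using t' j by (auto simp: R_def)
  then have "P - dec t' (A j) \<union> (P - R) = P" by blast
  ultimately show False using P by simp
qed

end

section \<open>A minimal family of null sets with positive union\<close>

lemma cantor_singleton_null: "{z} \<in> null_sets cantor_measure"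
proof -
  have eq: "{z} = (\<Inter>n. {w. pre (pr n z) w})"
  proof (auto simp: pre_def)
    fix w assume "\<forall>n. pr n w = pr n z"
    then have "w i = z i" for i
      using nth_pr[of i "Suc i" w] nth_pr[of i "Suc i" z] by simp
    then show "w = z" by blast
  qed
  have sets: "{z} \<in> sets cantor_measure"
    unfolding eq by (intro sets.countable_INT) auto
  have "measure cantor_measure {z} \<le> (1/2) ^ n" for n
  proof -
    have "measure cantor_measure {z} \<le> measure cantor_measure {w. pre (pr n z) w}"
      by (rule cantor.finite_measure_mono[OF _ sets_pre]) (auto simp: pre_def)
    then show ?thesis by (simp add: measure_pre)
  qed
  then have "measure cantor_measure {z} \<le> 0"
    by (intro LIMSEQ_le_const[OF LIMSEQ_power_zero[of "1/2::real"]]) auto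
  then show ?thesis
    using sets by (simp add: null_sets_def cantor.emeasure_eq_measure measure_le_0_iff)
qed

context cohen_random_rep
begin

text \<open>Take an index set \<open>Z\<close> of least cardinality for a family in \<open>I\<close>
  with union outside \<open>I\<close>, ordered in the type of its cardinal. Then \<open>X0\<close>
  is that union, \<open>h x\<close> is the first index whose set contains \<open>x\<close>, and
  \<open>low z\<close> is the set of predecessors of \<open>z\<close>, which is too small to index
  such a family.\<close>

lemma small_unions:
  obtains X0 :: "'a set" and h :: "'a \<Rightarrow> nat \<Rightarrow> bool" and low :: "(nat \<Rightarrow> bool) \<Rightarrow> (nat \<Rightarrow> bool) set"
  where "X0 \<subseteq> X" "X0 \<notin> I"
    "\<And>z. {x \<in> X0. h x = z} \<in> I"
    "\<And>x0. x0 \<in> X0 \<Longrightarrow> {x \<in> X0. h x0 \<notin> low (h x)} \<in> I"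
    "\<And>z (N :: (nat \<Rightarrow> bool) \<Rightarrow> 'a set). (\<And>y. y \<in> low z \<Longrightarrow> N y \<in> I) \<Longrightarrow> (\<Union>y\<in>low z. N y) \<in> I"
proof -
  define big where "big Z \<longleftrightarrow> (\<exists>N. (\<forall>z\<in>Z. N z \<in> I \<and> N z \<subseteq> X) \<and> (\<Union>z\<in>Z. N z) \<notin> I)"
    for Z :: "(nat \<Rightarrow> bool) set"
  \<comment> \<open>The fibres of \<open>s\<close> over single points lie in \<open>I\<close> and
    cover \<open>X\<close>, so some index set exists.\<close>
  have "big UNIV"
    unfolding big_def
  proof (intro exI[of _ "\<lambda>z. {x \<in> X. s x \<in> {z}}"] conjI ballI)
    have "(\<Union>z. {x \<in> X. s x \<in> {z}}) = X" by auto
    then show "(\<Union>z. {x \<in> X. s x \<in> {z}}) \<notin> I" using X_notin_I by simp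
  qed (use null_in_I[OF cantor_singleton_null] in auto)
  then have U: "UNIV \<in> Collect big" by simp
  have wf: "wf (inv_image ordLess (card_of :: (nat \<Rightarrow> bool) set \<Rightarrow> _))"
    by (intro wf_inv_image wf_ordLess)
  obtain Z where "Z \<in> Collect big"
      "\<And>Z'. (Z', Z) \<in> inv_image ordLess card_of \<Longrightarrow> Z' \<notin> Collect big"
    by (rule wfE_min[OF wf U]) blast
  then have Z: "big Z" and min: "\<And>Z'. (card_of Z', card_of Z) \<in> ordLess \<Longrightarrow> \<not> big Z'"
    by (auto simp: in_inv_image)
  then obtain N where N: "\<And>z. z \<in> Z \<Longrightarrow> N z \<in> I" "\<And>z. z \<in> Z \<Longrightarrow> N z \<subseteq> X" "(\<Union>z\<in>Z. N z) \<notin> I"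
    unfolding big_def by blast
  define r where "r = card_of Z"
  have r: "Card_order r" "Field r = Z"
    unfolding r_def by (rule card_of_Card_order, rule Field_card_of)
  have wo: "Well_order r" unfolding r_def by (rule card_of_Well_order)
  define h where "h x = (SOME z. z \<in> Z \<and> x \<in> N z \<and> (\<forall>y\<in>underS r z. x \<notin> N y))" for x
  have h: "h x \<in> Z" "x \<in> N (h x)" "\<And>y. y \<in> underS r (h x) \<Longrightarrow> x \<notin> N y" if "x \<in> (\<Union>z\<in>Z. N z)" for x
  proof -
    have "wf (r - Id)" using wo by (simp add: well_order_on_def)
    moreover obtain z1 where "z1 \<in> {z \<in> Z. x \<in> N z}" using \<open>x \<in> (\<Union>z\<in>Z. N z)\<close> by blast
    ultimately obtain z where z: "z \<in> {z \<in> Z. x \<in> N z}"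
        "\<And>y. (y, z) \<in> r - Id \<Longrightarrow> y \<notin> {z \<in> Z. x \<in> N z}"
      by (rule wfE_min) blast
    have "x \<notin> N y" if "y \<in> underS r z" for y
    proof -
      have "(y, z) \<in> r - Id" "y \<in> Z" using that r(2) by (auto simp: underS_def Field_def)
      then show ?thesis using z(2) by blast
    qed
    then have "\<exists>z. z \<in> Z \<and> x \<in> N z \<and> (\<forall>y\<in>underS r z. x \<notin> N y)"
      using z(1) by blast
    from someI_ex[OF this, folded h_def]
    show "h x \<in> Z" "x \<in> N (h x)" "\<And>y. y \<in> underS r (h x) \<Longrightarrow> x \<notin> N y" by blast+
  qed
  have small: "(\<Union>y\<in>underS r z. N' y) \<in> I" if "\<And>y. y \<in> underS r z \<Longrightarrow> N' y \<in> I"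
    for z and N' :: "(nat \<Rightarrow> bool) \<Rightarrow> 'a set"
  proof (cases "z \<in> Z")
    case False
    then have "underS r z = {}" using r(2) by (auto simp: underS_def Field_def)
    then show ?thesis by simp
  next
    case True
    then have "(card_of (underS r z), r) \<in> ordLess"
      using r(2) by (intro card_of_underS[OF r(1)]) simp
    then have "(card_of (underS r z), card_of Z) \<in> ordLess"
      by (simp only: r_def)
    from min[OF this] have nb: "\<not> big (underS r z)" .
    show ?thesis
    proof (rule ccontr)
      assume "\<not> ?thesis"
      then have "big (underS r z)"
        unfolding big_def using that by (intro exI[of _ N']) (auto dest: I_carrier)
      with nb show False by blast
    qed
  qed
  show ?thesis
  proof
    show "(\<Union>z\<in>Z. N z) \<subseteq> X" using N by blast
    show "(\<Union>z\<in>Z. N z) \<notin> I" by fact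
    show "{x \<in> (\<Union>z\<in>Z. N z). h x = z} \<in> I" for z
    proof (cases "z \<in> Z")
      case True
      then show ?thesis by (intro I_subset[OF N(1)[OF True]]) (use h in auto)
    next
      case False
      then have "{x \<in> (\<Union>z\<in>Z. N z). h x = z} = {}" using h(1) by blast
      then show ?thesis by (simp only: I_empty)
    qed
    show "(\<Union>y\<in>underS r z. N' y) \<in> I" if "\<And>y. y \<in> underS r z \<Longrightarrow> N' y \<in> I"
      for z and N' :: "(nat \<Rightarrow> bool) \<Rightarrow> 'a set" using that by (rule small)
    fix x0 assume "x0 \<in> (\<Union>z\<in>Z. N z)"
    then have z0: "h x0 \<in> Z" using h by blast
    \<comment> \<open>An \<open>x\<close> whose index is not above \<open>h x0\<close> lies in
      \<open>N y\<close> for some \<open>y\<close> at or below \<open>h x0\<close>, and there are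
      few such \<open>y\<close>.\<close>
    have "{x \<in> (\<Union>z\<in>Z. N z). h x0 \<notin> underS r (h x)} \<subseteq> (\<Union>y\<in>underS r (h x0). N y) \<union> N (h x0)"
    proof
      fix x assume "x \<in> {x \<in> (\<Union>z\<in>Z. N z). h x0 \<notin> underS r (h x)}"
      then have x: "x \<in> (\<Union>z\<in>Z. N z)" and nu: "h x0 \<notin> underS r (h x)" by auto
      have "total_on Z r" using wo r(2) by (simp add: well_order_on_def linear_order_on_def)
      then have "h x = h x0 \<or> h x \<in> underS r (h x0)"
        using nu z0 h(1)[OF x] by (auto simp: underS_def total_on_def)
      then show "x \<in> (\<Union>y\<in>underS r (h x0). N y) \<union> N (h x0)" using h(2)[OF x] by auto
    qed
    moreover have "underS r (h x0) \<subseteq> Z" using r(2) by (auto simp: underS_def Field_def)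
    then have "(\<Union>y\<in>underS r (h x0). N y) \<in> I" using N by (intro small) auto
    then have "(\<Union>y\<in>underS r (h x0). N y) \<union> N (h x0) \<in> I" using N(1)[OF z0] by (rule I_Un)
    ultimately show "{x \<in> (\<Union>z\<in>Z. N z). h x0 \<notin> underS r (h x)} \<in> I"
      by (rule I_subset[rotated])
  qed
qed

end

section \<open>No total measure\<close>

text \<open>Replacing each set by its part outside the earlier ones changes it only by a null
  set.\<close>

lemma emeasure_UN_AE_disjoint:
  assumes A [measurable]: "\<And>n::nat. A n \<in> sets M"
    and disj: "\<And>m n. m \<noteq> n \<Longrightarrow> AE w in M. \<not> (w \<in> A m \<and> w \<in> A n)"
  shows "(\<Sum>n. emeasure M (A n)) = emeasure M (\<Union>n. A n)"
proof -
  have sD: "disjointed A n \<in> sets M" for n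
    using sets.range_disjointed_sets[of A M] A by blast
  have "emeasure M (A n) = emeasure M (disjointed A n)" for n
  proof (rule emeasure_eq_AE)
    have "AE w in M. \<forall>m. m \<noteq> n \<longrightarrow> \<not> (w \<in> A m \<and> w \<in> A n)"
      unfolding AE_all_countable using disj by auto
    then show "AE w in M. w \<in> A n \<longleftrightarrow> w \<in> disjointed A n"
      by eventually_elim (auto simp: disjointed_def)
  qed (use sD in auto)
  then have "(\<Sum>n. emeasure M (A n)) = (\<Sum>n. emeasure M (disjointed A n))" by simp
  also have "\<dots> = emeasure M (\<Union>n. disjointed A n)"
    using sD by (intro suminf_emeasure) (auto simp: disjoint_family_disjointed)
  finally show ?thesis by (simp add: UN_disjointed_eq)
qed

text \<open>\<open>low z\<close> plays the role of the proper initial segment of \<open>L = h ` X0\<close> below \<open>z\<close>.\<close>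

locale cohen_random_tower = cohen_random_rep +
  fixes X0 :: "'a set" and h :: "'a \<Rightarrow> nat \<Rightarrow> bool" and low :: "(nat \<Rightarrow> bool) \<Rightarrow> (nat \<Rightarrow> bool) set"
    and t0 :: "bool list" and P0 :: "(nat \<Rightarrow> bool) set"
  assumes X0_subset: "X0 \<subseteq> X"
    and fibre_in_I: "{x \<in> X0. h x = z} \<in> I"
    and low_in_I: "x0 \<in> X0 \<Longrightarrow> {x \<in> X0. h x0 \<notin> low (h x)} \<in> I"
    and low_UN: "(\<And>y. y \<in> low z \<Longrightarrow> N y \<in> I) \<Longrightarrow> (\<Union>y\<in>low z. N y :: 'a set) \<in> I"
    and P0: "P0 \<in> sets cantor_measure - null_sets cantor_measure"
    and t0_P0: "{x \<in> X. pre t0 (c x) \<and> s x \<in> P0} - X0 \<in> I"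
begin

lemma sets_P0 [measurable]: "P0 \<in> sets M"
  using P0 by simp

definition hv :: "(nat \<Rightarrow> bool) set \<Rightarrow> 'a set" where
  "hv Y = {x \<in> X0. h x \<in> Y}"

text \<open>Over the random real \<open>w\<close>, the condition \<open>t\<close> leaves open
  whether the \<open>h\<close>-value lies in \<open>Y\<close>. The negation describes the case in
  which the random real alone settles the question.\<close>

definition split :: "(nat \<Rightarrow> bool) set \<Rightarrow> bool list \<Rightarrow> (nat \<Rightarrow> bool) \<Rightarrow> bool" where
  "split Y t w \<longleftrightarrow> (\<exists>t1 t2. prefix t t1 \<and> prefix t t2 \<and> w \<in> dec t1 (hv Y) \<and> w \<in> dec t2 (hv (- Y)))"

lemma hv_UNIV [simp]: "hv UNIV = X0"
  by (simp add: hv_def)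

lemma hv_UN: "hv (\<Union>j\<in>J. Y j) = (\<Union>j\<in>J. hv (Y j))"
  by (auto simp: hv_def)

lemma AE_hv_mono: "Y \<subseteq> Y' \<Longrightarrow> AE w in M. \<forall>t. w \<in> dec t (hv Y) \<longrightarrow> w \<in> dec t (hv Y')"
proof -
  assume "Y \<subseteq> Y'"
  then have eq: "hv Y - hv Y' = {}" by (auto simp: hv_def)
  show ?thesis
    unfolding AE_all_countable by (intro allI AE_dec_mono) (auto simp: eq)
qed

lemma sets_split [measurable]: "{w. split Y t w} \<in> sets M"
proof -
  have "{w. split Y t w} = (\<Union>t1\<in>{t1. prefix t t1}. \<Union>t2\<in>{t2. prefix t t2}. dec t1 (hv Y) \<inter> dec t2 (hv (- Y)))"
    by (auto simp: split_def)
  also have "\<dots> \<in> sets M"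
    by (intro sets.countable_UN'' uncountable_def) auto
  finally show ?thesis .
qed

lemma AE_dec_X0: "AE w in M. w \<in> P0 \<longrightarrow> (\<forall>t. prefix t0 t \<longrightarrow> w \<in> dec t X0)"
  using AE_dec[OF sets_P0 t0_P0[folded ev_def]] AE_dec_ext[of X0]
  by eventually_elim blast

text \<open>The lengths of runs of zeros turn the Cohen real \<open>c x\<close> in \<open>2\<^sup>\<omega>\<close> into one in \<open>\<omega>\<^sup>\<omega>\<close>.\<close>

lemma run_infinitely_often:
  "{x \<in> X. \<not> (\<exists>\<^sub>\<infinity>n. (LEAST k. c x (n + k)) = g n)} \<in> I"
proof -
  have "{x \<in> X. \<forall>n\<ge>m. (LEAST k. c x (n + k)) \<noteq> g n} \<in> I" (is "?A \<in> I") for m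
  proof (rule ccontr)
    assume A: "?A \<notin> I"
    have "?A \<subseteq> X" by auto
    from this A obtain t P where P: "P \<in> sets M - null_sets M" and t: "ev t P - ?A \<in> I"
      by (rule dense_ev)
    define n where "n = max m (length t)"
    \<comment> \<open>Pad \<open>t\<close> with zeros to length \<open>n\<close>, then append
      exactly \<open>g n\<close> zeros and a one: the run starting at \<open>n\<close> has length
      \<open>g n\<close>.\<close>
    define t' where "t' = t @ replicate (n - length t) False @ replicate (g n) False @ [True]"
    have mn: "m \<le> n" by (simp add: n_def)
    have nt: "length (t @ replicate (n - length t) False) = n" by (simp add: n_def)
    then have len: "length t' = n + g n + 1" by (simp add: t'_def)
    have nth: "t' ! (n + k) = (k = g n)" if "k \<le> g n" for k
    proof -
      have "t' ! (n + k) = (replicate (g n) False @ [True]) ! k"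
        using nth_append_length_plus[of "t @ replicate (n - length t) False" "replicate (g n) False @ [True]" k] nt
        by (simp add: t'_def)
      then show ?thesis using that by (simp add: nth_append)
    qed
    have "ev t' P \<inter> ?A = {}"
    proof (rule ccontr)
      assume "ev t' P \<inter> ?A \<noteq> {}"
      then obtain x where x: "pre t' (c x)" "(LEAST k. c x (n + k)) \<noteq> g n"
        using mn unfolding ev_def by blast
      have ck: "c x (n + k) = (k = g n)" if "k \<le> g n" for k
        using x(1) nth[OF that] that len by (auto simp: pre_iff)
      have "(LEAST k. c x (n + k)) = g n"
        by (rule Least_equality) (use ck in \<open>auto, metis nat_le_linear\<close>)
      with x(2) show False by blast
    qed
    moreover have "ev t' P \<subseteq> ev t P" by (rule ev_prefix) (simp add: t'_def)
    ultimately have "ev t' P \<in> I" by (intro I_subset[OF t]) blast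
    then show False using ev_notin_I[OF P] by blast
  qed
  then have "(\<Union>m. {x \<in> X. \<forall>n\<ge>m. (LEAST k. c x (n + k)) \<noteq> g n}) \<in> I"
    by (intro I_UN) auto
  then show ?thesis
    by (rule I_subset) (auto simp: INFM_nat_le)
qed

text \<open>Without splitting, the measure of the part of \<open>P\<close> over which some extension
  of \<open>t\<close> decides \<open>Y\<close> is countably additive on all subsets of the Cantor
  space, nonzero, and zero on points. Null sets from the Cohen real that cover initial segments then
  contradict Fubini's theorem.\<close>

lemma no_total_measure:
  assumes t: "prefix t0 t" and P: "P \<in> sets M - null_sets M" "P \<subseteq> P0"
    and nosplit: "\<And>Y. AE w in M. w \<in> P \<longrightarrow> \<not> split Y t w"
  shows False
proof -
  have sP [measurable]: "P \<in> sets M" using P by simp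
  define hit where "hit Y = (\<Union>t'\<in>{t'. prefix t t'}. dec t' (hv Y))" for Y
  have sets_hit [measurable]: "hit Y \<in> sets M" for Y
    unfolding hit_def by (intro sets.countable_UN'') auto
  have hit_iff: "w \<in> hit Y \<longleftrightarrow> (\<exists>t'. prefix t t' \<and> w \<in> dec t' (hv Y))" for w Y
    by (auto simp: hit_def)
  have AE_hit_mono: "AE w in M. w \<in> hit Y \<longrightarrow> w \<in> hit Y'" if "Y \<subseteq> Y'" for Y Y'
    using AE_hv_mono[OF that] by eventually_elim (auto simp: hit_iff)
  have AE_hit_null: "AE w in M. w \<notin> hit Y" if "hv Y \<in> I" for Y
  proof -
    have "AE w in M. \<forall>t'. w \<notin> dec t' (hv Y)"
      unfolding AE_all_countable using AE_dec_in_I[OF that] by blast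
    then show ?thesis by eventually_elim (auto simp: hit_iff)
  qed
  define \<nu> where "\<nu> Y = emeasure M (P \<inter> hit Y)" for Y
  have \<nu>_null: "\<nu> Y = 0" if "hv Y \<in> I" for Y
  proof -
    have "AE w in M. w \<notin> P \<inter> hit Y"
      using AE_hit_null[OF that] by eventually_elim simp
    then have "P \<inter> hit Y \<in> null_sets M" by (subst AE_iff_null_sets) auto
    then show ?thesis by (simp add: \<nu>_def null_sets_def)
  qed
  define N where "N = measure_of UNIV UNIV \<nu>"
  have sets_N [simp]: "sets N = UNIV" and space_N [simp]: "space N = UNIV"
    using sigma_algebra.sigma_sets_eq[OF sigma_algebra_Pow[of "UNIV :: (nat \<Rightarrow> bool) set"]]
    by (simp_all add: N_def sets_measure_of_conv space_measure_of_conv)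
  \<comment> \<open>Disjoint sets are almost never decided over the same \<open>w\<close> because
    nothing is split; a decision for a countable union extends to a decision for one member.\<close>
  have "countably_additive UNIV \<nu>"
  proof (rule countably_additiveI)
    fix A :: "nat \<Rightarrow> (nat \<Rightarrow> bool) set" assume disj: "disjoint_family A"
    have "(\<Sum>i. \<nu> (A i)) = emeasure M (\<Union>i. P \<inter> hit (A i))"
      unfolding \<nu>_def
    proof (rule emeasure_UN_AE_disjoint)
      fix m n :: nat assume "m \<noteq> n"
      then have "A n \<subseteq> - A m" using disj by (auto simp: disjoint_family_on_def)
      from AE_hv_mono[OF this] nosplit[of "A m"]
      show "AE w in M. \<not> (w \<in> P \<inter> hit (A m) \<and> w \<in> P \<inter> hit (A n))"
        by eventually_elim (auto simp: hit_iff split_def)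
    qed simp
    also have "\<dots> = \<nu> (\<Union>i. A i)"
      unfolding \<nu>_def
    proof (rule emeasure_eq_AE)
      have "AE w in M. \<forall>i. w \<in> hit (A i) \<longrightarrow> w \<in> hit (\<Union>i. A i)"
        unfolding AE_all_countable by (intro allI AE_hit_mono) auto
      moreover have "AE w in M. \<forall>t'. w \<in> dec t' (\<Union>i\<in>UNIV. hv (A i)) \<longrightarrow>
          (\<exists>t''. prefix t' t'' \<and> (\<exists>i\<in>UNIV. w \<in> dec t'' (hv (A i))))"
        unfolding AE_all_countable by (intro allI AE_dec_dense) auto
      ultimately show "AE w in M. w \<in> (\<Union>i. P \<inter> hit (A i)) \<longleftrightarrow> w \<in> P \<inter> hit (\<Union>i. A i)"
        by eventually_elim (auto simp: hit_iff hv_UN; meson prefix_order.trans)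
    qed auto
    finally show "(\<Sum>i. \<nu> (A i)) = \<nu> (\<Union>i. A i)" .
  qed
  moreover have "\<nu> {} = 0"
    by (rule \<nu>_null) (simp add: hv_def)
  ultimately have N: "emeasure N Y = \<nu> Y" for Y
    unfolding N_def
    by (intro emeasure_measure_of_sigma) (auto simp: positive_def sigma_algebra_Pow[of UNIV, simplified])
  have N0: "AE y in N. y \<notin> Y" if "hv Y \<in> I" for Y
  proof -
    have "emeasure N Y = 0"
      unfolding N using that by (rule \<nu>_null)
    then show ?thesis by (intro AE_I[of _ _ Y]) auto
  qed
  have fin: "emeasure N (space N) \<noteq> \<infinity>" 
    by (simp add: N \<nu>_def)
  interpret N: finite_measure N by (rule finite_measureI) (rule fin)
  have pos: "\<not> (AE y in N. False)"
  proof
    assume "AE y in N. False"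
    then have "\<nu> UNIV = 0" using N by (simp add: AE_iff_null null_sets_def)
    then have "P \<inter> hit UNIV \<in> null_sets M" by (simp add: \<nu>_def null_sets_def)
    then have "AE w in M. w \<notin> P \<inter> hit UNIV" by (rule AE_not_in)
    moreover note AE_dec_X0
    ultimately have "AE w in M. w \<notin> P"
      by eventually_elim (use t P(2) in \<open>auto simp: hit_iff\<close>)
    then show False using P(1) by (simp add: AE_iff_null_sets[OF sP])
  qed
  text \<open>Points are null, so finitely many bits of \<open>y\<close> already confine it to a set of small measure.\<close>
  have "\<exists>u. pre u y \<and> measure N {y. pre u y} \<le> (1/2) ^ n" for y n
  proof -
    have "(\<lambda>k. measure N ({z. pre (pr k y) z} - {y})) \<longlonglongrightarrow> 0"
    proof (rule N.measure_eventually_avoided)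
      have "\<forall>\<^sub>F k in sequentially. z \<notin> {z. pre (pr k y) z} - {y}" for z
      proof (cases "z = y")
        case False
        then obtain i where "z i \<noteq> y i" by blast
        then show ?thesis
          unfolding eventually_sequentially by (intro exI[of _ "Suc i"]) (auto simp: pre_iff)
      qed simp
      then show "AE z in N. \<forall>\<^sub>F k in sequentially. z \<notin> {z. pre (pr k y) z} - {y}" by simp
    qed simp
    then have "\<forall>\<^sub>F k in sequentially. measure N ({z. pre (pr k y) z} - {y}) < (1/2) ^ n"
      by (rule order_tendstoD) simp
    then obtain k where "measure N ({z. pre (pr k y) z} - {y}) < (1/2) ^ n"
      by (auto simp: eventually_sequentially)
    moreover have "measure N ({z. pre (pr k y) z} - {y}) = measure N {z. pre (pr k y) z}"
      using N0[of "{y}"] fibre_in_I[of y] by (intro measure_eq_AE) (auto simp: hv_def)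
    ultimately show ?thesis by (intro exI[of _ "pr k y"]) (auto simp: pre_def)
  qed
  then obtain u where u: "\<And>y n. pre (u y n) y" "\<And>y n. measure N {z. pre (u y n) z} \<le> (1/2) ^ n"
    by metis
  \<comment> \<open>\<open>Q n\<close> enumerates the cylinders of measure at most
    \<open>(1/2) ^ n\<close>; the code of a larger cylinder yields the empty set instead.\<close>
  define Q where "Q n k = (let v = from_nat k in
    if measure N {y. pre v y} \<le> (1/2) ^ n then {y. pre v y} else {})" for n k :: nat
  have Q_small: "measure N (Q n k) \<le> (1/2) ^ n" for n k
    by (simp add: Q_def Let_def)
  have Q_cover: "y \<in> Q n (to_nat (u y n))" for y n
    using u by (simp add: Q_def)
  text \<open>The Cohen real provides null sets (in the sense of the new measure) that absorb everything below \<open>y\<close>.\<close>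
  have "\<exists>\<zeta>. \<forall>z\<in>low y. \<exists>\<^sub>\<infinity>n. z \<in> Q n (\<zeta> n)" for y
  proof -
    have "(\<Union>z\<in>low y. {x \<in> X. \<not> (\<exists>\<^sub>\<infinity>n. (LEAST k. c x (n + k)) = to_nat (u z n))}) \<in> I"
      by (intro low_UN run_infinitely_often)
    then obtain x where x: "x \<in> X" "\<And>z. z \<in> low y \<Longrightarrow> \<exists>\<^sub>\<infinity>n. (LEAST k. c x (n + k)) = to_nat (u z n)"
      using X_notin_I I_subset[of _ X] by blast
    have "\<exists>\<^sub>\<infinity>n. z \<in> Q n (LEAST k. c x (n + k))" if "z \<in> low y" for z
      using x(2)[OF that] by (rule INFM_mono) (metis Q_cover)
    then show ?thesis by (intro exI[of _ "\<lambda>n. LEAST k. c x (n + k)"]) blast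
  qed
  then obtain \<zeta> where \<zeta>: "\<And>y z. z \<in> low y \<Longrightarrow> \<exists>\<^sub>\<infinity>n. z \<in> Q n (\<zeta> y n)"
    by metis
  interpret NN: pair_sigma_finite N N by unfold_locales
  \<comment> \<open>Since \<open>N\<close> measures every set, the relation is built from measurable
    rectangles by countable operations, although \<open>\<zeta>\<close> comes from an arbitrary
    choice.\<close>
  have pairs: "{p \<in> space (N \<Otimes>\<^sub>M N). \<not> (\<exists>\<^sub>\<infinity>n. fst p \<in> Q n (\<zeta> (snd p) n))} \<in> sets (N \<Otimes>\<^sub>M N)"
  proof -
    have iff: "(\<exists>\<^sub>\<infinity>n. z \<in> Q n (\<zeta> y n)) \<longleftrightarrow> (z, y) \<in> (\<Inter>m. \<Union>n\<in>{m..}. \<Union>k. Q n k \<times> {y. \<zeta> y n = k})" for z y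
      unfolding INFM_nat_le by simp (metis atLeast_iff)
    have "{p \<in> space (N \<Otimes>\<^sub>M N). \<not> (\<exists>\<^sub>\<infinity>n. fst p \<in> Q n (\<zeta> (snd p) n))}
       = space (N \<Otimes>\<^sub>M N) - (\<Inter>m. \<Union>n\<in>{m..}. \<Union>k. Q n k \<times> {y. \<zeta> y n = k})"
      by (simp only: iff prod.collapse) blast
    also have "\<dots> \<in> sets (N \<Otimes>\<^sub>M N)"
      by (intro sets.Diff sets.top sets.countable_INT sets.countable_UN'' image_subsetI) auto
    finally show ?thesis .
  qed
  have "AE y in N. AE z in N. \<not> (\<exists>\<^sub>\<infinity>n. z \<in> Q n (\<zeta> y n))"
  proof (rule AE_I2)
    fix y
    have "AE z in N. \<forall>\<^sub>F n in sequentially. z \<notin> Q n (\<zeta> y n)"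
      by (rule N.AE_eventually_not_in) (auto simp: Q_small)
    then show "AE z in N. \<not> (\<exists>\<^sub>\<infinity>n. z \<in> Q n (\<zeta> y n))"
      by eventually_elim (simp add: frequently_def cofinite_eq_sequentially)
  qed
  \<comment> \<open>Fubini: almost every \<open>z\<close> avoids the covering sets of almost every
    \<open>y\<close>. But almost every \<open>y\<close> has \<open>z\<close> in
    \<open>low y\<close>, where \<open>\<zeta> y\<close> does cover \<open>z\<close>.\<close>
  then have "AE z in N. AE y in N. \<not> (\<exists>\<^sub>\<infinity>n. z \<in> Q n (\<zeta> y n))"
    using NN.AE_commute[of "\<lambda>z y. \<not> (\<exists>\<^sub>\<infinity>n. z \<in> Q n (\<zeta> y n))"] pairs by simp
  moreover have "hv (- h ` X0) = {}" by (auto simp: hv_def)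
  then have "AE z in N. z \<in> h ` X0"
    using N0[of "- h ` X0"] by simp
  ultimately have "AE z in N. AE y in N. False"
  proof eventually_elim
    case (elim z)
    then obtain x0 where x0: "x0 \<in> X0" "z = h x0" by blast
    have "AE y in N. y \<notin> {y. z \<notin> low y}"
    proof (rule N0)
      show "hv {y. z \<notin> low y} \<in> I"
        using low_in_I[OF x0(1)] unfolding hv_def x0(2) mem_Collect_eq .
    qed
    with elim(1) show ?case
    proof eventually_elim
      case (elim y)
      then show ?case using \<zeta>[of z y] by blast
    qed
  qed
  then show False using pos by simp
qed

end

section \<open>Colouring the words below a condition\<close>

text \<open>A colouring that is constant on \<open>A\<close> is determined by its restriction to
  \<open>W - A\<close> and the colour of \<open>A\<close>.\<close>

lemma card_monochromatic_colourings:
  assumes W: "finite W" and A: "A \<subseteq> W" "N \<le> card A"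
  shows "real (card {K \<in> Pow W. A \<subseteq> K \<or> A \<inter> K = {}}) \<le> 2 * 2 ^ card W * (1/2) ^ N"
proof -
  have "{K \<in> Pow W. A \<subseteq> K \<or> A \<inter> K = {}} \<subseteq> (\<lambda>B. B \<union> A) ` Pow (W - A) \<union> Pow (W - A)"
  proof
    fix K assume K: "K \<in> {K \<in> Pow W. A \<subseteq> K \<or> A \<inter> K = {}}"
    show "K \<in> (\<lambda>B. B \<union> A) ` Pow (W - A) \<union> Pow (W - A)"
    proof (cases "A \<subseteq> K")
      case True
      then have "K = (K - A) \<union> A" by blast
      moreover have "K - A \<in> Pow (W - A)" using K by auto
      ultimately show ?thesis by (intro UnI1 image_eqI)
    next
      case False
      then show ?thesis using K by (intro UnI2) auto
    qed
  qed
  then have "card {K \<in> Pow W. A \<subseteq> K \<or> A \<inter> K = {}} \<le> card ((\<lambda>B. B \<union> A) ` Pow (W - A) \<union> Pow (W - A))"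
    using W by (intro card_mono) auto
  also have "\<dots> \<le> card ((\<lambda>B. B \<union> A) ` Pow (W - A)) + card (Pow (W - A))"
    by (rule card_Un_le)
  also have "\<dots> \<le> card (Pow (W - A)) + card (Pow (W - A))"
    using W by (intro add_right_mono card_image_le) auto
  also have "\<dots> = 2 * 2 ^ (card W - card A)"
    using W A(1) finite_subset[OF A(1) W] by (simp add: card_Pow card_Diff_subset)
  finally have "real (card {K \<in> Pow W. A \<subseteq> K \<or> A \<inter> K = {}}) \<le> real (2 * 2 ^ (card W - card A))"
    by (simp only: of_nat_le_iff)
  also have "\<dots> = 2 * 2 ^ (card W - card A)" by simp
  also have "(2::real) ^ (card W - card A) = 2 ^ card W * (1/2) ^ card A"
    using card_mono[OF W A(1)] by (simp add: power_diff power_one_over field_simps)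
  also have "2 * (2 ^ card W * (1/2) ^ card A) \<le> 2 * (2 ^ card W * (1/2::real) ^ N)"
    using A(2) by (intro mult_left_mono power_decreasing) auto
  finally show ?thesis by simp
qed

context cohen_random_tower
begin

text \<open>For a fixed \<open>t\<close>, exhaustion reduces all sets \<open>Y\<close> to countably
  many. Where none of these splits \<open>t\<close>, almost no set does, which
  \<open>no_total_measure\<close> excludes on a positive set. Countably many \<open>t\<close> then
  need only one sequence.\<close>

lemma splitting_sequence:
  "\<exists>Ys :: nat \<Rightarrow> (nat \<Rightarrow> bool) set.
    AE w in M. w \<in> P0 \<longrightarrow> (\<forall>t. prefix t0 t \<longrightarrow> (\<exists>m. split (Ys m) t w))"
proof -
  have "\<exists>\<Y>. countable \<Y> \<and> (AE w in M. w \<in> P0 \<longrightarrow> (\<exists>Y\<in>\<Y>. split Y t w))" if t: "prefix t0 t" for t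
  proof -
    let ?C = "range (\<lambda>Y. {w. split Y t w})"
    have "?C \<subseteq> sets M" by auto
    from cantor.exhaustion[OF this] obtain \<C>' where
      C': "countable \<C>'" "\<C>' \<subseteq> ?C" "\<forall>C\<in>?C. C - \<Union>\<C>' \<in> null_sets M"
      by (elim exE conjE)
    then obtain \<Y> where Y: "countable \<Y>" "\<C>' = (\<lambda>Y. {w. split Y t w}) ` \<Y>"
      by (metis countable_subset_image)
    define R where "R = P0 - (\<Union>Y\<in>\<Y>. {w. split Y t w})"
    have R: "R \<in> sets M"
      unfolding R_def using Y(1) by (intro sets.Diff sets.countable_UN'') auto
    have "R \<in> null_sets M"
    proof (rule ccontr)
      assume "R \<notin> null_sets M"
      with R no_total_measure[OF t, of R]
      obtain Y' where Y': "\<not> (AE w in M. w \<in> R \<longrightarrow> \<not> split Y' t w)"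
        by (auto simp: R_def)
      have "{w. split Y' t w} - \<Union>\<C>' \<in> null_sets M" by (rule bspec[OF C'(3)]) simp
      then have "AE w in M. w \<notin> {w. split Y' t w} - \<Union>\<C>'" by (rule AE_not_in)
      then have "AE w in M. w \<in> R \<longrightarrow> \<not> split Y' t w"
        by eventually_elim (auto simp: R_def Y(2))
      with Y' show False by blast
    qed
    then have "AE w in M. w \<notin> R" by (rule AE_not_in)
    then have "AE w in M. w \<in> P0 \<longrightarrow> (\<exists>Y\<in>\<Y>. split Y t w)"
      by eventually_elim (auto simp: R_def)
    with Y(1) show ?thesis by blast
  qed
  then have "\<forall>t. \<exists>\<Y>. prefix t0 t \<longrightarrow> countable \<Y> \<and> (AE w in M. w \<in> P0 \<longrightarrow> (\<exists>Y\<in>\<Y>. split Y t w))"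
    by blast
  from choice[OF this] obtain \<Y> where Y0: "\<forall>t. prefix t0 t \<longrightarrow>
      countable (\<Y> t) \<and> (AE w in M. w \<in> P0 \<longrightarrow> (\<exists>Y\<in>\<Y> t. split Y t w))" ..
  then have Y: "\<And>t. prefix t0 t \<Longrightarrow> countable (\<Y> t)"
    "\<And>t. prefix t0 t \<Longrightarrow> AE w in M. w \<in> P0 \<longrightarrow> (\<exists>Y\<in>\<Y> t. split Y t w)"
    by blast+
  define \<Y>' where "\<Y>' = insert {} (\<Union>t\<in>{t. prefix t0 t}. \<Y> t)"
  have Y': "countable \<Y>'" "\<Y>' \<noteq> {}" using Y(1) by (auto simp: \<Y>'_def)
  show ?thesis
  proof (intro exI[of _ "from_nat_into \<Y>'"])
    have "AE w in M. \<forall>t. prefix t0 t \<longrightarrow> w \<in> P0 \<longrightarrow> (\<exists>Y\<in>\<Y> t. split Y t w)"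
      unfolding AE_all_countable using Y(2) by auto
    then show "AE w in M. w \<in> P0 \<longrightarrow> (\<forall>t. prefix t0 t \<longrightarrow> (\<exists>m. split (from_nat_into \<Y>' m) t w))"
    proof eventually_elim
      case (elim w)
      show ?case
      proof (intro impI allI)
        fix t assume "w \<in> P0" and t: "prefix t0 t"
        with elim obtain Y where "Y \<in> \<Y> t" "split Y t w" by blast
        then have "Y \<in> \<Y>'" using t by (auto simp: \<Y>'_def)
        then obtain m where "from_nat_into \<Y>' m = Y"
          using from_nat_into_surj[OF Y'(1)] by blast
        with \<open>split Y t w\<close> show "\<exists>m. split (from_nat_into \<Y>' m) t w" by blast
      qed
    qed
  qed
qed

context
  fixes Ys :: "nat \<Rightarrow> (nat \<Rightarrow> bool) set"
begin

definition word :: "nat \<Rightarrow> (nat \<Rightarrow> bool) \<Rightarrow> bool list" where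
  "word n z = map (\<lambda>m. z \<in> Ys m) [0..<n]"

definition AU :: "bool list \<Rightarrow> 'a set" where
  "AU u = hv {z. word (length u) z = u}"

text \<open>The words of length \<open>n\<close> that \<open>h x\<close> can still realise below the condition \<open>t\<close>, given the random real \<open>w\<close>.\<close>

definition reach :: "nat \<Rightarrow> bool list \<Rightarrow> (nat \<Rightarrow> bool) \<Rightarrow> bool list set" where
  "reach n t w = {u. length u = n \<and> (\<exists>t'. prefix t t' \<and> w \<in> dec t' (AU u))}"

lemma length_word [simp]: "length (word n z) = n"
  by (simp add: word_def)

lemma take_word: "m \<le> n \<Longrightarrow> take m (word n z) = word m z"
  by (simp add: word_def take_map)

lemma AU_Nil: "AU [] = X0"
  by (simp add: AU_def word_def)

lemma AU_refine: "length u \<le> n \<Longrightarrow> AU u = (\<Union>u'\<in>{u'. length u' = n \<and> take (length u) u' = u}. AU u')"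
  by (auto simp: AU_def hv_def) (metis length_word take_word)+

lemma AU_disjoint: "m < length u \<Longrightarrow> hv (if u ! m then - Ys m else Ys m) \<inter> AU u = {}"
proof -
  assume m: "m < length u"
  have "x \<notin> hv (if u ! m then - Ys m else Ys m)" if "x \<in> AU u" for x
  proof -
    from that have "word (length u) (h x) = u" by (simp add: AU_def hv_def)
    from arg_cong[OF this, of "\<lambda>v. v ! m"] m have "u ! m \<longleftrightarrow> h x \<in> Ys m"
      by (simp add: word_def)
    then show ?thesis by (simp add: hv_def)
  qed
  then show ?thesis by blast
qed

lemma finite_reach [simp]: "finite (reach n t w)"
  by (rule finite_subset[OF _ finite_lists_length_eq[of UNIV n]]) (auto simp: reach_def)

text \<open>Reachable words of length \<open>n\<close> are truncations of longer reachable ones, so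
  their number does not decrease. A set \<open>Ys m\<close> that splits below a reachable word
  yields two reachable words differing at \<open>m\<close>, so the number grows without
  bound.\<close>

lemma AE_reach_grows:
  assumes Ys: "AE w in M. w \<in> P0 \<longrightarrow> (\<forall>t. prefix t0 t \<longrightarrow> (\<exists>m. split (Ys m) t w))"
  shows "AE w in M. w \<in> P0 \<longrightarrow> (\<forall>t. prefix t0 t \<longrightarrow> (\<forall>N. \<forall>\<^sub>F n in sequentially. N \<le> card (reach n t w)))"
proof -
  have 1: "AE w in M. \<forall>u t t'. prefix t t' \<longrightarrow> w \<in> dec t (AU u) \<longrightarrow> w \<in> dec t' (AU u)"
    unfolding AE_all_countable[where 'i = "bool list"] by (intro allI AE_dec_mono AE_impI) simp_all
  have 2: "AE w in M. \<forall>u n t. length u \<le> n \<longrightarrow> w \<in> dec t (AU u) \<longrightarrow>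
      (\<exists>t'. prefix t t' \<and> (\<exists>u'\<in>{u'. length u' = n \<and> take (length u) u' = u}. w \<in> dec t' (AU u')))"
    unfolding AE_all_countable
  proof (intro allI)
    fix u n t
    show "AE w in M. length u \<le> n \<longrightarrow> w \<in> dec t (AU u) \<longrightarrow>
      (\<exists>t'. prefix t t' \<and> (\<exists>u'\<in>{u'. length u' = n \<and> take (length u) u' = u}. w \<in> dec t' (AU u')))"
    proof (cases "length u \<le> n")
      case True
      then show ?thesis
        using AE_dec_dense[of "{u'. length u' = n \<and> take (length u) u' = u}" t AU]
        by (simp add: AU_refine[OF True, symmetric])
    qed simp
  qed
  have 3: "AE w in M. \<forall>t u m. m < length u \<longrightarrow>
      \<not> (w \<in> dec t (hv (if u ! m then - Ys m else Ys m)) \<and> w \<in> dec t (AU u))"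
    unfolding AE_all_countable
  proof (intro allI)
    fix t u m
    show "AE w in M. m < length u \<longrightarrow>
      \<not> (w \<in> dec t (hv (if u ! m then - Ys m else Ys m)) \<and> w \<in> dec t (AU u))"
    proof (cases "m < length u")
      case True
      have "hv (if u ! m then - Ys m else Ys m) \<inter> AU u \<in> I"
        unfolding AU_disjoint[OF True] by simp
      from AE_dec_disjoint[OF this, of t] show ?thesis by eventually_elim blast
    qed simp
  qed
  have 4: "AE w in M. \<forall>m t t'. prefix t t' \<longrightarrow>
      (w \<in> dec t (hv (Ys m)) \<longrightarrow> w \<in> dec t' (hv (Ys m))) \<and> (w \<in> dec t (hv (- Ys m)) \<longrightarrow> w \<in> dec t' (hv (- Ys m)))"
  proof -
    have "AE w in M. \<forall>m. (\<forall>t t'. prefix t t' \<longrightarrow> w \<in> dec t (hv (Ys m)) \<longrightarrow> w \<in> dec t' (hv (Ys m)))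
      \<and> (\<forall>t t'. prefix t t' \<longrightarrow> w \<in> dec t (hv (- Ys m)) \<longrightarrow> w \<in> dec t' (hv (- Ys m)))"
      unfolding AE_all_countable[where 'i = nat] by (intro allI AE_conjI AE_dec_ext)
    then show ?thesis by eventually_elim blast
  qed
  show ?thesis
    using 1 2 3 4 Ys AE_dec_X0
  proof eventually_elim
    case (elim w)
    note ext = elim(1)[rule_format] and refine = elim(2)[rule_format] and excl = elim(3)[rule_format]
      and ext' = elim(4)[rule_format]
    show ?case
    proof (intro impI allI)
      fix t N assume w: "w \<in> P0" and t: "prefix t0 t"
      have mono: "reach n t w \<subseteq> take n ` reach n' t w" if "n \<le> n'" for n n'
      proof
        fix u assume "u \<in> reach n t w"
        then obtain t1 where t1: "length u = n" "prefix t t1" "w \<in> dec t1 (AU u)"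
          by (auto simp: reach_def)
        from refine[of u n', OF _ t1(3)] t1(1) that obtain t2 u' where
          "prefix t1 t2" "length u' = n'" "take n u' = u" "w \<in> dec t2 (AU u')" by auto
        moreover from this have "u' \<in> reach n' t w"
          using t1(2) by (auto simp: reach_def intro: prefix_order.trans)
        ultimately show "u \<in> take n ` reach n' t w" by blast
      qed
      have card_mono: "card (reach n t w) \<le> card (reach n' t w)" if "n \<le> n'" for n n'
        using surj_card_le[OF _ mono[OF that]] by simp
      have step: "\<exists>n'. card (reach n t w) < card (reach n' t w)" if ne: "u \<in> reach n t w" for n u
      proof -
        from ne obtain t1 where t1: "length u = n" "prefix t t1" "w \<in> dec t1 (AU u)"
          by (auto simp: reach_def)
        have "prefix t0 t1" using t t1(2) by (rule prefix_order.trans)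
        then obtain m t2 t3 where m: "prefix t1 t2" "prefix t1 t3"
            "w \<in> dec t2 (hv (Ys m))" "w \<in> dec t3 (hv (- Ys m))"
          using elim(5) w unfolding split_def by blast
        define n' where "n' = max n (Suc m)"
        have n': "n \<le> n'" "m < n'" by (auto simp: n'_def)
        have un: "length u \<le> n'" using t1(1) n'(1) by simp
        from refine[OF un ext[OF m(1) t1(3)]] obtain t4 u4 where u4:
          "prefix t2 t4" "length u4 = n'" "take n u4 = u" "w \<in> dec t4 (AU u4)" using t1(1) by auto
        from refine[OF un ext[OF m(2) t1(3)]] obtain t5 u5 where u5:
          "prefix t3 t5" "length u5 = n'" "take n u5 = u" "w \<in> dec t5 (AU u5)" using t1(1) by auto
        have "w \<in> dec t4 (hv (Ys m))" using ext'[OF u4(1), of m] m(3) by blast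
        then have "u4 ! m" using excl[of m u4 t4] u4(2,4) n'(2) by (cases "u4 ! m") auto
        moreover have "w \<in> dec t5 (hv (- Ys m))" using ext'[OF u5(1), of m] m(4) by blast
        then have "\<not> u5 ! m" using excl[of m u5 t5] u5(2,4) n'(2) by (cases "u5 ! m") auto
        ultimately have ne45: "u4 \<noteq> u5" by blast
        have in4: "u4 \<in> reach n' t w" and in5: "u5 \<in> reach n' t w"
          using u4 u5 m t1(2) by (auto simp: reach_def intro: prefix_order.trans)
        have "reach n t w \<subseteq> take n ` (reach n' t w - {u5})"
        proof
          fix v assume "v \<in> reach n t w"
          then obtain v' where v': "v' \<in> reach n' t w" "v = take n v'" using mono[OF n'(1)] by blast
          show "v \<in> take n ` (reach n' t w - {u5})"
          proof (cases "v' = u5")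
            case True
            then have "v = take n u4" using v' u4 u5 by simp
            then show ?thesis using in4 ne45 by blast
          qed (use v' in blast)
        qed
        then have "card (reach n t w) \<le> card (reach n' t w - {u5})"
          by (intro surj_card_le) auto
        also have "\<dots> < card (reach n' t w)"
          using in5 by (intro card_Diff1_less) auto
        finally show ?thesis by blast
      qed
      have "\<exists>n. N < card (reach n t w)"
      proof (induction N)
        case 0
        have "[] \<in> reach 0 t w"
          using elim(6) w t by (auto simp: reach_def AU_Nil)
        then have "0 < card (reach 0 t w)" by (auto simp: card_gt_0_iff)
        then show ?case by blast
      next
        case (Suc N)
        then obtain n where n: "N < card (reach n t w)" by blast
        then obtain u where "u \<in> reach n t w" by fastforce
        from step[OF this] n show ?case by (meson Suc_lessI less_trans_Suc order_less_le_trans Suc_leI)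
      qed
      then obtain n where "N < card (reach n t w)" by blast
      then show "\<forall>\<^sub>F n in sequentially. N \<le> card (reach n t w)"
        unfolding eventually_sequentially using card_mono by (meson less_imp_le order_trans)
    qed
  qed
qed

end

text \<open>There are finitely many possible values, and each is attained on a finite Boolean
  combination of measurable sets.\<close>

lemma sets_reach_pred [measurable]: "{w. \<Phi> (reach Ys n t w)} \<in> sets M"
proof -
  let ?W = "{u :: bool list. length u = n}"
  have W: "finite ?W" using finite_lists_length_eq[OF finite[of "UNIV :: bool set"], of n] by simp
  have sub: "reach Ys n t w \<subseteq> ?W" for w by (auto simp: reach_def)
  define J where "J u = (\<Union>t'\<in>{t'. prefix t t'}. dec t' (AU Ys u))" for u
  have J: "J u \<in> sets M" for u unfolding J_def by (intro sets.countable_UN'') auto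
  have mem: "u \<in> reach Ys n t w \<longleftrightarrow> w \<in> J u" if "u \<in> ?W" for u w
    using that by (auto simp: reach_def J_def)
  have "{w. reach Ys n t w = A} = (\<Inter>u\<in>?W. if u \<in> A then J u else - J u)" if "A \<subseteq> ?W" for A
  proof (intro set_eqI iffI)
    fix w assume "w \<in> {w. reach Ys n t w = A}"
    then show "w \<in> (\<Inter>u\<in>?W. if u \<in> A then J u else - J u)" using mem by auto
  next
    fix w assume w: "w \<in> (\<Inter>u\<in>?W. if u \<in> A then J u else - J u)"
    have "u \<in> reach Ys n t w \<longleftrightarrow> u \<in> A" if "u \<in> ?W" for u
      unfolding mem[OF that] using INT_D[OF w that] by (auto split: if_splits)
    then show "w \<in> {w. reach Ys n t w = A}" using sub[of w] \<open>A \<subseteq> ?W\<close> by blast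
  qed
  moreover have "(\<Inter>u\<in>?W. if u \<in> A then J u else - J u) \<in> sets M" for A
  proof (rule sets.countable_INT'')
    show "(if u \<in> A then J u else - J u) \<in> sets M" for u
      using J sets.compl_sets[OF J[of u]] by (auto simp: Compl_eq_Diff_UNIV)
  qed (use sets.top[of M] in auto)
  ultimately have A: "{w. reach Ys n t w = A} \<in> sets M" if "A \<subseteq> ?W" for A
    using that by simp
  have "{w. \<Phi> (reach Ys n t w)} = (\<Union>A\<in>{A \<in> Pow ?W. \<Phi> A}. {w. reach Ys n t w = A})"
    using sub by blast
  also have "\<dots> \<in> sets M"
    using W A by (intro sets.finite_UN) auto
  finally show ?thesis .
qed

text \<open>The probabilistic method: \<open>Y\<close> collects the words in a colour class
  \<open>K\<close>. A condition with at least \<open>N\<close> reachable words can fail to be split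
  only if these are monochromatic, which happens for a fraction of at most
  \<open>2 * (1/2) ^ N\<close> of the colourings.\<close>

lemma split_most:
  assumes Ts: "finite Ts" "\<And>t. t \<in> Ts \<Longrightarrow> prefix t0 t" and \<epsilon>: "0 < \<epsilon>"
  shows "\<exists>Y. measure M {w \<in> P0. \<exists>t\<in>Ts. \<not> split Y t w} \<le> \<epsilon>"
proof -
  from splitting_sequence obtain Ys :: "nat \<Rightarrow> (nat \<Rightarrow> bool) set"
    where Ys: "AE w in M. w \<in> P0 \<longrightarrow> (\<forall>t. prefix t0 t \<longrightarrow> (\<exists>m. split (Ys m) t w))" ..
  have "(\<lambda>N. real (card Ts) * 2 * (1/2) ^ N) \<longlonglongrightarrow> real (card Ts) * 2 * 0"
    by (intro tendsto_mult tendsto_const LIMSEQ_power_zero) simp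
  then have "\<forall>\<^sub>F N in sequentially. real (card Ts) * 2 * (1/2) ^ N < \<epsilon> / 2"
    using \<epsilon> by (intro order_tendstoD) auto
  then obtain N where N: "real (card Ts) * 2 * (1/2) ^ N < \<epsilon> / 2"
    by (auto simp: eventually_sequentially)
  \<comment> \<open>The part of \<open>P0\<close> on which some condition still has too few
    reachable words; its measure tends to zero as the length grows.\<close>
  define E where "E n = {w \<in> P0. \<exists>t\<in>Ts. card (reach Ys n t w) < N}" for n
  have E_eq: "E n = P0 \<inter> (\<Union>t\<in>Ts. {w. card (reach Ys n t w) < N})" for n
    by (auto simp: E_def)
  have E [measurable]: "E n \<in> sets M" for n
    unfolding E_eq using Ts(1) sets_reach_pred[of "\<lambda>R. card R < N"] by (intro sets.Int sets.finite_UN) auto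
  have "(\<lambda>n. measure M (E n)) \<longlonglongrightarrow> 0"
  proof (rule cantor.measure_eventually_avoided)
    show "AE w in M. \<forall>\<^sub>F n in sequentially. w \<notin> E n"
      using AE_reach_grows[OF Ys]
    proof eventually_elim
      case (elim w)
      show ?case
      proof (cases "w \<in> P0")
        case True
        then have "\<forall>\<^sub>F n in sequentially. \<forall>t\<in>Ts. N \<le> card (reach Ys n t w)"
          using elim Ts by (intro eventually_ball_finite) auto
        then show ?thesis by eventually_elim (auto simp: E_def not_less)
      qed (simp add: E_def)
    qed
  qed simp
  then have "\<forall>\<^sub>F n in sequentially. measure M (E n) < \<epsilon> / 2"
    using \<epsilon> by (intro order_tendstoD) auto
  then obtain n where n: "measure M (E n) < \<epsilon> / 2"
    by (auto simp: eventually_sequentially)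
  define W where "W = {u :: bool list. length u = n}"
  have W: "finite W" using finite_lists_length_eq[OF finite[of "UNIV :: bool set"], of n] by (simp add: W_def)
  have sub: "reach Ys n t w \<subseteq> W" for t w by (auto simp: reach_def W_def)
  define bad where "bad K t = {w. N \<le> card (reach Ys n t w) \<and> (reach Ys n t w \<subseteq> K \<or> reach Ys n t w \<inter> K = {})}" for K t
  have bad [measurable]: "bad K t \<in> sets M" for K t
    unfolding bad_def by (rule sets_reach_pred[of "\<lambda>R. N \<le> card R \<and> (R \<subseteq> K \<or> R \<inter> K = {})"])
  have int: "integrable M (indicat_real (bad K t))" for K t
    by (rule integrable_real_indicator) (auto simp: less_top[symmetric])
  text \<open>Averaging over all colourings \<open>K\<close> of the words of length \<open>n\<close>.\<close>
  have avg: "(\<Sum>K\<in>Pow W. measure M (bad K t)) \<le> 2 * 2 ^ card W * (1/2) ^ N" for t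
  proof -
    have "(\<Sum>K\<in>Pow W. measure M (bad K t)) = (\<integral>w. (\<Sum>K\<in>Pow W. indicator (bad K t) w) \<partial>M)"
      by (subst Bochner_Integration.integral_sum) (auto simp: int)
    also have "\<dots> \<le> (\<integral>w. 2 * 2 ^ card W * (1/2) ^ N \<partial>M)"
    proof (rule integral_mono)
      fix w
      show "(\<Sum>K\<in>Pow W. indicator (bad K t) w) \<le> (2 * 2 ^ card W * (1/2) ^ N :: real)"
      proof (cases "N \<le> card (reach Ys n t w)")
        case True
        have "(\<Sum>K\<in>Pow W. indicator (bad K t) w :: real)
            = (\<Sum>K\<in>Pow W. if reach Ys n t w \<subseteq> K \<or> reach Ys n t w \<inter> K = {} then 1 else 0)"
          using True by (intro sum.cong) (auto simp: bad_def indicator_def)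
        also have "\<dots> = real (card {K \<in> Pow W. reach Ys n t w \<subseteq> K \<or> reach Ys n t w \<inter> K = {}})"
          using W by (subst sum.inter_filter[symmetric]) auto
        also have "\<dots> \<le> 2 * 2 ^ card W * (1/2) ^ N"
          by (rule card_monochromatic_colourings[OF W sub True])
        finally show ?thesis .
      next
        case False
        then have "(\<Sum>K\<in>Pow W. indicator (bad K t) w :: real) = 0"
          by (intro sum.neutral) (auto simp: bad_def indicator_def)
        then show ?thesis by simp
      qed
    qed (auto intro: int)
    also have "\<dots> = 2 * 2 ^ card W * (1/2) ^ N"
      using cantor.prob_space by simp
    finally show ?thesis .
  qed
  have "\<exists>K\<in>Pow W. (\<Sum>t\<in>Ts. measure M (bad K t)) \<le> real (card Ts) * 2 * (1/2) ^ N"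
  proof (rule ccontr)
    assume "\<not> ?thesis"
    then have "(\<Sum>K\<in>Pow W. real (card Ts) * 2 * (1/2) ^ N) < (\<Sum>K\<in>Pow W. \<Sum>t\<in>Ts. measure M (bad K t))"
      using W by (intro sum_strict_mono) (auto simp: not_le)
    also have "\<dots> = (\<Sum>t\<in>Ts. \<Sum>K\<in>Pow W. measure M (bad K t))"
      by (rule sum.swap)
    also have "\<dots> \<le> (\<Sum>t\<in>Ts. 2 * 2 ^ card W * (1/2) ^ N)"
      by (intro sum_mono avg)
    finally show False
      using W by (simp add: card_Pow)
  qed
  then obtain K where K: "(\<Sum>t\<in>Ts. measure M (bad K t)) < \<epsilon> / 2"
    using N by (meson le_less_trans)
  define Y where "Y = {z. word Ys n z \<in> K}"
  have into: "AE w in M. \<forall>u t. length u = n \<longrightarrow> w \<in> dec t (AU Ys u) \<longrightarrow> w \<in> dec t (hv (if u \<in> K then Y else - Y))"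
    unfolding AE_all_countable
  proof (intro allI)
    fix u t
    show "AE w in M. length u = n \<longrightarrow> w \<in> dec t (AU Ys u) \<longrightarrow> w \<in> dec t (hv (if u \<in> K then Y else - Y))"
    proof (cases "length u = n")
      case True
      then have "AU Ys u - hv (if u \<in> K then Y else - Y) = {}"
        by (auto simp: AU_def hv_def Y_def)
      then have "AU Ys u - hv (if u \<in> K then Y else - Y) \<in> I" by (simp only: I_empty)
      from AE_dec_mono[OF prefix_order.refl[of t] this] show ?thesis by eventually_elim simp
    qed simp
  qed
  have "measure M {w \<in> P0. \<exists>t\<in>Ts. \<not> split Y t w} \<le> measure M (E n \<union> (\<Union>t\<in>Ts. bad K t))"
  proof (rule cantor.finite_measure_mono_AE)
    show "AE w in M. w \<in> {w \<in> P0. \<exists>t\<in>Ts. \<not> split Y t w} \<longrightarrow> w \<in> E n \<union> (\<Union>t\<in>Ts. bad K t)"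
      using into
    proof eventually_elim
      case (elim w)
      show ?case
      proof (rule impI, rule ccontr)
        assume w: "w \<in> {w \<in> P0. \<exists>t\<in>Ts. \<not> split Y t w}" and good: "w \<notin> E n \<union> (\<Union>t\<in>Ts. bad K t)"
        then obtain t where t: "t \<in> Ts" "\<not> split Y t w" "w \<in> P0" by blast
        have "N \<le> card (reach Ys n t w)" using good t by (auto simp: E_def)
        with good t have "\<not> reach Ys n t w \<subseteq> K" "reach Ys n t w \<inter> K \<noteq> {}" by (auto simp: bad_def)
        then obtain u v where uv: "u \<in> reach Ys n t w" "u \<in> K" "v \<in> reach Ys n t w" "v \<notin> K" by blast
        then obtain t1 t2 where "prefix t t1" "w \<in> dec t1 (AU Ys u)" "length u = n"
            "prefix t t2" "w \<in> dec t2 (AU Ys v)" "length v = n"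
          by (auto simp: reach_def)
        then have "split Y t w"
          unfolding split_def using elim[rule_format, of u t1] elim[rule_format, of v t2] uv by auto
        with t show False by blast
      qed
    qed
  next
    show "E n \<union> (\<Union>t\<in>Ts. bad K t) \<in> sets M"
      using Ts(1) by (intro sets.Un sets.finite_UN) auto
  qed
  also have "\<dots> \<le> measure M (E n) + measure M (\<Union>t\<in>Ts. bad K t)"
    using Ts(1) by (intro measure_Un_le sets.finite_UN) auto
  also have "measure M (\<Union>t\<in>Ts. bad K t) \<le> (\<Sum>t\<in>Ts. measure M (bad K t))"
    using Ts(1) by (intro measure_UNION_le) auto
  finally show ?thesis using n K by (intro exI[of _ Y]) linarith
qed

text \<open>A bound on the lengths keeps the conditions that must be split at the next stage finite
  in number.\<close>

definition split_within :: "nat \<Rightarrow> (nat \<Rightarrow> bool) set \<Rightarrow> bool list \<Rightarrow> (nat \<Rightarrow> bool) \<Rightarrow> bool" where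
  "split_within m Y t w \<longleftrightarrow> (\<exists>t1 t2. length t1 \<le> m \<and> length t2 \<le> m \<and> prefix t t1 \<and> prefix t t2 \<and>
     w \<in> dec t1 (hv Y) \<and> w \<in> dec t2 (hv (- Y)))"

lemma sets_split_within [measurable]: "{w. split_within m Y t w} \<in> sets M"
proof -
  have "{w. split_within m Y t w} = (\<Union>t1\<in>{t1. length t1 \<le> m \<and> prefix t t1}. \<Union>t2\<in>{t2. length t2 \<le> m \<and> prefix t t2}.
      dec t1 (hv Y) \<inter> dec t2 (hv (- Y)))"
    by (auto simp: split_within_def)
  also have "\<dots> \<in> sets M"
    by (intro sets.countable_UN'') auto
  finally show ?thesis .
qed

text \<open>The two witnesses of a splitting have finite length, so \<open>split\<close> is the
  increasing limit of \<open>split_within m\<close>, and a large \<open>m\<close> loses little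
  measure.\<close>

lemma split_within_most:
  assumes Ts: "finite Ts" "\<And>t. t \<in> Ts \<Longrightarrow> prefix t0 t" and \<epsilon>: "0 < \<epsilon>"
  shows "\<exists>Y m. k \<le> m \<and> measure M {w \<in> P0. \<exists>t\<in>Ts. \<not> split_within m Y t w} \<le> \<epsilon>"
proof -
  obtain Y where Y: "measure M {w \<in> P0. \<exists>t\<in>Ts. \<not> split Y t w} \<le> \<epsilon> / 2"
    using split_most[OF Ts, of "\<epsilon> / 2"] \<epsilon> by auto
  define F where "F m = {w. (\<forall>t\<in>Ts. split Y t w) \<and> (\<exists>t\<in>Ts. \<not> split_within m Y t w)}" for m
  define G where "G = {w \<in> P0. \<exists>t\<in>Ts. \<not> split Y t w}"
  have "F m = (\<Inter>t\<in>Ts. {w. split Y t w}) \<inter> (\<Union>t\<in>Ts. UNIV - {w. split_within m Y t w})" for m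
    by (auto simp: F_def)
  then have F: "F m \<in> sets M" for m
    using Ts(1) sets.top[of M] by (auto intro!: sets.Int sets.finite_UN sets.countable_INT'' countable_finite)
  have "G = P0 \<inter> (\<Union>t\<in>Ts. UNIV - {w. split Y t w})"
    by (auto simp: G_def)
  then have G: "G \<in> sets M"
    using Ts(1) sets.top[of M] by (auto intro!: sets.Int sets.finite_UN)
  have "(\<lambda>m. measure M (F m)) \<longlonglongrightarrow> 0"
  proof (rule cantor.measure_eventually_avoided[OF F])
    have "\<forall>\<^sub>F m in sequentially. w \<notin> F m" for w
    proof (cases "\<forall>t\<in>Ts. split Y t w")
      case True
      have "\<forall>\<^sub>F m in sequentially. split_within m Y t w" if "t \<in> Ts" for t
      proof -
        from True that obtain t1 t2 where "prefix t t1" "prefix t t2" "w \<in> dec t1 (hv Y)" "w \<in> dec t2 (hv (- Y))"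
          unfolding split_def by blast
        then show ?thesis
          unfolding eventually_sequentially split_within_def
          by (intro exI[of _ "max (length t1) (length t2)"] allI impI exI[of _ t1] exI[of _ t2]) auto
      qed
      then have "\<forall>\<^sub>F m in sequentially. \<forall>t\<in>Ts. split_within m Y t w"
        using Ts(1) by (intro eventually_ball_finite) auto
      then show ?thesis by eventually_elim (auto simp: F_def)
    qed (simp add: F_def)
    then show "AE w in M. \<forall>\<^sub>F m in sequentially. w \<notin> F m" by simp
  qed
  then have "\<forall>\<^sub>F m in sequentially. measure M (F m) < \<epsilon> / 2"
    using \<epsilon> by (intro order_tendstoD) auto
  then obtain m0 where m0: "\<And>m. m0 \<le> m \<Longrightarrow> measure M (F m) < \<epsilon> / 2"
    by (auto simp: eventually_sequentially)
  define m where "m = max m0 k"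
  have "measure M {w \<in> P0. \<exists>t\<in>Ts. \<not> split_within m Y t w} \<le> measure M (G \<union> F m)"
    using F G by (intro cantor.finite_measure_mono) (auto simp: F_def G_def)
  also have "\<dots> \<le> measure M G + measure M (F m)"
    using F G by (intro measure_Un_le) auto
  finally show ?thesis
    using Y m0[of m] by (intro exI[of _ Y] exI[of _ m]) (simp add: m_def G_def)
qed

text \<open>
  The splitting sets \<open>D n\<close> are chosen together with finite sets of conditions such that each condition of
  the \<open>n\<close>-th set is split by two conditions of the next one. Hence any pattern of memberships in
  \<open>D n, D (n + 1), \<dots>\<close> can be realised without gaps, and run lengths yield all natural numbers.
\<close>

lemma coding_functions:
  "\<exists>f :: nat \<Rightarrow> (nat \<Rightarrow> bool) \<Rightarrow> nat. AE w in M. w \<in> P0 \<longrightarrow> (\<forall>t. prefix t0 t \<longrightarrow>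
     (\<forall>\<^sub>F n in sequentially. \<forall>k. \<exists>t'. prefix t t' \<and> w \<in> dec t' (hv {z. f n z = k})))"
proof -
  define Ts where "Ts m = {t. prefix t0 t \<and> length t \<le> m}" for m
  have finTs: "finite (Ts m)" for m
    using finite_lists_length_le[OF finite[of "UNIV :: bool set"], of m]
    by (rule rev_finite_subset) (auto simp: Ts_def)
  have "\<exists>Y m'. Suc m \<le> m' \<and> measure M {w \<in> P0. \<exists>t\<in>Ts m. \<not> split_within m' Y t w} \<le> (1/2) ^ n" for n m
    by (rule split_within_most[OF finTs]) (auto simp: Ts_def)
  then have "\<forall>n m. \<exists>Ym. Suc m \<le> snd Ym \<and>
      measure M {w \<in> P0. \<exists>t\<in>Ts m. \<not> split_within (snd Ym) (fst Ym) t w} \<le> (1/2) ^ n"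
    by simp
  from choice[OF allI, of "\<lambda>nm Ym. Suc (snd nm) \<le> snd Ym \<and>
      measure M {w \<in> P0. \<exists>t\<in>Ts (snd nm). \<not> split_within (snd Ym) (fst Ym) t w} \<le> (1/2) ^ fst nm"] this
  obtain g where g: "\<forall>nm. Suc (snd nm) \<le> snd (g nm) \<and>
      measure M {w \<in> P0. \<exists>t\<in>Ts (snd nm). \<not> split_within (snd (g nm)) (fst (g nm)) t w} \<le> (1/2) ^ fst nm"
    by auto
  \<comment> \<open>Length bounds chosen by recursion: \<open>D n\<close> splits every extension of
    \<open>t0\<close> of length at most \<open>mm n\<close> by conditions of length at most
    \<open>mm (Suc n)\<close>, except on a part of \<open>P0\<close> of measure at most
    \<open>(1/2) ^ n\<close>.\<close>
  define mm where "mm = rec_nat 0 (\<lambda>n m. snd (g (n, m)))"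
  define D where "D n = fst (g (n, mm n))" for n
  have mm_Suc: "mm (Suc n) = snd (g (n, mm n))" for n by (simp add: mm_def)
  have "Suc (mm n) \<le> mm (Suc n)" for n
    using g[rule_format, of "(n, mm n)"] by (simp add: mm_Suc)
  then have mm_ge: "n \<le> mm n" for n
    by (induction n) (auto intro: order_trans[of "Suc _"])
  define B where "B n = {w \<in> P0. \<exists>t\<in>Ts (mm n). \<not> split_within (mm (Suc n)) (D n) t w}" for n
  have "B n = P0 \<inter> (\<Union>t\<in>Ts (mm n). UNIV - {w. split_within (mm (Suc n)) (D n) t w})" for n
    by (auto simp: B_def)
  then have B: "B n \<in> sets M" for n
    using finTs sets.top[of M] by (auto intro!: sets.Int sets.finite_UN)
  have "measure M (B n) \<le> (1/2) ^ n" for n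
    using g[rule_format, of "(n, mm n)"] by (simp add: B_def D_def mm_Suc)
  with B have good: "AE w in M. \<forall>\<^sub>F n in sequentially. w \<notin> B n"
    by (rule cantor.AE_eventually_not_in)
  \<comment> \<open>\<open>f n z\<close> counts the sets from \<open>D n\<close> on that
    \<open>z\<close> misses before the first one containing it; \<open>pat n k\<close> records
    \<open>k\<close> misses in a row.\<close>
  define f where "f n z = (LEAST k. z \<in> D (n + k))" for n z
  define pat where "pat n k = {z. \<forall>i<k. z \<notin> D (n + i)}" for n k
  have 1: "AE w in M. \<forall>n k t. (\<forall>t'. prefix t t' \<longrightarrow> w \<in> dec t (hv (pat n k)) \<longrightarrow> w \<in> dec t' (hv (pat n k))) \<and>
      (w \<in> dec t (hv (pat n k)) \<and> w \<in> dec t (hv (- D (n + k))) \<longrightarrow> w \<in> dec t (hv (pat n k) \<inter> hv (- D (n + k)))) \<and>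
      (w \<in> dec t (hv (pat n k)) \<and> w \<in> dec t (hv (D (n + k))) \<longrightarrow> w \<in> dec t (hv (pat n k) \<inter> hv (D (n + k)))) \<and>
      (w \<in> dec t (hv (pat n k) \<inter> hv (D (n + k))) \<longrightarrow> w \<in> dec t (hv {z. f n z = k}))"
    unfolding AE_all_countable
  proof (intro allI AE_conjI)
    fix n k t
    show "AE w in M. \<forall>t'. prefix t t' \<longrightarrow> w \<in> dec t (hv (pat n k)) \<longrightarrow> w \<in> dec t' (hv (pat n k))"
      unfolding AE_all_countable by (intro allI AE_impI AE_dec_mono) simp_all
    show "AE w in M. w \<in> dec t (hv (pat n k) \<inter> hv (D (n + k))) \<longrightarrow> w \<in> dec t (hv {z. f n z = k})"
    proof (rule AE_dec_mono[OF prefix_order.refl])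
      have "pat n k \<inter> D (n + k) \<subseteq> {z. f n z = k}"
        unfolding f_def pat_def by (auto intro!: Least_equality simp: not_less[symmetric])
      then have "hv (pat n k) \<inter> hv (D (n + k)) - hv {z. f n z = k} = {}" by (auto simp: hv_def)
      then show "hv (pat n k) \<inter> hv (D (n + k)) - hv {z. f n z = k} \<in> I" by (simp only: I_empty)
    qed
  qed (rule AE_dec_Int)+
  have pat_Suc: "hv (pat n (Suc k)) = hv (pat n k) \<inter> hv (- D (n + k))" for n k
    by (auto simp: hv_def pat_def less_Suc_eq)
  have "AE w in M. w \<in> P0 \<longrightarrow> (\<forall>t. prefix t0 t \<longrightarrow>
     (\<forall>\<^sub>F n in sequentially. \<forall>k. \<exists>t'. prefix t t' \<and> w \<in> dec t' (hv {z. f n z = k})))"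
    using 1 good AE_dec_X0
  proof eventually_elim
    case (elim w)
    note E = elim(1)[rule_format]
    show ?case
    proof (intro impI allI)
      fix t assume w: "w \<in> P0" and t: "prefix t0 t"
      from elim(2) obtain n0 where n0: "\<And>n. n0 \<le> n \<Longrightarrow> w \<notin> B n"
        by (auto simp: eventually_sequentially)
      have split: "\<exists>t1 t2. t1 \<in> Ts (mm (Suc n)) \<and> t2 \<in> Ts (mm (Suc n)) \<and> prefix t' t1 \<and> prefix t' t2 \<and>
          w \<in> dec t1 (hv (D n)) \<and> w \<in> dec t2 (hv (- D n))" if "n0 \<le> n" "t' \<in> Ts (mm n)" for n t'
      proof -
        from n0[OF that(1)] w that(2) have "split_within (mm (Suc n)) (D n) t' w" by (auto simp: B_def)
        moreover have "prefix t0 t'" using that(2) by (simp add: Ts_def)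
        ultimately show ?thesis
          unfolding split_within_def Ts_def by (blast intro: prefix_order.trans)
      qed
      have "\<exists>t'. prefix t t' \<and> w \<in> dec t' (hv {z. f n z = k})" if n: "max n0 (length t) \<le> n" for n k
      proof -
        \<comment> \<open>Pass \<open>k\<close> times to an extension that decides against the
          current set; one more extension deciding for \<open>D (n + k)\<close> then gives the value
          \<open>k\<close>.\<close>
        have "\<exists>t'. prefix t t' \<and> t' \<in> Ts (mm (n + k)) \<and> w \<in> dec t' (hv (pat n k))" for k
        proof (induction k)
          case 0
          have "t \<in> Ts (mm (n + 0))" using n t mm_ge[of n] by (auto simp: Ts_def)
          moreover have "w \<in> dec t (hv (pat n 0))" using elim(3) w t by (simp add: pat_def)
          ultimately show ?case by blast
        next
          case (Suc k)
          then obtain t' where t': "prefix t t'" "t' \<in> Ts (mm (n + k))" "w \<in> dec t' (hv (pat n k))" by blast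
          from split[OF _ t'(2)] n obtain t2 where t2: "t2 \<in> Ts (mm (Suc (n + k)))" "prefix t' t2"
              "w \<in> dec t2 (hv (- D (n + k)))" by auto
          have "w \<in> dec t2 (hv (pat n k))" using E t2(2) t'(3) by blast
          with E t2(3) have "w \<in> dec t2 (hv (pat n (Suc k)))" unfolding pat_Suc by blast
          with t' t2 show ?case by (auto intro: prefix_order.trans)
        qed
        then obtain t' where t': "prefix t t'" "t' \<in> Ts (mm (n + k))" "w \<in> dec t' (hv (pat n k))" by blast
        from split[OF _ t'(2)] n obtain t1 where t1: "prefix t' t1" "w \<in> dec t1 (hv (D (n + k)))" by auto
        have "w \<in> dec t1 (hv (pat n k))" using E t1(1) t'(3) by blast
        with E t1(2) have "w \<in> dec t1 (hv {z. f n z = k})" by blast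
        with t' t1 show ?thesis by (auto intro: prefix_order.trans)
      qed
      then show "\<forall>\<^sub>F n in sequentially. \<forall>k. \<exists>t'. prefix t t' \<and> w \<in> dec t' (hv {z. f n z = k})"
        unfolding eventually_sequentially by blast
    qed
  qed
  then show ?thesis by blast
qed

end

section \<open>The contradiction\<close>

text \<open>A fixed guess of the first \<open>n\<close> bits is right with measure at most
  \<open>(1/2) ^ n\<close>, so Borel-Cantelli applies; a guess of the wrong length is never
  right.\<close>

lemma AE_eventually_ne_pr:
  "AE w in cantor_measure. \<forall>\<^sub>F n in sequentially. pr n w \<noteq> v n"
proof -
  have "AE w in cantor_measure. \<forall>\<^sub>F n in sequentially. w \<notin> {w. pr n w = v n}"
  proof (rule cantor.AE_eventually_not_in)
    fix n
    show "{w. pr n w = v n} \<in> sets cantor_measure"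
      using sets_pr_in[of n "{v n}"] by simp
    show "measure cantor_measure {w. pr n w = v n} \<le> (1/2) ^ n"
    proof (cases "length (v n) = n")
      case True
      then have "{w. pr n w = v n} = {w. pre (v n) w}" by (simp add: pre_def)
      then show ?thesis using measure_pre[of "v n"] True by simp
    next
      case False
      then have "{w. pr n w = v n} = {}" by (metis (mono_tags, lifting) Collect_empty_eq length_pr)
      then show ?thesis by simp
    qed
  qed
  then show ?thesis by simp
qed

context cohen_random_rep
begin

text \<open>A condition inside the difference would have an extension deciding \<open>C\<close>,
  hence almost contained both in \<open>C\<close> and in its complement. In forcing terms, density
  of the decisions for \<open>C\<close> below \<open>t\<close> suffices to force
  \<open>C\<close>.\<close>

lemma ev_diff_in_I:
  assumes P: "P \<in> sets M"
    and ae: "AE w in M. w \<in> P \<longrightarrow> (\<forall>t'. prefix t t' \<longrightarrow> (\<exists>t''. prefix t' t'' \<and> w \<in> dec t'' C))"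
  shows "ev t P - C \<in> I"
proof (rule ccontr)
  assume C: "ev t P - C \<notin> I"
  have "ev t P - C \<subseteq> X" using ev_subset by blast
  from this C obtain u Q where Q: "Q \<in> sets M - null_sets M" and u: "ev u Q - (ev t P - C) \<in> I"
    by (rule dense_ev)
  have "Q - P \<in> null_sets M"
  proof (rule ccontr)
    assume "Q - P \<notin> null_sets M"
    then have "ev u (Q - P) \<notin> I" using P Q by (intro ev_notin_I) auto
    moreover have "ev u (Q - P) \<in> I" by (rule I_subset[OF u]) (auto simp: ev_def)
    ultimately show False by blast
  qed
  then have QP: "AE w in M. w \<notin> Q - P" by (rule AE_not_in)
  have "prefix t u \<or> prefix u t"
  proof (rule ccontr)
    assume "\<not> ?thesis"
    then have "ev u Q \<inter> ev t P = {}" using pre_comparable by (auto simp: ev_def)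
    then have "ev u Q \<subseteq> ev u Q - (ev t P - C)" by blast
    then have "ev u Q \<in> I" by (rule I_subset[OF u])
    then show False using ev_notin_I[OF Q] by blast
  qed
  then obtain t' where t': "prefix t t'" "prefix u t'" by auto
  have "AE w in M. \<forall>t''. prefix t' t'' \<longrightarrow> w \<notin> Q \<inter> dec t'' C"
    unfolding AE_all_countable
  proof
    fix t''
    show "AE w in M. prefix t' t'' \<longrightarrow> w \<notin> Q \<inter> dec t'' C"
    proof (rule AE_impI)
      assume t'': "prefix t' t''"
      have "ev t'' (Q \<inter> dec t'' C) - C \<in> I" by (rule ev_subset_dec) simp
      moreover have "ev t'' (Q \<inter> dec t'' C) \<subseteq> ev u Q"
        using ev_prefix[OF prefix_order.trans[OF t'(2) t'']] by (auto simp: ev_def)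
      then have "ev t'' (Q \<inter> dec t'' C) \<inter> C \<subseteq> ev u Q - (ev t P - C)" by blast
      then have "ev t'' (Q \<inter> dec t'' C) \<inter> C \<in> I" by (rule I_subset[OF u])
      ultimately have "(ev t'' (Q \<inter> dec t'' C) - C) \<union> (ev t'' (Q \<inter> dec t'' C) \<inter> C) \<in> I" by (rule I_Un)
      then have "ev t'' (Q \<inter> dec t'' C) \<in> I" by (rule I_subset) blast
      then have "Q \<inter> dec t'' C \<in> null_sets M"
        using ev_notin_I[of "Q \<inter> dec t'' C" t''] Q by auto
      then show "AE w in M. w \<notin> Q \<inter> dec t'' C" by (rule AE_not_in)
    qed
  qed
  with QP ae have "AE w in M. w \<notin> Q"
    by eventually_elim (use t' in blast)
  then show False using Q AE_iff_null_sets[of Q M] by simp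
qed

end

context cohen_random_tower
begin

lemma tower_contradiction: False
proof -
  from coding_functions obtain f :: "nat \<Rightarrow> (nat \<Rightarrow> bool) \<Rightarrow> nat" where f: "AE w in M. w \<in> P0 \<longrightarrow>
    (\<forall>t. prefix t0 t \<longrightarrow> (\<forall>\<^sub>F n in sequentially. \<forall>k. \<exists>t'. prefix t t' \<and> w \<in> dec t' (hv {z. f n z = k})))" ..
  text \<open>The random real evades everything that is guessed below \<open>h x\<close>.\<close>
  have "\<exists>y. \<forall>z\<in>low (h x). \<forall>\<^sub>F n in sequentially. pr n y \<noteq> clopen_fun (f n z) (s x)" for x
  proof -
    \<comment> \<open>Here \<open>x\<close> is fixed, so the guesses evaluated at \<open>s x\<close>
      form a fixed sequence, and \<open>s x'\<close> evades it for almost all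
      \<open>x'\<close>.\<close>
    let ?N = "\<lambda>z. {x' \<in> X. \<not> (\<forall>\<^sub>F n in sequentially. pr n (s x') \<noteq> clopen_fun (f n z) (s x))}"
    have N: "?N z \<in> I" for z
    proof -
      have "AE w in M. \<forall>\<^sub>F n in sequentially. pr n w \<noteq> clopen_fun (f n z) (s x)"
        by (rule AE_eventually_ne_pr)
      then obtain N where N: "N \<in> null_sets M"
          "{w \<in> space M. \<not> (\<forall>\<^sub>F n in sequentially. pr n w \<noteq> clopen_fun (f n z) (s x))} \<subseteq> N"
        by (auto elim!: AE_E simp: null_sets_def)
      have "?N z \<subseteq> {x' \<in> X. s x' \<in> N}" using N(2) by auto
      then show ?thesis by (rule I_subset[OF null_in_I[OF N(1)]])
    qed
    have "(\<Union>z\<in>low (h x). ?N z) \<in> I" by (rule low_UN) (rule N)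
    then have "\<not> X \<subseteq> (\<Union>z\<in>low (h x). ?N z)" using X_notin_I I_subset by blast
    then obtain x' where x': "x' \<in> X" "x' \<notin> (\<Union>z\<in>low (h x). ?N z)" by blast
    then show ?thesis by (intro exI[of _ "s x'"]) blast
  qed
  then obtain G where G: "\<And>x z. z \<in> low (h x) \<Longrightarrow> \<forall>\<^sub>F n in sequentially. pr n (G x) \<noteq> clopen_fun (f n z) (s x)"
    by metis
  \<comment> \<open>\<open>K t n v\<close> consists of the \<open>w\<close> over which some
    extension of \<open>t\<close> decides the first \<open>n\<close> bits of the name
    \<open>G\<close> to be \<open>v\<close>; \<open>R t n\<close> is the leftover without any
    decision.\<close>
  define Gs where "Gs n v = {x \<in> X0. pr n (G x) = v}" for n v
  define K where "K t n v = (\<Union>t'\<in>{t'. prefix t t'}. dec t' (Gs n v))" for t n v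
  have sK [measurable]: "K t n v \<in> sets M" for t n v
    unfolding K_def by (intro sets.countable_UN'') auto
  define R where "R t n = UNIV - (\<Union>v\<in>{v. length v = n}. K t n v)" for t n
  have sR [measurable]: "R t n \<in> sets M" for t n
    unfolding R_def using sets.top[of M] by (intro sets.Diff sets.countable_UN'') auto
  \<comment> \<open>A measurable choice of a decided value by least code. On the leftover set every
    word of length \<open>n\<close> is allowed, so the choice is total.\<close>
  define good where "good t n w i \<longleftrightarrow> length (from_nat i :: bool list) = n \<and> w \<in> K t n (from_nat i) \<union> R t n" for t n w i
  define \<kappa> where "\<kappa> t n w = (from_nat (LEAST i. good t n w i) :: bool list)" for t n w
  have good: "good t n w (LEAST i. good t n w i)" for t n w
  proof (rule LeastI_ex)
    show "\<exists>i. good t n w i"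
    proof (cases "w \<in> R t n")
      case True
      then show ?thesis by (intro exI[of _ "to_nat (replicate n False)"]) (simp add: good_def)
    next
      case False
      then obtain v where "length v = n" "w \<in> K t n v" by (auto simp: R_def)
      then show ?thesis by (intro exI[of _ "to_nat v"]) (simp add: good_def)
    qed
  qed
  have len: "length (\<kappa> t n w) = n" and mem: "w \<in> K t n (\<kappa> t n w) \<union> R t n" for t n w
    using good[of t n w] by (auto simp: good_def \<kappa>_def)
  have \<kappa> [measurable]: "\<kappa> t n \<in> measurable M (count_space UNIV)" for t n
  proof -
    have "(\<lambda>w. LEAST i. good t n w i) \<in> measurable M (count_space UNIV)"
      unfolding good_def by measurable
    then have "(\<lambda>w. (from_nat (LEAST i. good t n w i) :: bool list)) \<in> measurable M (count_space UNIV)"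
      by (rule measurable_compose) simp
    then show ?thesis by (simp add: \<kappa>_def[abs_def])
  qed
  have 1: "AE w in M. w \<in> P0 \<longrightarrow> (\<forall>t n. prefix t0 t \<longrightarrow> (\<exists>t'. prefix t t' \<and> w \<in> dec t' (Gs n (\<kappa> t n w))))"
  proof -
    have X0_UN: "X0 = (\<Union>v\<in>{v. length v = n}. Gs n v)" for n by (auto simp: Gs_def)
    have "AE w in M. \<forall>n t. w \<in> dec t (\<Union>v\<in>{v. length v = n}. Gs n v) \<longrightarrow>
        (\<exists>t'. prefix t t' \<and> (\<exists>v\<in>{v. length v = n}. w \<in> dec t' (Gs n v)))"
      unfolding AE_all_countable by (intro allI AE_dec_dense) auto
    then show ?thesis
      using AE_dec_X0
    proof eventually_elim
      case (elim w)
      show ?case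
      proof (intro impI allI)
        fix t n assume "w \<in> P0" "prefix t0 t"
        then have "w \<notin> R t n"
          using elim(1)[rule_format, of t n] elim(2) X0_UN[of n] by (auto simp: R_def K_def)
        then show "\<exists>t'. prefix t t' \<and> w \<in> dec t' (Gs n (\<kappa> t n w))"
          using mem[of w t n] by (auto simp: K_def)
      qed
    qed
  qed
  \<comment> \<open>Clopen codes replace the measurable choices with summable errors, so for almost
    every \<open>w\<close> they agree from some \<open>n\<close> on.\<close>
  have "\<exists>k. measure M {w. clopen_fun k w \<noteq> \<kappa> t n w} \<le> (1/2) ^ n" for t n
    by (rule clopen_fun_dense[OF \<kappa> len]) simp
  then obtain kk where kk: "\<And>t n. measure M {w. clopen_fun (kk t n) w \<noteq> \<kappa> t n w} \<le> (1/2) ^ n"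
    by metis
  have 2: "AE w in M. \<forall>t. \<forall>\<^sub>F n in sequentially. clopen_fun (kk t n) w = \<kappa> t n w"
    unfolding AE_all_countable
  proof
    fix t
    have "AE w in M. \<forall>\<^sub>F n in sequentially. w \<notin> {w. clopen_fun (kk t n) w \<noteq> \<kappa> t n w}"
    proof (rule cantor.AE_eventually_not_in)
      fix n
      have "{w \<in> space M. clopen_fun (kk t n) w \<noteq> \<kappa> t n w} \<in> sets M" by measurable
      then show "{w. clopen_fun (kk t n) w \<noteq> \<kappa> t n w} \<in> sets M" by simp
    qed (rule kk)
    then show "AE w in M. \<forall>\<^sub>F n in sequentially. clopen_fun (kk t n) w = \<kappa> t n w" by simp
  qed
  \<comment> \<open>\<open>\<tau>\<close> takes each word as a value at arbitrarily large arguments;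
    the second component of the pair provides the repetitions.\<close>
  define \<tau> where "\<tau> n = (from_nat (fst (prod_decode n)) :: bool list)" for n
  have \<tau>: "\<exists>n\<ge>m. \<tau> n = t" for m t
    by (intro exI[of _ "prod_encode (to_nat t, m)"]) (simp add: \<tau>_def le_prod_encode_2)
  text \<open>A single \<open>z\<close> guesses, for each condition \<open>t\<close>, infinitely many of the names decided below \<open>t\<close>.\<close>
  define B where "B t m = {z. \<exists>n\<ge>m. \<tau> n = t \<and> f n z = kk (\<tau> n) n}" for t m
  have B: "ev t0 P0 - hv (B t m) \<in> I" for t m
  proof (rule ev_diff_in_I[OF sets_P0])
    have "AE w in M. \<forall>n t'. w \<in> dec t' (hv {z. f n z = kk t n}) \<longrightarrow> m \<le> n \<and> \<tau> n = t \<longrightarrow> w \<in> dec t' (hv (B t m))"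
      unfolding AE_all_countable
    proof (intro allI)
      fix n t'
      show "AE w in M. w \<in> dec t' (hv {z. f n z = kk t n}) \<longrightarrow> m \<le> n \<and> \<tau> n = t \<longrightarrow> w \<in> dec t' (hv (B t m))"
      proof (cases "m \<le> n \<and> \<tau> n = t")
        case True
        then have "{z. f n z = kk t n} \<subseteq> B t m" by (auto simp: B_def)
        from AE_hv_mono[OF this] show ?thesis by eventually_elim blast
      next
        case False
        then show ?thesis by (intro AE_I2) blast
      qed
    qed
    then show "AE w in M. w \<in> P0 \<longrightarrow> (\<forall>t'. prefix t0 t' \<longrightarrow> (\<exists>t''. prefix t' t'' \<and> w \<in> dec t'' (hv (B t m))))"
      using f
    proof eventually_elim
      case (elim w)
      show ?case
      proof (intro impI allI)
        fix t' assume "w \<in> P0" "prefix t0 t'"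
        with elim(2) obtain n0 where
          n0: "\<And>n k. n0 \<le> n \<Longrightarrow> \<exists>t''. prefix t' t'' \<and> w \<in> dec t'' (hv {z. f n z = k})"
          unfolding eventually_sequentially by blast
        obtain n where n: "max n0 m \<le> n" "\<tau> n = t" using \<tau> by blast
        then obtain t'' where "prefix t' t''" "w \<in> dec t'' (hv {z. f n z = kk t n})"
          using n0[of n "kk t n"] by auto
        then show "\<exists>t''. prefix t' t'' \<and> w \<in> dec t'' (hv (B t m))"
          using elim(1)[rule_format, of t'' n] n by auto
      qed
    qed
  qed
  \<comment> \<open>Countably many exceptional sets in \<open>I\<close> cannot cover the condition,
    so one \<open>x0\<close> lies in all the events and fixes \<open>z\<close>.\<close>
  have "(\<Union>(t, m)\<in>UNIV. ev t0 P0 - hv (B t m)) \<in> I"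
    by (rule I_UN) (use B in auto)
  then have "\<not> ev t0 P0 \<subseteq> (\<Union>(t, m)\<in>UNIV. ev t0 P0 - hv (B t m))"
    using ev_notin_I[OF P0] I_subset by blast
  then obtain x0 where x0: "\<And>t m. x0 \<in> hv (B t m)" by blast
  define z where "z = h x0"
  have x0_X0: "x0 \<in> X0" using x0 by (auto simp: hv_def)
  have z: "\<exists>n\<ge>m. \<tau> n = t \<and> f n z = kk t n" for t m
    using x0[of t m] by (auto simp: hv_def z_def B_def)
  \<comment> \<open>On \<open>E m\<close> the name evades the guesses of \<open>z\<close> from
    \<open>m\<close> on. These sets cover almost all of \<open>X0\<close> because \<open>z\<close>
    lies in \<open>low (h x)\<close> for almost all \<open>x\<close>.\<close>
  define E where "E m = {x \<in> X0. \<forall>n\<ge>m. pr n (G x) \<noteq> clopen_fun (f n z) (s x)}" for m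
  have "X0 - (\<Union>m. E m) \<subseteq> {x \<in> X0. h x0 \<notin> low (h x)}"
    using G by (auto simp: E_def z_def eventually_sequentially)
  then have X0_E: "X0 - (\<Union>m. E m) \<in> I" by (rule I_subset[OF low_in_I[OF x0_X0]])
  have 3: "AE w in M. w \<in> P0 \<longrightarrow> (\<exists>t m. prefix t0 t \<and> w \<in> dec t (E m))"
    using AE_dec_X0 AE_dec_mono[OF prefix_order.refl[of t0] X0_E] AE_dec_dense[where J = "UNIV :: nat set" and t = t0 and A = E, OF countableI_type]
    by eventually_elim auto
  have 4: "AE w in M. \<forall>m t t'. prefix t t' \<longrightarrow> w \<in> dec t (E m) \<longrightarrow> w \<in> dec t' (E m)"
    unfolding AE_all_countable[where 'i = nat] by (intro allI AE_dec_ext)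
  have 5: "AE w in M. \<forall>t n m v. w \<in> dec t (Gs n v) \<and> w \<in> dec t (E m) \<longrightarrow> w \<in> dec t (Gs n v \<inter> E m)"
    unfolding AE_all_countable by (intro allI AE_dec_Int)
  \<comment> \<open>No positive condition can decide evasion from \<open>m\<close> on, decide the
    first \<open>n\<close> bits to be \<open>v\<close>, and make the guess of \<open>z\<close> equal
    to \<open>v\<close>.\<close>
  have 6: "AE w in M. \<forall>t n m v. m \<le> n \<longrightarrow> w \<notin> dec t (Gs n v \<inter> E m) \<inter> {w. clopen_fun (f n z) w = v}"
    unfolding AE_all_countable
  proof (intro allI AE_impI)
    fix t n m v assume mn: "m \<le> (n :: nat)"
    let ?Q = "dec t (Gs n v \<inter> E m) \<inter> {w. clopen_fun (f n z) w = v}"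
    have Q: "?Q \<in> sets M"
      using measurable_sets[OF measurable_clopen_fun, of "{v}" "f n z"] by (auto simp: vimage_def)
    have "ev t ?Q - Gs n v \<inter> E m \<in> I" by (rule ev_subset_dec) blast
    moreover have "ev t ?Q \<inter> (Gs n v \<inter> E m) = {}"
      using mn by (auto simp: ev_def Gs_def E_def)
    then have "ev t ?Q - Gs n v \<inter> E m = ev t ?Q" by blast
    ultimately have "ev t ?Q \<in> I" by simp
    then have "?Q \<in> null_sets M" using ev_notin_I[of ?Q t] Q by blast
    then show "AE w in M. w \<notin> ?Q" by (rule AE_not_in)
  qed
  \<comment> \<open>Some \<open>t\<close> decides \<open>E m\<close>. At a large \<open>n\<close>
    with \<open>f n z = kk t n\<close>, the guess of \<open>z\<close> is exactly the value of the
    name that an extension of \<open>t\<close> decides.\<close>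
  have "AE w in M. w \<notin> P0"
    using 1 2 3 4 5 6
  proof eventually_elim
    case (elim w)
    show ?case
    proof
      assume w: "w \<in> P0"
      with elim(3) obtain t m where t: "prefix t0 t" "w \<in> dec t (E m)" by blast
      from elim(2) obtain n0 where n0: "\<And>n. n0 \<le> n \<Longrightarrow> clopen_fun (kk t n) w = \<kappa> t n w"
        unfolding eventually_sequentially by blast
      from z[of "max m n0" t] obtain n where n: "m \<le> n" "n0 \<le> n" "f n z = kk t n" by auto
      from elim(1) w t obtain t' where t': "prefix t t'" "w \<in> dec t' (Gs n (\<kappa> t n w))" by blast
      have "w \<in> dec t' (E m)" using elim(4) t'(1) t(2) by blast
      with elim(5) t'(2) have "w \<in> dec t' (Gs n (\<kappa> t n w) \<inter> E m)" by blast
      moreover have "clopen_fun (f n z) w = \<kappa> t n w" using n0[OF n(2)] n(3) by simp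
      ultimately show False using elim(6) n(1) by blast
    qed
  qed
  then show False using P0 AE_iff_null_sets[of P0 M] by simp
qed

end

lemma (in cohen_random_rep) no_cohen_random_rep: False
proof -
  obtain X0 :: "'a set" and h :: "'a \<Rightarrow> nat \<Rightarrow> bool" and low :: "(nat \<Rightarrow> bool) \<Rightarrow> (nat \<Rightarrow> bool) set"
    where X0: "X0 \<subseteq> X" "X0 \<notin> I"
    and h: "\<And>z. {x \<in> X0. h x = z} \<in> I"
      "\<And>x0. x0 \<in> X0 \<Longrightarrow> {x \<in> X0. h x0 \<notin> low (h x)} \<in> I"
      "\<And>z (N :: (nat \<Rightarrow> bool) \<Rightarrow> 'a set). (\<And>y. y \<in> low z \<Longrightarrow> N y \<in> I) \<Longrightarrow> (\<Union>y\<in>low z. N y) \<in> I"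
    using small_unions by blast
  from dense[OF X0] obtain t0 P0 where
    P0: "P0 \<in> sets M - null_sets M" "{x \<in> X. pre t0 (c x) \<and> s x \<in> P0} - X0 \<in> I" by blast
  interpret cohen_random_tower X I c s X0 h low t0 P0
    by unfold_locales (use X0 h P0 in auto)
  show False by (rule tower_contradiction)
qed

section \<open>Regular open algebras of presented forcing notions\<close>

text \<open>One frame for the power set modulo \<open>I\<close> and for the measurable sets modulo
  null sets. Downward closure is restricted to the algebra because a subset of a null set need not
  be measurable.\<close>

locale algebra_with_ideal =
  fixes \<A> N :: "'a set set"
  assumes Diff: "A \<in> \<A> \<Longrightarrow> B \<in> \<A> \<Longrightarrow> A - B \<in> \<A>"
    and Un: "A \<in> \<A> \<Longrightarrow> B \<in> \<A> \<Longrightarrow> A \<union> B \<in> \<A>"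
    and N_empty: "{} \<in> N"
    and N_subset: "A \<in> N \<Longrightarrow> B \<in> \<A> \<Longrightarrow> B \<subseteq> A \<Longrightarrow> B \<in> N"
    and N_Un: "A \<in> N \<Longrightarrow> B \<in> N \<Longrightarrow> A \<union> B \<in> N"
begin

lemma quotient_forcing_iff:
  assumes A: "A \<in> \<A> - N" and B: "B \<in> \<A> - N"
  shows "(mod_ideal \<A> N `` {A}, mod_ideal \<A> N `` {B}) \<in> quotient_forcing \<A> N \<longleftrightarrow> A - B \<in> N"
proof
  assume "(mod_ideal \<A> N `` {A}, mod_ideal \<A> N `` {B}) \<in> quotient_forcing \<A> N"
  then obtain A' B' where
    eqA: "mod_ideal \<A> N `` {A} = mod_ideal \<A> N `` {A'}" and
    eqB: "mod_ideal \<A> N `` {B} = mod_ideal \<A> N `` {B'}" and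
    d: "A' - B' \<in> N"
    unfolding quotient_forcing_def by blast
  have "A \<in> mod_ideal \<A> N `` {A'}" "B \<in> mod_ideal \<A> N `` {B'}"
    using A B N_empty unfolding eqA[symmetric] eqB[symmetric] by (auto simp: mod_ideal_def)
  then have sd: "(A' - A) \<union> (A - A') \<in> N" "(B' - B) \<union> (B - B') \<in> N"
    by (auto simp: mod_ideal_def)
  have "((A' - A) \<union> (A - A')) \<union> ((B' - B) \<union> (B - B')) \<union> (A' - B') \<in> N"
    by (rule N_Un[OF N_Un[OF sd] d])
  then show "A - B \<in> N" by (rule N_subset) (use A B Diff in auto)
next
  assume "A - B \<in> N"
  then show "(mod_ideal \<A> N `` {A}, mod_ideal \<A> N `` {B}) \<in> quotient_forcing \<A> N"
    using A B unfolding quotient_forcing_def by blast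
qed

lemma Field_quotient_forcing: "Field (quotient_forcing \<A> N) = (\<lambda>A. mod_ideal \<A> N `` {A}) ` (\<A> - N)"
proof
  show "(\<lambda>A. mod_ideal \<A> N `` {A}) ` (\<A> - N) \<subseteq> Field (quotient_forcing \<A> N)"
  proof
    fix p assume "p \<in> (\<lambda>A. mod_ideal \<A> N `` {A}) ` (\<A> - N)"
    then obtain A where A: "A \<in> \<A> - N" "p = mod_ideal \<A> N `` {A}" by blast
    then have "(p, p) \<in> quotient_forcing \<A> N"
      using quotient_forcing_iff[OF A(1) A(1)] N_empty by simp
    then show "p \<in> Field (quotient_forcing \<A> N)" by (rule FieldI1)
  qed
qed (auto simp: Field_def quotient_forcing_def)

end

text \<open>The regular open sets for the topology of sets closed under strengthening, written
  through the order alone: a condition belongs to \<open>U\<close> once \<open>U\<close> is dense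
  below it.\<close>

definition regular_open :: "'d set \<Rightarrow> ('d \<Rightarrow> 'd \<Rightarrow> bool) \<Rightarrow> 'd set set" where
  "regular_open D le = {U. U \<subseteq> D \<and> (\<forall>p\<in>D. p \<in> U \<longleftrightarrow> (\<forall>q\<in>D. le q p \<longrightarrow> (\<exists>u\<in>U. le u q)))}"

text \<open>A preorder on representatives presents a forcing notion when \<open>\<pi>\<close> identifies the latter with its quotient.\<close>

definition presents :: "'d set \<Rightarrow> ('d \<Rightarrow> 'd \<Rightarrow> bool) \<Rightarrow> ('d \<Rightarrow> 'p) \<Rightarrow> 'p rel \<Rightarrow> bool" where
  "presents D le \<pi> r \<longleftrightarrow> Field r = \<pi> ` D \<and> (\<forall>a\<in>D. \<forall>b\<in>D. (\<pi> a, \<pi> b) \<in> r \<longleftrightarrow> le a b) \<and>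
     (\<forall>a\<in>D. le a a) \<and> (\<forall>a\<in>D. \<forall>b\<in>D. \<forall>c\<in>D. le a b \<longrightarrow> le b c \<longrightarrow> le a c)"

text \<open>The smallest open set around \<open>p\<close> consists of the conditions stronger than
  \<open>p\<close>. Hence the closure of \<open>U\<close> consists of the conditions with an
  extension in \<open>U\<close>, and the interior asks this of everything below
  \<open>p\<close>.\<close>

lemma interior_closure_forcing_topology:
  assumes refl: "\<And>p. p \<in> Field r \<Longrightarrow> (p, p) \<in> r" and tr: "trans r" and U: "U \<subseteq> Field r"
  shows "forcing_topology r interior_of (forcing_topology r closure_of U) =
    {p \<in> Field r. \<forall>q. (q, p) \<in> r \<longrightarrow> (\<exists>u\<in>U. (u, q) \<in> r)}"
proof -
  let ?T = "forcing_topology r"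
  have cone: "openin ?T {q. (q, p) \<in> r}" for p
    using tr by (auto simp: openin_forcing_topology Field_def trans_def)
  have "openin ?T (Field r)" by (auto simp: openin_forcing_topology Field_def)
  then have "Field r \<subseteq> topspace ?T" by (rule openin_subset)
  moreover have "topspace ?T \<subseteq> Field r"
    using openin_topspace[of ?T] by (simp only: openin_forcing_topology)
  ultimately have top: "topspace ?T = Field r" by blast
  have cl: "?T closure_of U = {p \<in> Field r. \<exists>u\<in>U. (u, p) \<in> r}"
  proof (intro set_eqI iffI)
    fix p assume "p \<in> ?T closure_of U"
    then have p: "p \<in> Field r" and "\<And>S. p \<in> S \<Longrightarrow> openin ?T S \<Longrightarrow> \<exists>y\<in>U. y \<in> S"
      by (auto simp: in_closure_of top)
    from this(2)[OF _ cone[of p]] refl[OF p] show "p \<in> {p \<in> Field r. \<exists>u\<in>U. (u, p) \<in> r}"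
      using p by auto
  next
    fix p assume "p \<in> {p \<in> Field r. \<exists>u\<in>U. (u, p) \<in> r}"
    then show "p \<in> ?T closure_of U"
      by (auto simp: in_closure_of top openin_forcing_topology)
  qed
  show ?thesis
  proof (intro set_eqI iffI)
    fix p assume "p \<in> ?T interior_of (?T closure_of U)"
    then obtain S where "openin ?T S" "p \<in> S" "S \<subseteq> ?T closure_of U"
      by (auto simp: interior_of_def)
    then show "p \<in> {p \<in> Field r. \<forall>q. (q, p) \<in> r \<longrightarrow> (\<exists>u\<in>U. (u, q) \<in> r)}"
      unfolding cl openin_forcing_topology by blast
  next
    fix p assume p: "p \<in> {p \<in> Field r. \<forall>q. (q, p) \<in> r \<longrightarrow> (\<exists>u\<in>U. (u, q) \<in> r)}"
    then have "p \<in> {q. (q, p) \<in> r}" "{q. (q, p) \<in> r} \<subseteq> ?T closure_of U"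
      using refl unfolding cl by (auto simp: Field_def)
    with cone[of p] show "p \<in> ?T interior_of (?T closure_of U)"
      unfolding interior_of_def by blast
  qed
qed

text \<open>Regular open sets cannot separate equivalent representatives (the fact
  \<open>sat\<close>), so taking images under \<open>\<pi>\<close> is an order isomorphism onto the
  completion of the quotient.\<close>

lemma presents_boolean_completion:
  assumes P: "presents D le \<pi> r"
  shows "boolean_completion r = (\<lambda>V. \<pi> ` V) ` regular_open D le"
    and "V \<in> regular_open D le \<Longrightarrow> V' \<in> regular_open D le \<Longrightarrow> \<pi> ` V \<subseteq> \<pi> ` V' \<longleftrightarrow> V \<subseteq> V'"
proof -
  have F: "Field r = \<pi> ` D" and iff: "\<And>a b. a \<in> D \<Longrightarrow> b \<in> D \<Longrightarrow> (\<pi> a, \<pi> b) \<in> r \<longleftrightarrow> le a b"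
    and le_refl: "\<And>a. a \<in> D \<Longrightarrow> le a a"
    and le_trans: "\<And>a b c. a \<in> D \<Longrightarrow> b \<in> D \<Longrightarrow> c \<in> D \<Longrightarrow> le a b \<Longrightarrow> le b c \<Longrightarrow> le a c"
    using P unfolding presents_def by blast+
  have "q \<in> \<pi> ` D" if "(q, p) \<in> r" for q p
    using FieldI1[OF that] F by simp
  then have all_q: "(\<forall>q. (q, p) \<in> r \<longrightarrow> Q q) \<longleftrightarrow> (\<forall>q\<in>D. (\<pi> q, p) \<in> r \<longrightarrow> Q (\<pi> q))" for p Q
    by blast
  have r1: "(p, p) \<in> r" if "p \<in> Field r" for p
    using that F iff le_refl by auto
  have r2: "trans r"
  proof (rule transI)
    fix p q s assume pq: "(p, q) \<in> r" and qs: "(q, s) \<in> r"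
    then have "p \<in> \<pi> ` D" "q \<in> \<pi> ` D" "s \<in> \<pi> ` D" unfolding F[symmetric] by (auto intro: FieldI1 FieldI2)
    then obtain a b c where abc: "a \<in> D" "b \<in> D" "c \<in> D" "p = \<pi> a" "q = \<pi> b" "s = \<pi> c" by blast
    then show "(p, s) \<in> r" using pq qs iff le_trans by metis
  qed
  have bc: "U \<in> boolean_completion r \<longleftrightarrow>
      U \<subseteq> Field r \<and> {p \<in> Field r. \<forall>q. (q, p) \<in> r \<longrightarrow> (\<exists>u\<in>U. (u, q) \<in> r)} = U" for U
    unfolding boolean_completion_def mem_Collect_eq
    by (rule conj_cong[OF refl]) (simp only: interior_closure_forcing_topology[OF r1 r2])
  have sat: "a \<in> V" if V: "V \<in> regular_open D le" and a: "a \<in> D" "\<pi> a \<in> \<pi> ` V" for a V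
  proof -
    from a obtain b where b: "b \<in> V" "\<pi> a = \<pi> b" by blast
    then have bD: "b \<in> D" using V by (auto simp: regular_open_def)
    then have ab: "le a b" using iff[OF a(1) bD] iff[OF bD bD] le_refl b by simp
    have "\<exists>u\<in>V. le u q" if "q \<in> D" "le q a" for q
      using V b bD le_trans[OF that(1) a(1) bD that(2) ab] that(1) unfolding regular_open_def by blast
    then show ?thesis using V a(1) unfolding regular_open_def by blast
  qed
  show "\<pi> ` V \<subseteq> \<pi> ` V' \<longleftrightarrow> V \<subseteq> V'" if "V \<in> regular_open D le" "V' \<in> regular_open D le" for V V'
  proof
    assume sub: "\<pi> ` V \<subseteq> \<pi> ` V'"
    have "V \<subseteq> D" using that by (auto simp: regular_open_def)
    then show "V \<subseteq> V'" using sat[OF that(2)] sub by blast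
  qed blast
  have "\<pi> ` V \<in> boolean_completion r" if V: "V \<in> regular_open D le" for V
  proof -
    have VD: "V \<subseteq> D" using V by (auto simp: regular_open_def)
    have "\<pi> a \<in> \<pi> ` V \<longleftrightarrow> (\<forall>q. (q, \<pi> a) \<in> r \<longrightarrow> (\<exists>u\<in>\<pi> ` V. (u, q) \<in> r))" if a: "a \<in> D" for a
    proof -
      have "\<pi> a \<in> \<pi> ` V \<longleftrightarrow> a \<in> V" using sat[OF V a] by blast
      also have "\<dots> \<longleftrightarrow> (\<forall>q\<in>D. le q a \<longrightarrow> (\<exists>u\<in>V. le u q))"
        using V a unfolding regular_open_def by blast
      also have "\<dots> \<longleftrightarrow> (\<forall>q\<in>D. (\<pi> q, \<pi> a) \<in> r \<longrightarrow> (\<exists>u\<in>V. (\<pi> u, \<pi> q) \<in> r))"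
        using iff a VD by (meson subsetD)
      also have "\<dots> \<longleftrightarrow> (\<forall>q. (q, \<pi> a) \<in> r \<longrightarrow> (\<exists>u\<in>\<pi> ` V. (u, q) \<in> r))"
        by (simp add: all_q)
      finally show ?thesis .
    qed
    then show ?thesis unfolding bc F using VD by auto
  qed
  moreover have "\<exists>V\<in>regular_open D le. U = \<pi> ` V" if "U \<in> boolean_completion r" for U
  proof
    define V where "V = {a \<in> D. \<pi> a \<in> U}"
    from that have U: "U \<subseteq> Field r" and eq: "\<And>p. p \<in> Field r \<Longrightarrow>
        p \<in> U \<longleftrightarrow> (\<forall>q. (q, p) \<in> r \<longrightarrow> (\<exists>u\<in>U. (u, q) \<in> r))"
      unfolding bc by blast+
    show "U = \<pi> ` V" using U F by (auto simp: V_def)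
    have "p \<in> V \<longleftrightarrow> (\<forall>q\<in>D. le q p \<longrightarrow> (\<exists>u\<in>V. le u q))" if p: "p \<in> D" for p
    proof -
      have "p \<in> V \<longleftrightarrow> (\<forall>q. (q, \<pi> p) \<in> r \<longrightarrow> (\<exists>u\<in>U. (u, q) \<in> r))"
        using eq[of "\<pi> p"] p F by (simp add: V_def)
      also have "\<dots> \<longleftrightarrow> (\<forall>q\<in>D. (\<pi> q, \<pi> p) \<in> r \<longrightarrow> (\<exists>u\<in>U. (u, \<pi> q) \<in> r))"
        by (simp add: all_q)
      also have "\<dots> \<longleftrightarrow> (\<forall>q\<in>D. (\<pi> q, \<pi> p) \<in> r \<longrightarrow> (\<exists>u\<in>V. (\<pi> u, \<pi> q) \<in> r))"
        using U unfolding \<open>U = \<pi> ` V\<close> by simp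
      also have "\<dots> \<longleftrightarrow> (\<forall>q\<in>D. le q p \<longrightarrow> (\<exists>u\<in>V. le u q))"
        using iff p by (auto simp: V_def)
      finally show ?thesis .
    qed
    then show "V \<in> regular_open D le" by (auto simp: regular_open_def V_def)
  qed
  ultimately show "boolean_completion r = (\<lambda>V. \<pi> ` V) ` regular_open D le" by blast
qed

lemma forcing_isomorphic_presented:
  assumes iso: "forcing_isomorphic r s" and r: "presents D le \<pi> r" and s: "presents D' le' \<pi>' s"
  shows "\<exists>F. F ` regular_open D le = regular_open D' le' \<and>
    (\<forall>U\<in>regular_open D le. \<forall>V\<in>regular_open D le. F U \<subseteq> F V \<longleftrightarrow> U \<subseteq> V)"
proof -
  obtain f where f: "bij_betw f (boolean_completion r) (boolean_completion s)"
    "\<And>U V. U \<in> boolean_completion r \<Longrightarrow> V \<in> boolean_completion r \<Longrightarrow> f U \<subseteq> f V \<longleftrightarrow> U \<subseteq> V"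
    using iso unfolding forcing_isomorphic_def by blast
  note r1 = presents_boolean_completion[OF r] and s1 = presents_boolean_completion[OF s]
  have "\<forall>U\<in>regular_open D le. \<exists>V. V \<in> regular_open D' le' \<and> \<pi>' ` V = f (\<pi> ` U)"
  proof
    fix U assume "U \<in> regular_open D le"
    then have "f (\<pi> ` U) \<in> boolean_completion s"
      using f(1) r1(1) by (auto simp: bij_betw_def)
    then show "\<exists>V. V \<in> regular_open D' le' \<and> \<pi>' ` V = f (\<pi> ` U)"
      unfolding s1(1) by blast
  qed
  from bchoice[OF this] obtain F where F: "\<And>U. U \<in> regular_open D le \<Longrightarrow> F U \<in> regular_open D' le'"
      "\<And>U. U \<in> regular_open D le \<Longrightarrow> \<pi>' ` F U = f (\<pi> ` U)" by blast
  have "W \<in> F ` regular_open D le" if W: "W \<in> regular_open D' le'" for W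
  proof -
    have "\<pi>' ` W \<in> f ` boolean_completion r"
      using W f(1) s1(1) by (auto simp: bij_betw_def)
    then obtain U where U: "U \<in> regular_open D le" "\<pi>' ` W = f (\<pi> ` U)"
      unfolding r1(1) by blast
    then have "\<pi>' ` W = \<pi>' ` F U" using F by simp
    then have "W = F U" using s1(2)[OF W F(1)[OF U(1)]] s1(2)[OF F(1)[OF U(1)] W] by blast
    then show ?thesis using U by blast
  qed
  moreover have "F U \<subseteq> F V \<longleftrightarrow> U \<subseteq> V" if "U \<in> regular_open D le" "V \<in> regular_open D le" for U V
  proof -
    have "F U \<subseteq> F V \<longleftrightarrow> f (\<pi> ` U) \<subseteq> f (\<pi> ` V)"
      using s1(2)[OF F(1)[OF that(1)] F(1)[OF that(2)]] F(2) that by simp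
    also have "\<dots> \<longleftrightarrow> U \<subseteq> V"
      using f(2) r1 that by simp
    finally show ?thesis .
  qed
  ultimately show ?thesis using F(1) by (intro exI[of _ F]) blast
qed

section \<open>From an isomorphism to a pair of generic reals\<close>

text \<open>Finite sums of the measures stay below the total measure, so the measures are summable
  and at most countably many are nonzero.\<close>

lemma (in finite_measure) countable_AE_disjoint_family:
  assumes P: "\<And>i. i \<in> J \<Longrightarrow> P i \<in> sets M - null_sets M"
    and disj: "\<And>i j. i \<in> J \<Longrightarrow> j \<in> J \<Longrightarrow> i \<noteq> j \<Longrightarrow> P i \<inter> P j \<in> null_sets M"
  shows "countable J"
proof -
  have "(\<lambda>i. measure M (P i)) summable_on J"
  proof (rule nonneg_bdd_above_summable_on)
    show "bdd_above (sum (\<lambda>i. measure M (P i)) ` {F. F \<subseteq> J \<and> finite F})"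
    proof (rule bdd_aboveI2)
      fix F assume F: "F \<in> {F. F \<subseteq> J \<and> finite F}"
      have "pairwise (\<lambda>i j. AE x in M. x \<notin> P i \<or> x \<notin> P j) F"
      proof (rule pairwiseI)
        fix i j assume "i \<in> F" "j \<in> F" "i \<noteq> j"
        then have "P i \<inter> P j \<in> null_sets M" using F disj by blast
        from AE_not_in[OF this] show "AE x in M. x \<notin> P i \<or> x \<notin> P j" by eventually_elim blast
      qed
      then have "measure M (\<Union>i\<in>F. P i) = (\<Sum>i\<in>F. measure M (P i))"
        using F P by (intro measure_UNION_AE) (auto simp: fmeasurable_eq_sets)
      then show "(\<Sum>i\<in>F. measure M (P i)) \<le> measure M (space M)"
        using bounded_measure[of "\<Union>i\<in>F. P i"] by simp
    qed
  qed simp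
  from summable_countable_real[OF this] have "countable {i \<in> J. measure M (P i) \<noteq> 0}" .
  moreover have "measure M (P i) \<noteq> 0" if "i \<in> J" for i
    using P[OF that] by (auto simp: null_sets_def emeasure_eq_measure)
  then have "{i \<in> J. measure M (P i) \<noteq> 0} = J" by blast
  ultimately show ?thesis by simp
qed

section \<open>The product order on representatives and dense embeddings into its completion\<close>

type_synonym cr_pair = "bool list \<times> (nat \<Rightarrow> bool) set"

definition cr_cond :: "cr_pair set" where
  "cr_cond = {p. snd p \<in> sets cantor_measure - null_sets cantor_measure}"

text \<open>Measurable sets stand for their classes, so this is only a preorder.\<close>

definition cr_le :: "cr_pair \<Rightarrow> cr_pair \<Rightarrow> bool" where
  "cr_le p q \<longleftrightarrow> prefix (fst q) (fst p) \<and> snd p - snd q \<in> null_sets cantor_measure"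

lemma null_subset_Un:
  assumes "A \<in> null_sets M" "B \<in> null_sets M" "C \<in> sets M" "C \<subseteq> A \<union> B"
  shows "C \<in> null_sets M"
  using null_sets_subset[OF null_sets.Un[OF assms(1,2)]] assms(3,4) by blast

lemma cr_le_refl: "cr_le p p"
  by (simp add: cr_le_def)

lemma cr_le_trans: "p \<in> cr_cond \<Longrightarrow> r \<in> cr_cond \<Longrightarrow> cr_le p q \<Longrightarrow> cr_le q r \<Longrightarrow> cr_le p r"
  unfolding cr_le_def cr_cond_def
  by (auto intro: prefix_order.trans null_subset_Un[of "snd p - snd q" _ "snd q - snd r"])

text \<open>\<open>\<Theta> A\<close> is to be read as the set of conditions that force the generic
  point into \<open>A\<close>. The assumptions say that \<open>\<Theta>\<close> embeds the power set
  of \<open>X\<close> modulo \<open>I\<close> densely into the completion of the product.\<close>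

locale dense_cr_embedding =
  fixes X :: "'a set" and I :: "'a set set" and \<Theta> :: "'a set \<Rightarrow> cr_pair set"
  assumes I_carrier: "A \<in> I \<Longrightarrow> A \<subseteq> X"
    and I_subset: "A \<in> I \<Longrightarrow> B \<subseteq> A \<Longrightarrow> B \<in> I"
    and I_Union: "countable F \<Longrightarrow> F \<subseteq> I \<Longrightarrow> \<Union>F \<in> I"
    and \<Theta>_regular: "A \<subseteq> X \<Longrightarrow> \<Theta> A \<in> regular_open cr_cond cr_le"
    and \<Theta>_iff: "A \<subseteq> X \<Longrightarrow> B \<subseteq> X \<Longrightarrow> \<Theta> A \<subseteq> \<Theta> B \<longleftrightarrow> A - B \<in> I"
    and \<Theta>_empty: "\<Theta> {} = {}"
    and \<Theta>_dense: "W \<in> regular_open cr_cond cr_le \<Longrightarrow> W \<noteq> {} \<Longrightarrow> \<exists>A. A \<subseteq> X \<and> A \<notin> I \<and> \<Theta> A \<subseteq> W"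
begin

abbreviation "D \<equiv> cr_cond"
abbreviation "M \<equiv> cantor_measure"

lemma I_Un: "A \<in> I \<Longrightarrow> B \<in> I \<Longrightarrow> A \<union> B \<in> I"
  using I_Union[of "{A, B}"] by simp

lemma \<Theta>_subset: "A \<subseteq> X \<Longrightarrow> p \<in> \<Theta> A \<Longrightarrow> p \<in> D"
  using \<Theta>_regular by (auto simp: regular_open_def)

lemma \<Theta>_reg: "A \<subseteq> X \<Longrightarrow> p \<in> D \<Longrightarrow> (\<And>q. q \<in> D \<Longrightarrow> cr_le q p \<Longrightarrow> \<exists>u\<in>\<Theta> A. cr_le u q) \<Longrightarrow> p \<in> \<Theta> A"
  using \<Theta>_regular unfolding regular_open_def by blast

lemma \<Theta>_down: "A \<subseteq> X \<Longrightarrow> p \<in> \<Theta> A \<Longrightarrow> q \<in> D \<Longrightarrow> cr_le q p \<Longrightarrow> q \<in> \<Theta> A"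
proof (rule \<Theta>_reg)
  fix r assume A: "A \<subseteq> X" "p \<in> \<Theta> A" "q \<in> D" "cr_le q p" "r \<in> D" "cr_le r q"
  have p: "p \<in> D" using \<Theta>_subset A by blast
  have "cr_le r p" using cr_le_trans[OF A(5) p A(6,4)] .
  then show "\<exists>u\<in>\<Theta> A. cr_le u r"
    using \<Theta>_regular[OF A(1)] A(2,5) p unfolding regular_open_def by blast
qed

lemma \<Theta>_mono: "A \<subseteq> X \<Longrightarrow> B \<subseteq> X \<Longrightarrow> A - B \<in> I \<Longrightarrow> p \<in> \<Theta> A \<Longrightarrow> p \<in> \<Theta> B"
  using \<Theta>_iff by blast

lemma \<Theta>_nonempty: "A \<subseteq> X \<Longrightarrow> A \<notin> I \<Longrightarrow> \<exists>p. p \<in> \<Theta> A"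
  using \<Theta>_iff[of A "{}"] by auto

lemma regular_closure:
  assumes U: "U \<subseteq> D" "\<And>p q. p \<in> U \<Longrightarrow> q \<in> D \<Longrightarrow> cr_le q p \<Longrightarrow> q \<in> U"
  shows "{p \<in> D. \<forall>q\<in>D. cr_le q p \<longrightarrow> (\<exists>u\<in>U. cr_le u q)} \<in> regular_open D cr_le" (is "?R \<in> _")
proof -
  have UR: "U \<subseteq> ?R" using U cr_le_refl by blast
  have "p \<in> ?R" if p: "p \<in> D" "\<forall>q\<in>D. cr_le q p \<longrightarrow> (\<exists>u\<in>?R. cr_le u q)" for p
  proof -
    have "\<exists>u\<in>U. cr_le u q" if q: "q \<in> D" "cr_le q p" for q
    proof -
      from p q obtain v where v: "v \<in> ?R" "cr_le v q" by blast
      then obtain u where "u \<in> U" "cr_le u v" using cr_le_refl by blast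
      then show ?thesis using cr_le_trans[of u q v] v q U(1) by blast
    qed
    then show ?thesis using p by blast
  qed
  moreover have "\<forall>q\<in>D. cr_le q p \<longrightarrow> (\<exists>u\<in>?R. cr_le u q)" if "p \<in> ?R" for p
    using that UR by blast
  ultimately show ?thesis unfolding regular_open_def by blast
qed

text \<open>The set \<open>C\<close> acts as a condition of the quotient by \<open>I\<close> below
  \<open>q\<close>: it comes from density inside the regular open set generated by \<open>q\<close>.
  Order arguments about \<open>\<Theta>\<close> can thus be carried out with sets modulo
  \<open>I\<close>.\<close>

lemma below:
  assumes q: "q \<in> D"
  obtains C where "C \<subseteq> X" "C \<notin> I" "\<And>A. A \<subseteq> X \<Longrightarrow> q \<in> \<Theta> A \<Longrightarrow> C - A \<in> I"
    "\<And>r. r \<in> \<Theta> C \<Longrightarrow> \<exists>u\<in>D. cr_le u r \<and> cr_le u q"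
proof -
  let ?U = "{u \<in> D. cr_le u q}"
  let ?R = "{p \<in> D. \<forall>q\<in>D. cr_le q p \<longrightarrow> (\<exists>u\<in>?U. cr_le u q)}"
  have "?R \<in> regular_open D cr_le"
    using q by (intro regular_closure) (auto intro: cr_le_trans)
  moreover have "q \<in> ?R" using q cr_le_refl by blast
  ultimately obtain C where C: "C \<subseteq> X" "C \<notin> I" "\<Theta> C \<subseteq> ?R"
    using \<Theta>_dense[of ?R] by blast
  show ?thesis
  proof
    show "C \<subseteq> X" "C \<notin> I" by fact+
    show "\<exists>u\<in>D. cr_le u r \<and> cr_le u q" if "r \<in> \<Theta> C" for r
      using that C(3) cr_le_refl by blast
    show "C - A \<in> I" if A: "A \<subseteq> X" "q \<in> \<Theta> A" for A
    proof -
      have "\<Theta> C \<subseteq> \<Theta> A"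
      proof
        fix r assume r: "r \<in> \<Theta> C"
        show "r \<in> \<Theta> A"
        proof (rule \<Theta>_reg[OF A(1)])
          show "r \<in> D" using r C \<Theta>_subset by blast
          fix r' assume "r' \<in> D" "cr_le r' r"
          then obtain u where "u \<in> D" "cr_le u q" "cr_le u r'" using r C(3) by blast
          then show "\<exists>u\<in>\<Theta> A. cr_le u r'" using \<Theta>_down[OF A] by blast
        qed
      qed
      then show ?thesis using \<Theta>_iff[OF C(1) A(1)] by simp
    qed
  qed
qed

text \<open>The forcing clause for conjunction. A set \<open>C\<close> below \<open>q\<close> is
  almost contained in both sets, hence in their intersection, and it supplies the required extension
  of \<open>q\<close>.\<close>

lemma \<Theta>_Int:
  assumes "A \<subseteq> X" "B \<subseteq> X"
  shows "p \<in> \<Theta> (A \<inter> B) \<longleftrightarrow> p \<in> \<Theta> A \<and> p \<in> \<Theta> B"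
proof
  have AB: "A \<inter> B \<subseteq> X" using assms by blast
  have e: "A \<inter> B - A = {}" "A \<inter> B - B = {}" by auto
  have eI: "{} \<in> I" using I_Union[of "{}"] by simp
  { assume "p \<in> \<Theta> (A \<inter> B)"
    then show "p \<in> \<Theta> A \<and> p \<in> \<Theta> B"
      using \<Theta>_mono[OF AB assms(1)] \<Theta>_mono[OF AB assms(2)] by (simp only: e eI) }
  assume p: "p \<in> \<Theta> A \<and> p \<in> \<Theta> B"
  show "p \<in> \<Theta> (A \<inter> B)"
  proof (rule \<Theta>_reg[OF AB])
    show "p \<in> D" using p assms \<Theta>_subset by blast
    fix q assume q: "q \<in> D" "cr_le q p"
    obtain C where C: "C \<subseteq> X" "C \<notin> I" "\<And>A. A \<subseteq> X \<Longrightarrow> q \<in> \<Theta> A \<Longrightarrow> C - A \<in> I"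
      "\<And>r. r \<in> \<Theta> C \<Longrightarrow> \<exists>u\<in>D. cr_le u r \<and> cr_le u q"
      using below[OF q(1)] by metis
    have "C - A \<in> I" "C - B \<in> I" using C(3) assms p q \<Theta>_down by blast+
    then have CAB: "C - A \<inter> B \<in> I" by (metis Diff_Int I_Un)
    obtain r where r: "r \<in> \<Theta> C" using \<Theta>_nonempty[OF C(1,2)] by blast
    then obtain u where u: "u \<in> D" "cr_le u r" "cr_le u q" using C(4) by blast
    then have "u \<in> \<Theta> C" using \<Theta>_down[OF C(1) r] by blast
    then have "u \<in> \<Theta> (A \<inter> B)" by (rule \<Theta>_mono[OF C(1) AB CAB])
    then show "\<exists>u\<in>\<Theta> (A \<inter> B). cr_le u q" using u by blast
  qed
qed

text \<open>The forcing clause for negation. If nothing below \<open>p\<close> forces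
  \<open>A\<close>, the set \<open>C\<close> below any extension of \<open>p\<close> is almost
  disjoint from \<open>A\<close>.\<close>

lemma \<Theta>_Compl:
  assumes A: "A \<subseteq> X" and p: "p \<in> D"
  shows "p \<in> \<Theta> (X - A) \<longleftrightarrow> (\<forall>q\<in>D. cr_le q p \<longrightarrow> q \<notin> \<Theta> A)"
proof
  assume pc: "p \<in> \<Theta> (X - A)"
  show "\<forall>q\<in>D. cr_le q p \<longrightarrow> q \<notin> \<Theta> A"
  proof (intro ballI impI notI)
    fix q assume q: "q \<in> D" "cr_le q p" "q \<in> \<Theta> A"
    have "q \<in> \<Theta> (X - A)" using \<Theta>_down[OF _ pc q(1,2)] by blast
    then have "q \<in> \<Theta> ((X - A) \<inter> A)" using \<Theta>_Int[of "X - A" A q] A q by blast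
    moreover have "(X - A) \<inter> A = {}" by blast
    ultimately show False using \<Theta>_empty by simp
  qed
next
  assume h: "\<forall>q\<in>D. cr_le q p \<longrightarrow> q \<notin> \<Theta> A"
  show "p \<in> \<Theta> (X - A)"
  proof (rule \<Theta>_reg[OF Diff_subset p])
    fix q assume q: "q \<in> D" "cr_le q p"
    obtain C where C: "C \<subseteq> X" "C \<notin> I" "\<And>A. A \<subseteq> X \<Longrightarrow> q \<in> \<Theta> A \<Longrightarrow> C - A \<in> I"
      "\<And>r. r \<in> \<Theta> C \<Longrightarrow> \<exists>u\<in>D. cr_le u r \<and> cr_le u q"
      using below[OF q(1)] by metis
    have CA: "C \<inter> A \<in> I"
    proof (rule ccontr)
      assume "C \<inter> A \<notin> I"
      then obtain r where "r \<in> \<Theta> (C \<inter> A)" using \<Theta>_nonempty[of "C \<inter> A"] A by blast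
      then have r: "r \<in> \<Theta> C" "r \<in> \<Theta> A" using \<Theta>_Int[OF C(1) A] by blast+
      from C(4)[OF r(1)] obtain u where u: "u \<in> D" "cr_le u r" "cr_le u q" by blast
      then have "u \<in> \<Theta> A" using \<Theta>_down[OF A r(2)] by blast
      moreover have "cr_le u p" using cr_le_trans[OF u(1) p u(3) q(2)] .
      ultimately show False using h u by blast
    qed
    have "C - (X - A) \<in> I" by (rule I_subset[OF CA]) (use C in blast)
    then have sub: "r \<in> \<Theta> C \<Longrightarrow> r \<in> \<Theta> (X - A)" for r
      using \<Theta>_mono[OF C(1) Diff_subset] by blast
    obtain r where r: "r \<in> \<Theta> C" using \<Theta>_nonempty[OF C(1,2)] by blast
    then obtain u where u: "u \<in> D" "cr_le u r" "cr_le u q" using C(4) by blast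
    then have "u \<in> \<Theta> (X - A)" using sub \<Theta>_down[OF C(1) r] by blast
    then show "\<exists>u\<in>\<Theta> (X - A). cr_le u q" using u by blast
  qed
qed

text \<open>The forcing clause for countable disjunction; countable completeness of \<open>I\<close>
  makes \<open>C\<close> meet one of the sets positively.\<close>

lemma \<Theta>_UN:
  assumes A: "\<And>j. j \<in> J \<Longrightarrow> A j \<subseteq> X" and J: "countable J" and p: "p \<in> D"
  shows "p \<in> \<Theta> (\<Union>j\<in>J. A j) \<longleftrightarrow> (\<forall>q\<in>D. cr_le q p \<longrightarrow> (\<exists>u\<in>D. cr_le u q \<and> (\<exists>j\<in>J. u \<in> \<Theta> (A j))))"
proof
  have AX: "(\<Union>j\<in>J. A j) \<subseteq> X" using A by blast
  { assume pu: "p \<in> \<Theta> (\<Union>j\<in>J. A j)"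
    show "\<forall>q\<in>D. cr_le q p \<longrightarrow> (\<exists>u\<in>D. cr_le u q \<and> (\<exists>j\<in>J. u \<in> \<Theta> (A j)))"
    proof (intro ballI impI)
      fix q assume q: "q \<in> D" "cr_le q p"
      obtain C where C: "C \<subseteq> X" "C \<notin> I" "\<And>A. A \<subseteq> X \<Longrightarrow> q \<in> \<Theta> A \<Longrightarrow> C - A \<in> I"
        "\<And>r. r \<in> \<Theta> C \<Longrightarrow> \<exists>u\<in>D. cr_le u r \<and> cr_le u q"
        using below[OF q(1)] by metis
      have CU: "C - (\<Union>j\<in>J. A j) \<in> I" using C(3)[OF AX] \<Theta>_down[OF AX pu q] by blast
      have "\<exists>j\<in>J. C \<inter> A j \<notin> I"
      proof (rule ccontr)
        assume "\<not> ?thesis"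
        then have "(\<Union>j\<in>J. C \<inter> A j) \<in> I" using J by (intro I_Union) auto
        from I_Un[OF this CU] have "C \<in> I" by (rule I_subset) blast
        then show False using C(2) by blast
      qed
      then obtain j where j: "j \<in> J" "C \<inter> A j \<notin> I" by blast
      then obtain r where "r \<in> \<Theta> (C \<inter> A j)" using \<Theta>_nonempty[of "C \<inter> A j"] C by blast
      then have r: "r \<in> \<Theta> C" "r \<in> \<Theta> (A j)" using \<Theta>_Int[OF C(1) A[OF j(1)]] by blast+
      from C(4)[OF r(1)] obtain u where u: "u \<in> D" "cr_le u r" "cr_le u q" by blast
      then have "u \<in> \<Theta> (A j)" using \<Theta>_down[OF A[OF j(1)] r(2)] by blast
      then show "\<exists>u\<in>D. cr_le u q \<and> (\<exists>j\<in>J. u \<in> \<Theta> (A j))" using u j by blast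
    qed }
  assume h: "\<forall>q\<in>D. cr_le q p \<longrightarrow> (\<exists>u\<in>D. cr_le u q \<and> (\<exists>j\<in>J. u \<in> \<Theta> (A j)))"
  show "p \<in> \<Theta> (\<Union>j\<in>J. A j)"
  proof (rule \<Theta>_reg[OF AX p])
    fix q assume "q \<in> D" "cr_le q p"
    with h obtain u j where u: "u \<in> D" "cr_le u q" "j \<in> J" "u \<in> \<Theta> (A j)" by blast
    have "A j - (\<Union>j\<in>J. A j) = {}" using u by blast
    moreover have "{} \<in> I" using I_Union[of "{}"] by simp
    ultimately have "A j - (\<Union>j\<in>J. A j) \<in> I" by (simp only:)
    then have "u \<in> \<Theta> (\<Union>j\<in>J. A j)" using \<Theta>_mono[OF A[OF u(3)] AX] u(4) by blast
    then show "\<exists>u\<in>\<Theta> (\<Union>j\<in>J. A j). cr_le u q" using u by blast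
  qed
qed

text \<open>Choose a condition in each \<open>\<Theta> A\<close>. For a fixed Cohen part the random
  parts are almost disjoint, hence countably many, and there are countably many Cohen parts.\<close>

lemma ccc:
  assumes \<A>: "\<And>A. A \<in> \<A> \<Longrightarrow> A \<subseteq> X \<and> A \<notin> I"
    and disj: "\<And>A B. A \<in> \<A> \<Longrightarrow> B \<in> \<A> \<Longrightarrow> A \<noteq> B \<Longrightarrow> A \<inter> B \<in> I"
  shows "countable \<A>"
proof -
  have "\<forall>A\<in>\<A>. \<exists>p. p \<in> \<Theta> A" using \<A> \<Theta>_nonempty by blast
  from bchoice[OF this] obtain p where p: "\<And>A. A \<in> \<A> \<Longrightarrow> p A \<in> \<Theta> A" by blast
  have pD: "p A \<in> D" if "A \<in> \<A>" for A using p \<A> \<Theta>_subset that by blast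
  have "countable {A \<in> \<A>. fst (p A) = t}" for t
  proof (rule cantor.countable_AE_disjoint_family[where P = "\<lambda>A. snd (p A)"])
    show "snd (p A) \<in> sets M - null_sets M" if "A \<in> {A \<in> \<A>. fst (p A) = t}" for A
      using pD[of A] that by (simp add: cr_cond_def)
    fix A B assume AB: "A \<in> {A \<in> \<A>. fst (p A) = t}" "B \<in> {A \<in> \<A>. fst (p A) = t}" "A \<noteq> B"
    show "snd (p A) \<inter> snd (p B) \<in> null_sets M"
    proof (rule ccontr)
      assume "snd (p A) \<inter> snd (p B) \<notin> null_sets M"
      then have uD: "(t, snd (p A) \<inter> snd (p B)) \<in> D"
        using pD[of A] pD[of B] AB by (auto simp: cr_cond_def)
      have e: "Q \<inter> R - Q = {}" "Q \<inter> R - R = {}" for Q R :: "(nat \<Rightarrow> bool) set" by auto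
      have "cr_le (t, snd (p A) \<inter> snd (p B)) (p A)" "cr_le (t, snd (p A) \<inter> snd (p B)) (p B)"
        using AB by (simp_all add: cr_le_def e)
      then have "(t, snd (p A) \<inter> snd (p B)) \<in> \<Theta> A" "(t, snd (p A) \<inter> snd (p B)) \<in> \<Theta> B"
        using \<Theta>_down uD p \<A> AB by blast+
      then have "(t, snd (p A) \<inter> snd (p B)) \<in> \<Theta> (A \<inter> B)" using \<Theta>_Int \<A> AB by blast
      moreover have "\<Theta> (A \<inter> B) \<subseteq> \<Theta> {}" using \<Theta>_iff[of "A \<inter> B" "{}"] disj \<A> AB by auto
      ultimately show False using \<Theta>_empty by blast
    qed
  qed
  then have "countable (\<Union>t. {A \<in> \<A>. fst (p A) = t})" by (intro countable_UN) auto
  moreover have "(\<Union>t. {A \<in> \<A>. fst (p A) = t}) = \<A>" by blast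
  ultimately show ?thesis by simp
qed

text \<open>Since the product has the countable chain condition, the quotient by \<open>I\<close> is already complete.\<close>

lemma complete:
  assumes U: "U \<subseteq> D" "\<And>p q. p \<in> U \<Longrightarrow> q \<in> D \<Longrightarrow> cr_le q p \<Longrightarrow> q \<in> U"
  shows "\<exists>A\<subseteq>X. \<forall>p\<in>D. p \<in> \<Theta> A \<longleftrightarrow> (\<forall>q\<in>D. cr_le q p \<longrightarrow> (\<exists>u\<in>U. cr_le u q))"
proof -
  define R where "R = {p \<in> D. \<forall>q\<in>D. cr_le q p \<longrightarrow> (\<exists>u\<in>U. cr_le u q)}"
  \<comment> \<open>Almost disjoint families of positive sets inside the target \<open>R\<close>. A
    maximal one exists by Zorn's lemma, is countable by \<open>ccc\<close>, and its union is the
    wanted set.\<close>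
  define \<F> where "\<F> = {\<A>. (\<forall>A\<in>\<A>. A \<subseteq> X \<and> A \<notin> I \<and> \<Theta> A \<subseteq> R) \<and> (\<forall>A\<in>\<A>. \<forall>B\<in>\<A>. A \<noteq> B \<longrightarrow> A \<inter> B \<in> I)}"
  have "\<exists>\<A>\<in>\<F>. \<forall>\<B>\<in>\<F>. \<A> \<subseteq> \<B> \<longrightarrow> \<B> = \<A>"
  proof (rule subset_Zorn')
    fix C assume C: "subset.chain \<F> C"
    show "\<Union>C \<in> \<F>"
      unfolding \<F>_def
    proof (intro CollectI conjI ballI impI)
      fix A assume "A \<in> \<Union>C"
      then show "A \<subseteq> X" "A \<notin> I" "\<Theta> A \<subseteq> R"
        using C by (auto simp: subset_chain_def \<F>_def)
    next
      fix A B assume "A \<in> \<Union>C" "B \<in> \<Union>C" and ne: "A \<noteq> B"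
      then obtain S T where ST: "S \<in> C" "T \<in> C" "A \<in> S" "B \<in> T" by blast
      then have "S \<subseteq> T \<or> T \<subseteq> S" using C by (auto simp: subset_chain_def)
      then obtain S' where "S' \<in> C" "A \<in> S'" "B \<in> S'" using ST by blast
      moreover from this have "S' \<in> \<F>" using C by (auto simp: subset_chain_def)
      ultimately show "A \<inter> B \<in> I" using ne by (auto simp: \<F>_def)
    qed
  qed
  then obtain \<A> where \<A>: "\<A> \<in> \<F>" and max: "\<And>\<B>. \<B> \<in> \<F> \<Longrightarrow> \<A> \<subseteq> \<B> \<Longrightarrow> \<B> = \<A>" by blast
  have \<A>1: "A \<subseteq> X" "A \<notin> I" "\<Theta> A \<subseteq> R" if "A \<in> \<A>" for A using \<A> that by (auto simp: \<F>_def)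
  have \<A>2: "A \<inter> B \<in> I" if "A \<in> \<A>" "B \<in> \<A>" "A \<noteq> B" for A B using \<A> that by (auto simp: \<F>_def)
  have cnt: "countable \<A>" by (rule ccc) (use \<A>1 \<A>2 in auto)
  have sub: "(\<Union>A\<in>\<A>. A) \<subseteq> X" using \<A>1 by blast
  have "p \<in> \<Theta> (\<Union>A\<in>\<A>. A) \<longleftrightarrow> p \<in> R" if p: "p \<in> D" for p
  proof
    assume pA: "p \<in> \<Theta> (\<Union>A\<in>\<A>. A)"
    have "\<exists>u\<in>U. cr_le u q" if q: "q \<in> D" "cr_le q p" for q
    proof -
      from pA \<Theta>_UN[where A = "\<lambda>A. A", OF \<A>1(1) cnt p] q obtain v A where v: "v \<in> D" "cr_le v q" "A \<in> \<A>" "v \<in> \<Theta> A" by blast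
      then have "v \<in> R" using \<A>1 by blast
      then obtain u where "u \<in> U" "cr_le u v" using cr_le_refl[of v] unfolding R_def by blast
      then show ?thesis using cr_le_trans[of u q v] v q U(1) by blast
    qed
    then show "p \<in> R" using p by (simp add: R_def)
  next
    assume pR: "p \<in> R"
    show "p \<in> \<Theta> (\<Union>A\<in>\<A>. A)"
    proof (rule \<Theta>_reg[OF sub p], rule ccontr)
      fix q assume q: "q \<in> D" "cr_le q p" and no: "\<not> (\<exists>u\<in>\<Theta> (\<Union>A\<in>\<A>. A). cr_le u q)"
      then have "q \<in> \<Theta> (X - (\<Union>A\<in>\<A>. A))" using \<Theta>_Compl[OF sub q(1)] by blast
      moreover obtain C where C: "C \<subseteq> X" "C \<notin> I" "\<And>A. A \<subseteq> X \<Longrightarrow> q \<in> \<Theta> A \<Longrightarrow> C - A \<in> I"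
        "\<And>r. r \<in> \<Theta> C \<Longrightarrow> \<exists>u\<in>D. cr_le u r \<and> cr_le u q"
        using below[OF q(1)] by metis
      ultimately have "C - (X - (\<Union>A\<in>\<A>. A)) \<in> I" by blast
      then have CA: "C \<inter> (\<Union>A\<in>\<A>. A) \<in> I" by (rule I_subset) blast
      \<comment> \<open>The positive set \<open>C\<close> below \<open>q\<close> is almost disjoint
        from the union; once it is seen to lie inside \<open>R\<close>, it contradicts the
        maximality of \<open>\<A>\<close>.\<close>
      have "\<Theta> C \<subseteq> R"
      proof
        fix r assume r: "r \<in> \<Theta> C"
        have "\<exists>u\<in>U. cr_le u r'" if r': "r' \<in> D" "cr_le r' r" for r'
        proof -
          have "r' \<in> \<Theta> C" using \<Theta>_down[OF C(1) r r'] .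
          then obtain v where v: "v \<in> D" "cr_le v r'" "cr_le v q" using C(4) by blast
          then have "cr_le v p" using cr_le_trans[OF v(1) p v(3) q(2)] by blast
          then obtain u where "u \<in> U" "cr_le u v" using pR v unfolding R_def by blast
          then show ?thesis using cr_le_trans[of u r' v] v r' U(1) by blast
        qed
        then show "r \<in> R" using \<Theta>_subset[OF C(1) r] by (simp add: R_def)
      qed
      moreover have "C \<inter> A \<in> I" "A \<inter> C \<in> I" if "A \<in> \<A>" for A
        using that by (auto intro!: I_subset[OF CA])
      ultimately have "insert C \<A> \<in> \<F>"
        using C \<A>1 \<A>2 by (auto simp: \<F>_def)
      from max[OF this] have "C \<in> \<A>" by blast
      then have "C \<in> I" by (intro I_subset[OF CA]) blast
      then show False using C by blast
    qed
  qed
  then show ?thesis using sub by (intro exI[of _ "\<Union>A\<in>\<A>. A"]) (auto simp: R_def)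
qed

end

section \<open>Names for the Cohen and the random real\<close>

context dense_cr_embedding
begin

text \<open>\<open>sep\<close> says that \<open>U\<close> is already regular, so
  \<open>complete\<close> represents \<open>U\<close> itself.\<close>

lemma bit_name:
  assumes U: "U \<subseteq> D" "\<And>p q. p \<in> U \<Longrightarrow> q \<in> D \<Longrightarrow> cr_le q p \<Longrightarrow> q \<in> U"
    and sep: "\<And>p. p \<in> D \<Longrightarrow> p \<notin> U \<Longrightarrow> \<exists>q\<in>D. cr_le q p \<and> (\<forall>u\<in>U. \<not> cr_le u q)"
  shows "\<exists>A\<subseteq>X. \<forall>p\<in>D. p \<in> \<Theta> A \<longleftrightarrow> p \<in> U"
proof -
  have "(\<forall>q\<in>D. cr_le q p \<longrightarrow> (\<exists>u\<in>U. cr_le u q)) \<longleftrightarrow> p \<in> U" if "p \<in> D" for p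
    using U(2) sep[OF that] cr_le_refl by blast
  then show ?thesis using complete[OF U] by auto
qed

lemma cohen_bit: "\<exists>A\<subseteq>X. \<forall>p\<in>D. p \<in> \<Theta> A \<longleftrightarrow> n < length (fst p) \<and> fst p ! n"
proof -
  let ?U = "{p \<in> D. n < length (fst p) \<and> fst p ! n}"
  have "\<exists>A\<subseteq>X. \<forall>p\<in>D. p \<in> \<Theta> A \<longleftrightarrow> p \<in> ?U"
  proof (rule bit_name)
    show "q \<in> ?U" if "p \<in> ?U" "q \<in> D" "cr_le q p" for p q
      using that by (auto simp: cr_le_def prefix_def nth_append)
    fix p assume p: "p \<in> D" "p \<notin> ?U"
    \<comment> \<open>If bit \<open>n\<close> is not yet present, pad with \<open>False\<close> up
      to and including position \<open>n\<close>; if it is present, it is already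
      \<open>False\<close>.\<close>
    define q where "q = (fst p @ replicate (Suc n - length (fst p)) False, snd p)"
    have "q \<in> D" "cr_le q p" using p by (auto simp: q_def cr_cond_def cr_le_def)
    moreover have "n < length (fst q)" "\<not> fst q ! n" using p by (auto simp: q_def nth_append)
    then have "\<forall>u\<in>?U. \<not> cr_le u q" by (auto simp: cr_le_def prefix_def nth_append)
    ultimately show "\<exists>q\<in>D. cr_le q p \<and> (\<forall>u\<in>?U. \<not> cr_le u q)" by blast
  qed auto
  then show ?thesis by auto
qed

lemma random_bit: "\<exists>A\<subseteq>X. \<forall>p\<in>D. p \<in> \<Theta> A \<longleftrightarrow> snd p - {w. w n} \<in> null_sets M"
proof -
  have Q [measurable]: "{w. w n} \<in> sets M"
    using measurable_sets[OF measurable_cantor_bit[of n], of "{True}"] by (simp add: vimage_def)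
  let ?U = "{p \<in> D. snd p - {w. w n} \<in> null_sets M}"
  have "\<exists>A\<subseteq>X. \<forall>p\<in>D. p \<in> \<Theta> A \<longleftrightarrow> p \<in> ?U"
  proof (rule bit_name)
    show "q \<in> ?U" if "p \<in> ?U" "q \<in> D" "cr_le q p" for p q
      using that Q
      by (auto simp: cr_le_def cr_cond_def intro: null_subset_Un[of "snd q - snd p" _ "snd p - {w. w n}"])
    fix p assume p: "p \<in> D" "p \<notin> ?U"
    define q where "q = (fst p, snd p - {w. w n})"
    have "q \<in> D" using p Q by (auto simp: q_def cr_cond_def)
    moreover have "cr_le q p"
    proof -
      have e: "snd p - {w. w n} - snd p = {}" by blast
      show ?thesis unfolding cr_le_def q_def fst_conv snd_conv e by simp
    qed
    moreover have "\<not> cr_le u q" if "u \<in> ?U" for u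
    proof
      assume "cr_le u q"
      then have "snd u - (snd p - {w. w n}) \<in> null_sets M" by (simp add: cr_le_def q_def)
      then have "snd u \<in> null_sets M"
        using that by (auto simp: cr_cond_def
            intro!: null_subset_Un[of "snd u - (snd p - {w. w n})" _ "snd u - {w. w n}"])
      then show False using that by (simp add: cr_cond_def)
    qed
    ultimately show "\<exists>q\<in>D. cr_le q p \<and> (\<forall>u\<in>?U. \<not> cr_le u q)" by blast
  qed auto
  then show ?thesis by auto
qed

text \<open>The bits of \<open>c\<close> and \<open>s\<close> at \<open>x\<close> are memberships in
  the sets just obtained. Computing \<open>\<Theta>\<close> on the basic events turns the embedding
  into a \<open>cohen_random_rep\<close>.\<close>

lemma no_embedding: False
proof -
  obtain Ac where Ac: "\<And>n. Ac n \<subseteq> X" "\<And>n p. p \<in> D \<Longrightarrow> p \<in> \<Theta> (Ac n) \<longleftrightarrow> n < length (fst p) \<and> fst p ! n"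
    using cohen_bit by metis
  obtain As where As: "\<And>n. As n \<subseteq> X" "\<And>n p. p \<in> D \<Longrightarrow> p \<in> \<Theta> (As n) \<longleftrightarrow> snd p - {w. w n} \<in> null_sets M"
    using random_bit by metis
  define c where "c x n = (x \<in> Ac n)" for x n
  define s where "s x n = (x \<in> As n)" for x n
  have top: "p \<in> \<Theta> X" if "p \<in> D" for p
    using \<Theta>_Compl[of "{}" p] that \<Theta>_empty by simp
  have cbit: "p \<in> \<Theta> {x \<in> X. c x n = b} \<longleftrightarrow> n < length (fst p) \<and> fst p ! n = b" if p: "p \<in> D" for p n b
  proof (cases b)
    case True
    then have "{x \<in> X. c x n = b} = Ac n" using Ac(1) by (auto simp: c_def)
    then show ?thesis using Ac(2)[OF p] True by simp
  next
    case False
    then have "{x \<in> X. c x n = b} = X - Ac n" by (auto simp: c_def)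
    moreover have "(\<forall>q\<in>D. cr_le q p \<longrightarrow> q \<notin> \<Theta> (Ac n)) \<longleftrightarrow> n < length (fst p) \<and> \<not> fst p ! n"
    proof
      assume h: "\<forall>q\<in>D. cr_le q p \<longrightarrow> q \<notin> \<Theta> (Ac n)"
      define q where "q = (fst p @ replicate (Suc n - length (fst p)) True, snd p)"
      have q: "q \<in> D" "cr_le q p" using p by (auto simp: q_def cr_cond_def cr_le_def)
      then have "\<not> (n < length (fst q) \<and> fst q ! n)" using h Ac(2) by blast
      then show "n < length (fst p) \<and> \<not> fst p ! n"
        by (auto simp: q_def nth_append split: if_splits)
    next
      assume "n < length (fst p) \<and> \<not> fst p ! n"
      then show "\<forall>q\<in>D. cr_le q p \<longrightarrow> q \<notin> \<Theta> (Ac n)"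
        using Ac(2) by (auto simp: cr_le_def prefix_def nth_append)
    qed
    ultimately show ?thesis using \<Theta>_Compl[OF Ac(1) p] False by simp
  qed
  have cohen: "p \<in> \<Theta> {x \<in> X. pre t (c x)} \<longleftrightarrow> prefix t (fst p)" if p: "p \<in> D" for p t
  proof (induction t rule: rev_induct)
    case Nil
    then show ?case using top[OF p] by (simp add: pre_iff)
  next
    case (snoc b t)
    have "{x \<in> X. pre (t @ [b]) (c x)} = {x \<in> X. pre t (c x)} \<inter> {x \<in> X. c x (length t) = b}"
      by (auto simp: pre_iff nth_append less_Suc_eq)
    then have "p \<in> \<Theta> {x \<in> X. pre (t @ [b]) (c x)} \<longleftrightarrow>
        prefix t (fst p) \<and> length t < length (fst p) \<and> fst p ! length t = b"
      using \<Theta>_Int[of "{x \<in> X. pre t (c x)}" "{x \<in> X. c x (length t) = b}" p] snoc cbit[OF p] by auto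
    also have "\<dots> \<longleftrightarrow> prefix (t @ [b]) (fst p)"
    proof
      assume h: "prefix t (fst p) \<and> length t < length (fst p) \<and> fst p ! length t = b"
      then obtain v where v: "fst p = t @ v" by (auto simp: prefix_def)
      with h obtain v' where "v = b # v'" by (cases v) auto
      with v show "prefix (t @ [b]) (fst p)" by simp
    qed (auto simp: prefix_def)
    finally show ?case .
  qed
  \<comment> \<open>Extends the computation from single bits to all measurable \<open>Q\<close> by
    induction over the sigma-algebra, with \<open>\<Theta>_Compl\<close> and
    \<open>\<Theta>_UN\<close> as closure steps.\<close>
  have random: "\<forall>p\<in>D. p \<in> \<Theta> {x \<in> X. s x \<in> Q} \<longleftrightarrow> snd p - Q \<in> null_sets M" if "Q \<in> sets M" for Q
  proof -
    let ?Z = "\<lambda>Q. \<forall>p\<in>D. p \<in> \<Theta> {x \<in> X. s x \<in> Q} \<longleftrightarrow> snd p - Q \<in> null_sets M"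
    have compl: "?Z (- Q)" if Q: "Q \<in> sets M" "?Z Q" for Q
    proof
      fix p assume p: "p \<in> D"
      have sp: "snd p \<in> sets M" using p by (simp add: cr_cond_def)
      have "{x \<in> X. s x \<in> - Q} = X - {x \<in> X. s x \<in> Q}" by auto
      then have "p \<in> \<Theta> {x \<in> X. s x \<in> - Q} \<longleftrightarrow> (\<forall>q\<in>D. cr_le q p \<longrightarrow> snd q - Q \<notin> null_sets M)"
        using \<Theta>_Compl[of "{x \<in> X. s x \<in> Q}" p] p Q(2) by auto
      also have "\<dots> \<longleftrightarrow> snd p - (- Q) \<in> null_sets M"
      proof
        assume h: "\<forall>q\<in>D. cr_le q p \<longrightarrow> snd q - Q \<notin> null_sets M"
        show "snd p - (- Q) \<in> null_sets M"
        proof (rule ccontr)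
          assume n: "snd p - (- Q) \<notin> null_sets M"
          have e: "snd p \<inter> Q - snd p = {}" "snd p \<inter> Q - Q = {}" "snd p - (- Q) = snd p \<inter> Q" by auto
          have "(fst p, snd p \<inter> Q) \<in> D" using n sp Q(1) by (auto simp: cr_cond_def e)
          moreover have "cr_le (fst p, snd p \<inter> Q) p" by (simp add: cr_le_def e)
          ultimately have "snd p \<inter> Q - Q \<notin> null_sets M" using h by (metis snd_conv)
          then show False by (simp add: e)
        qed
      next
        assume n: "snd p - (- Q) \<in> null_sets M"
        show "\<forall>q\<in>D. cr_le q p \<longrightarrow> snd q - Q \<notin> null_sets M"
        proof (intro ballI impI notI)
          fix q assume q: "q \<in> D" "cr_le q p" "snd q - Q \<in> null_sets M"
          have "snd q - snd p \<union> (snd p - (- Q)) \<in> null_sets M"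
            using q n by (intro null_sets.Un) (auto simp: cr_le_def)
          moreover have "snd q \<in> sets M" using q by (simp add: cr_cond_def)
          ultimately have "snd q \<in> null_sets M"
            by (rule null_subset_Un[OF _ q(3)]) blast
          then show False using q by (simp add: cr_cond_def)
        qed
      qed
      finally show "p \<in> \<Theta> {x \<in> X. s x \<in> - Q} \<longleftrightarrow> snd p - (- Q) \<in> null_sets M" .
    qed
    have "Q \<in> sets M \<and> ?Z Q" if "Q \<in> sigma_sets UNIV {{f. f i \<in> A} |(i::nat) (A :: bool set). True}" for Q
      using that
    proof (induction rule: sigma_sets.induct)
      case (Basic Q)
      then obtain i A where Q: "Q = {f. f i \<in> A}" by blast
      have sQ: "Q \<in> sets M"
        unfolding sets_cantor_sigma_sets Q by (intro sigma_sets.Basic) blast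
      have empty: "?Z {}" using \<Theta>_empty by (auto simp: cr_cond_def)
      have one: "?Z {f. f i}"
      proof -
        have "{x \<in> X. s x \<in> {f. f i}} = As i" using As(1) by (auto simp: s_def)
        then show ?thesis using As(2) by simp
      qed
      have s1: "{f. f i} \<in> sets M"
        unfolding sets_cantor_sigma_sets by (intro sigma_sets.Basic) (auto intro!: exI[of _ i] exI[of _ "{True}"])
      \<comment> \<open>A set of truth values is empty, full or a singleton, so a coordinate set is
        one of four.\<close>
      have "Q = {} \<or> Q = - {} \<or> Q = {f. f i} \<or> Q = - {f. f i}"
      proof (cases "True \<in> A"; cases "False \<in> A")
        assume "True \<in> A" "False \<in> A" then have "A = UNIV" by (auto simp: UNIV_bool)
        then show ?thesis by (simp add: Q)
      next
        assume "True \<in> A" "False \<notin> A" then have "x \<in> A \<longleftrightarrow> x" for x by (cases x) auto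
        then show ?thesis by (simp add: Q)
      next
        assume "True \<notin> A" "False \<in> A" then have "x \<in> A \<longleftrightarrow> \<not> x" for x by (cases x) auto
        then show ?thesis by (auto simp: Q)
      next
        assume "True \<notin> A" "False \<notin> A" then have "x \<notin> A" for x by (cases x) auto
        then show ?thesis by (simp add: Q)
      qed
      then have "?Z Q"
        using empty one compl[OF sets.empty_sets empty] compl[OF s1 one] by (elim disjE) (simp_all only:)
      then show ?case using sQ by blast
    next
      case Empty
      show ?case using \<Theta>_empty by (auto simp: cr_cond_def)
    next
      case (Compl Q)
      then have "Q \<in> sets M" "?Z Q" by blast+
      then have "?Z (- Q)" "- Q \<in> sets M"
        using compl sets.compl_sets[of Q M] by (simp_all add: Compl_eq_Diff_UNIV)
      then show ?case by (simp add: Compl_eq_Diff_UNIV)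
    next
      case (Union Q)
      then have sQ: "\<And>n. Q n \<in> sets M" and Z: "\<And>n. ?Z (Q n)" by blast+
      have "p \<in> \<Theta> {x \<in> X. s x \<in> (\<Union>n. Q n)} \<longleftrightarrow> snd p - (\<Union>n. Q n) \<in> null_sets M" if p: "p \<in> D" for p
      proof -
        have sp: "snd p \<in> sets M" using p by (simp add: cr_cond_def)
        have sU: "(\<Union>n. Q n) \<in> sets M" using sQ by blast
        have "{x \<in> X. s x \<in> (\<Union>n. Q n)} = (\<Union>n\<in>UNIV. {x \<in> X. s x \<in> Q n})" by auto
        then have "p \<in> \<Theta> {x \<in> X. s x \<in> (\<Union>n. Q n)} \<longleftrightarrow>
            (\<forall>q\<in>D. cr_le q p \<longrightarrow> (\<exists>u\<in>D. cr_le u q \<and> (\<exists>n\<in>UNIV. u \<in> \<Theta> {x \<in> X. s x \<in> Q n})))"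
          using \<Theta>_UN[of "UNIV :: nat set" "\<lambda>n. {x \<in> X. s x \<in> Q n}" p] p by auto
        also have "\<dots> \<longleftrightarrow> (\<forall>q\<in>D. cr_le q p \<longrightarrow> (\<exists>u\<in>D. cr_le u q \<and> (\<exists>n. snd u - Q n \<in> null_sets M)))"
          using Z by blast
        also have "\<dots> \<longleftrightarrow> snd p - (\<Union>n. Q n) \<in> null_sets M"
        proof
          assume h: "\<forall>q\<in>D. cr_le q p \<longrightarrow> (\<exists>u\<in>D. cr_le u q \<and> (\<exists>n. snd u - Q n \<in> null_sets M))"
          show "snd p - (\<Union>n. Q n) \<in> null_sets M"
          proof (rule ccontr)
            assume n: "snd p - (\<Union>n. Q n) \<notin> null_sets M"
            have e: "snd p - (\<Union>n. Q n) - snd p = {}" by auto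
            have "(fst p, snd p - (\<Union>n. Q n)) \<in> D" using n sp sU by (auto simp: cr_cond_def)
            moreover have "cr_le (fst p, snd p - (\<Union>n. Q n)) p"
              unfolding cr_le_def fst_conv snd_conv e by simp
            ultimately obtain u n where u: "u \<in> D" "cr_le u (fst p, snd p - (\<Union>n. Q n))" "snd u - Q n \<in> null_sets M"
              using h by blast
            have "snd u - (snd p - (\<Union>n. Q n)) \<in> null_sets M" "snd u \<in> sets M"
              using u by (simp_all add: cr_le_def cr_cond_def)
            from null_subset_Un[OF this(1) u(3) this(2)] have "snd u \<in> null_sets M" by blast
            then show False using u by (simp add: cr_cond_def)
          qed
        next
          assume n: "snd p - (\<Union>n. Q n) \<in> null_sets M"
          show "\<forall>q\<in>D. cr_le q p \<longrightarrow> (\<exists>u\<in>D. cr_le u q \<and> (\<exists>n. snd u - Q n \<in> null_sets M))"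
          proof (intro ballI impI)
            fix q assume q: "q \<in> D" "cr_le q p"
            have sq: "snd q \<in> sets M" using q by (simp add: cr_cond_def)
            have "\<exists>n. snd q \<inter> Q n \<notin> null_sets M"
            proof (rule ccontr)
              assume "\<not> ?thesis"
              then have "(\<Union>n. snd q \<inter> Q n) \<in> null_sets M" by (intro null_sets_UN) auto
              moreover have "snd q - snd p \<union> (snd p - (\<Union>n. Q n)) \<in> null_sets M"
                using q n by (intro null_sets.Un) (auto simp: cr_le_def)
              ultimately have "snd q \<in> null_sets M"
                using sq by (rule null_subset_Un) blast
              then show False using q by (simp add: cr_cond_def)
            qed
            then obtain n where n: "snd q \<inter> Q n \<notin> null_sets M" by blast
            have e: "snd q \<inter> Q n - snd q = {}" "snd q \<inter> Q n - Q n = {}" by auto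
            have "(fst q, snd q \<inter> Q n) \<in> D" using n sq sQ by (simp add: cr_cond_def)
            moreover have "cr_le (fst q, snd q \<inter> Q n) q" by (simp add: cr_le_def e)
            moreover have "snd (fst q, snd q \<inter> Q n) - Q n \<in> null_sets M" by (simp add: e)
            ultimately show "\<exists>u\<in>D. cr_le u q \<and> (\<exists>n. snd u - Q n \<in> null_sets M)" by blast
          qed
        qed
        finally show ?thesis .
      qed
      then show ?case using sQ by blast
    qed
    then show ?thesis using that sets_cantor_sigma_sets by blast
  qed
  have both: "p \<in> \<Theta> {x \<in> X. pre t (c x) \<and> s x \<in> P} \<longleftrightarrow> prefix t (fst p) \<and> snd p - P \<in> null_sets M"
    if "p \<in> D" "P \<in> sets M" for p t P
  proof -
    have "{x \<in> X. pre t (c x) \<and> s x \<in> P} = {x \<in> X. pre t (c x)} \<inter> {x \<in> X. s x \<in> P}" by auto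
    then show ?thesis
      using \<Theta>_Int[of "{x \<in> X. pre t (c x)}" "{x \<in> X. s x \<in> P}" p] cohen[OF that(1)] random[OF that(2)] that(1)
      by auto
  qed
  interpret cohen_random_rep X I c s
  proof
    show "A \<subseteq> X" if "A \<in> I" for A using that by (rule I_carrier)
    show "B \<in> I" if "A \<in> I" "B \<subseteq> A" for A B using that by (rule I_subset)
    show "\<Union>F \<in> I" if "countable F" "F \<subseteq> I" for F using that by (rule I_Union)
    show "{x \<in> X. s x \<in> N} \<in> I" if N: "N \<in> null_sets M" for N
    proof (rule ccontr)
      assume "{x \<in> X. s x \<in> N} \<notin> I"
      then obtain p where p: "p \<in> \<Theta> {x \<in> X. s x \<in> N}" using \<Theta>_nonempty[of "{x \<in> X. s x \<in> N}"] by auto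
      then have pD: "p \<in> D" using \<Theta>_subset[of "{x \<in> X. s x \<in> N}"] by auto
      then have pN: "snd p - N \<in> null_sets M" using random[of N] N p by auto
      have "snd p \<in> sets M" using pD by (simp add: cr_cond_def)
      from null_subset_Un[OF pN N this] have "snd p \<in> null_sets M" by blast
      then show False using pD by (simp add: cr_cond_def)
    qed
    show "{x \<in> X. pre t (c x) \<and> s x \<in> P} \<notin> I" if P: "P \<in> sets M - null_sets M" for P t
    proof
      let ?A = "{x \<in> X. pre t (c x) \<and> s x \<in> P}"
      assume "?A \<in> I"
      then have "\<Theta> ?A \<subseteq> \<Theta> {}" using \<Theta>_iff[of ?A "{}"] by auto
      moreover have "(t, P) \<in> D" using P by (simp add: cr_cond_def)
      then have "(t, P) \<in> \<Theta> ?A" using both[of "(t, P)" P t] P by simp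
      ultimately show False using \<Theta>_empty by blast
    qed
    show "\<exists>t. \<exists>P\<in>sets M - null_sets M. {x \<in> X. pre t (c x) \<and> s x \<in> P} - A \<in> I" if A: "A \<subseteq> X" "A \<notin> I" for A
    proof -
      obtain t P where p: "(t, P) \<in> \<Theta> A" using \<Theta>_nonempty[OF A] by auto
      then have "(t, P) \<in> D" using \<Theta>_subset[OF A(1)] by blast
      then have P: "P \<in> sets M - null_sets M" by (simp add: cr_cond_def)
      have "\<Theta> {x \<in> X. pre t (c x) \<and> s x \<in> P} \<subseteq> \<Theta> A"
      proof
        fix q assume q: "q \<in> \<Theta> {x \<in> X. pre t (c x) \<and> s x \<in> P}"
        then have qD: "q \<in> D" using \<Theta>_subset[of "{x \<in> X. pre t (c x) \<and> s x \<in> P}"] by auto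
        then have "cr_le q (t, P)" using both[OF qD, of P t] P q by (simp add: cr_le_def)
        then show "q \<in> \<Theta> A" using \<Theta>_down[OF A(1) p qD] by blast
      qed
      then have "{x \<in> X. pre t (c x) \<and> s x \<in> P} - A \<in> I"
        using \<Theta>_iff[of "{x \<in> X. pre t (c x) \<and> s x \<in> P}" A] A(1) by auto
      with P show ?thesis by blast
    qed
  qed
  show False by (rule no_cohen_random_rep)
qed

end

section \<open>Presentations of the concrete forcing notions\<close>

lemma presents_ideal_forcing:
  assumes "ideal_over \<kappa> I"
  shows "presents (Pow \<kappa> - I) (\<lambda>A B. A - B \<in> I) (\<lambda>A. mod_ideal (Pow \<kappa>) I `` {A}) (ideal_forcing \<kappa> I)"
proof -
  have I: "{} \<in> I" "\<And>A B. A \<in> I \<Longrightarrow> B \<subseteq> A \<Longrightarrow> B \<in> I" "\<And>A B. A \<in> I \<Longrightarrow> B \<in> I \<Longrightarrow> A \<union> B \<in> I"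
    using assms unfolding ideal_over_def by blast+
  interpret algebra_with_ideal "Pow \<kappa>" I
    by unfold_locales (use I in auto)
  have "A - C \<in> I" if "A - B \<in> I" "B - C \<in> I" for A B C
    by (rule I(2)[OF I(3)[OF that]]) blast
  then show ?thesis
    unfolding presents_def ideal_forcing_def
    using Field_quotient_forcing quotient_forcing_iff I(1) by auto
qed

interpretation cantor_null: algebra_with_ideal "sets cantor_measure" "null_sets cantor_measure"
  by unfold_locales (auto intro: null_sets_subset)

lemma random_forcing_iff:
  "P \<in> sets cantor_measure - null_sets cantor_measure \<Longrightarrow> Q \<in> sets cantor_measure - null_sets cantor_measure \<Longrightarrow>
    (mod_ideal (sets cantor_measure) (null_sets cantor_measure) `` {P},
     mod_ideal (sets cantor_measure) (null_sets cantor_measure) `` {Q}) \<in> random_forcing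
    \<longleftrightarrow> P - Q \<in> null_sets cantor_measure"
  unfolding random_forcing_def by (rule cantor_null.quotient_forcing_iff)

lemma Field_random_forcing:
  "Field random_forcing = (\<lambda>P. mod_ideal (sets cantor_measure) (null_sets cantor_measure) `` {P}) `
     (sets cantor_measure - null_sets cantor_measure)"
  unfolding random_forcing_def by (rule cantor_null.Field_quotient_forcing)

lemma Field_prod_forcing:
  assumes "\<And>p. p \<in> Field r \<Longrightarrow> (p, p) \<in> r" "\<And>p. p \<in> Field s \<Longrightarrow> (p, p) \<in> s"
  shows "Field (prod_forcing r s) = Field r \<times> Field s"
proof
  show "Field (prod_forcing r s) \<subseteq> Field r \<times> Field s"
    by (auto simp: prod_forcing_def Field_def)
  show "Field r \<times> Field s \<subseteq> Field (prod_forcing r s)"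
  proof
    fix p assume "p \<in> Field r \<times> Field s"
    then have "(p, p) \<in> prod_forcing r s" using assms by (auto simp: prod_forcing_def)
    then show "p \<in> Field (prod_forcing r s)" by (rule FieldI1)
  qed
qed

text \<open>Both orders of the product are quotients of the same preorder, with the coordinates
  exchanged, so a single argument covers them.\<close>

lemma presents_cohen_random:
  fixes cl :: "(nat \<Rightarrow> bool) set \<Rightarrow> (nat \<Rightarrow> bool) set set"
  defines "cl \<equiv> \<lambda>P. mod_ideal (sets cantor_measure) (null_sets cantor_measure) `` {P}"
  shows "presents cr_cond cr_le (\<lambda>p. (fst p, cl (snd p))) (prod_forcing cohen_forcing random_forcing)"
    and "presents cr_cond cr_le (\<lambda>p. (cl (snd p), fst p)) (prod_forcing random_forcing cohen_forcing)"
proof -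
  have Fc: "Field cohen_forcing = UNIV" by (auto simp: cohen_forcing_def Field_def)
  have Fr: "Field random_forcing = cl ` (sets cantor_measure - null_sets cantor_measure)"
    unfolding cl_def by (rule Field_random_forcing)
  have rc: "(p, p) \<in> cohen_forcing" for p by (simp add: cohen_forcing_def)
  have rr: "(p, p) \<in> random_forcing" if "p \<in> Field random_forcing" for p
    using that random_forcing_iff unfolding Field_random_forcing by auto
  have iff: "(cl P, cl Q) \<in> random_forcing \<longleftrightarrow> P - Q \<in> null_sets cantor_measure"
    if "P \<in> sets cantor_measure - null_sets cantor_measure" "Q \<in> sets cantor_measure - null_sets cantor_measure" for P Q
    unfolding cl_def using that by (rule random_forcing_iff)
  have Fp1: "Field (prod_forcing cohen_forcing random_forcing) =
      UNIV \<times> cl ` (sets cantor_measure - null_sets cantor_measure)"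
    unfolding Fc[symmetric] Fr[symmetric] using rc rr by (rule Field_prod_forcing)
  have Fp2: "Field (prod_forcing random_forcing cohen_forcing) =
      cl ` (sets cantor_measure - null_sets cantor_measure) \<times> UNIV"
    unfolding Fc[symmetric] Fr[symmetric] using rr rc by (rule Field_prod_forcing)
  let ?S = "sets cantor_measure - null_sets cantor_measure"
  have pair: "(t, P) \<in> cr_cond \<longleftrightarrow> P \<in> ?S" for t P by (simp add: cr_cond_def)
  have F1: "Field (prod_forcing cohen_forcing random_forcing) = (\<lambda>p. (fst p, cl (snd p))) ` cr_cond"
    unfolding Fp1
  proof (rule equalityI; rule subsetI)
    fix x assume "x \<in> (UNIV :: bool list set) \<times> cl ` ?S"
    then obtain t P where "x = (t, cl P)" "P \<in> ?S" by blast
    then show "x \<in> (\<lambda>p. (fst p, cl (snd p))) ` cr_cond"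
      using pair[of t P] by (intro image_eqI[of _ _ "(t, P)"]) simp_all
  next
    fix x assume "x \<in> (\<lambda>p. (fst p, cl (snd p))) ` cr_cond"
    then show "x \<in> UNIV \<times> cl ` ?S" by (auto simp: cr_cond_def)
  qed
  have F2: "Field (prod_forcing random_forcing cohen_forcing) = (\<lambda>p. (cl (snd p), fst p)) ` cr_cond"
    unfolding Fp2
  proof (rule equalityI; rule subsetI)
    fix x assume "x \<in> cl ` ?S \<times> (UNIV :: bool list set)"
    then obtain t P where "x = (cl P, t)" "P \<in> ?S" by blast
    then show "x \<in> (\<lambda>p. (cl (snd p), fst p)) ` cr_cond"
      using pair[of t P] by (intro image_eqI[of _ _ "(t, P)"]) simp_all
  next
    fix x assume "x \<in> (\<lambda>p. (cl (snd p), fst p)) ` cr_cond"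
    then show "x \<in> cl ` ?S \<times> UNIV" by (auto simp: cr_cond_def)
  qed
  have o: "(fst a, fst b) \<in> cohen_forcing \<and> (cl (snd a), cl (snd b)) \<in> random_forcing \<longleftrightarrow> cr_le a b"
    if "a \<in> cr_cond" "b \<in> cr_cond" for a b
    using that iff by (simp add: cr_cond_def cr_le_def cohen_forcing_def)
  show "presents cr_cond cr_le (\<lambda>p. (fst p, cl (snd p))) (prod_forcing cohen_forcing random_forcing)"
    unfolding presents_def
  proof (intro conjI F1)
    show "\<forall>a\<in>cr_cond. \<forall>b\<in>cr_cond. ((fst a, cl (snd a)), (fst b, cl (snd b))) \<in>
        prod_forcing cohen_forcing random_forcing \<longleftrightarrow> cr_le a b"
      using o by (simp add: prod_forcing_def)
  qed (use cr_le_refl cr_le_trans in blast)+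
  show "presents cr_cond cr_le (\<lambda>p. (cl (snd p), fst p)) (prod_forcing random_forcing cohen_forcing)"
    unfolding presents_def
  proof (intro conjI F2)
    show "\<forall>a\<in>cr_cond. \<forall>b\<in>cr_cond. ((cl (snd a), fst a), (cl (snd b), fst b)) \<in>
        prod_forcing random_forcing cohen_forcing \<longleftrightarrow> cr_le a b"
      using o by (auto simp: prod_forcing_def)
  qed (use cr_le_refl cr_le_trans in blast)+
qed

text \<open>Send \<open>A\<close> to the image under the isomorphism of the principal regular open
  set \<open>cone A\<close>. This map is a dense embedding, which \<open>no_embedding\<close>
  refutes.\<close>

lemma not_isomorphic_presented:
  assumes I: "ideal_over \<kappa> I" "omega1_complete I" and s: "presents cr_cond cr_le \<pi> s"
  shows "\<not> forcing_isomorphic (ideal_forcing \<kappa> I) s"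
proof
  assume "forcing_isomorphic (ideal_forcing \<kappa> I) s"
  from forcing_isomorphic_presented[OF this presents_ideal_forcing[OF I(1)] s]
  obtain F where F: "F ` regular_open (Pow \<kappa> - I) (\<lambda>A B. A - B \<in> I) = regular_open cr_cond cr_le"
    and mono0: "\<forall>U\<in>regular_open (Pow \<kappa> - I) (\<lambda>A B. A - B \<in> I).
      \<forall>V\<in>regular_open (Pow \<kappa> - I) (\<lambda>A B. A - B \<in> I). F U \<subseteq> F V \<longleftrightarrow> U \<subseteq> V"
    by (elim exE conjE)
  let ?RO = "regular_open (Pow \<kappa> - I) (\<lambda>A B. A - B \<in> I)"
  have mono: "F U \<subseteq> F V \<longleftrightarrow> U \<subseteq> V" if "U \<in> ?RO" "V \<in> ?RO" for U V
    using mono0 that by (simp only:)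
  have sub: "\<And>A B. A \<in> I \<Longrightarrow> B \<subseteq> A \<Longrightarrow> B \<in> I" and Un: "\<And>A B. A \<in> I \<Longrightarrow> B \<in> I \<Longrightarrow> A \<union> B \<in> I"
    and carrier: "\<And>A. A \<in> I \<Longrightarrow> A \<subseteq> \<kappa>" and e: "{} \<in> I"
    using I(1) unfolding ideal_over_def by blast+
  define cone where "cone A = {B \<in> Pow \<kappa> - I. B - A \<in> I}" for A
  have cone: "cone A \<in> ?RO" if A: "A \<subseteq> \<kappa>" for A
  proof -
    have "B \<in> cone A \<longleftrightarrow> (\<forall>C\<in>Pow \<kappa> - I. C - B \<in> I \<longrightarrow> (\<exists>u\<in>cone A. u - C \<in> I))" if B: "B \<in> Pow \<kappa> - I" for B
    proof
      assume "B \<in> cone A"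
      then have BA: "B - A \<in> I" by (simp add: cone_def)
      show "\<forall>C\<in>Pow \<kappa> - I. C - B \<in> I \<longrightarrow> (\<exists>u\<in>cone A. u - C \<in> I)"
      proof (intro ballI impI)
        fix C assume C: "C \<in> Pow \<kappa> - I" "C - B \<in> I"
        have "C - A \<in> I" by (rule sub[OF Un[OF C(2) BA]]) blast
        then show "\<exists>u\<in>cone A. u - C \<in> I" using C e by (intro bexI[of _ C]) (auto simp: cone_def)
      qed
    next
      assume h: "\<forall>C\<in>Pow \<kappa> - I. C - B \<in> I \<longrightarrow> (\<exists>u\<in>cone A. u - C \<in> I)"
      have "B - A \<in> I"
      proof (rule ccontr)
        assume BA: "B - A \<notin> I"
        have "B - A - B = {}" by blast
        then have "B - A - B \<in> I" using e by (simp only:)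
        moreover have "B - A \<in> Pow \<kappa> - I" using B BA by blast
        ultimately obtain u where u: "u \<in> cone A" "u - (B - A) \<in> I" using h by blast
        then have "u - A \<in> I" by (simp add: cone_def)
        from Un[OF u(2) this] have "u \<in> I" by (rule sub) blast
        then show False using u by (simp add: cone_def)
      qed
      then show "B \<in> cone A" using B by (simp add: cone_def)
    qed
    then show ?thesis by (auto simp: regular_open_def cone_def)
  qed
  have cone_mono: "cone A \<subseteq> cone B \<longleftrightarrow> A - B \<in> I" if A: "A \<subseteq> \<kappa>" "B \<subseteq> \<kappa>" for A B
  proof
    assume h: "cone A \<subseteq> cone B"
    show "A - B \<in> I"
    proof (cases "A \<in> I")
      case True
      then show ?thesis by (rule sub) blast
    next
      case False
      then have "A \<in> cone A" using A e by (simp add: cone_def)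
      then show ?thesis using h by (auto simp: cone_def)
    qed
  next
    assume AB: "A - B \<in> I"
    have "C - B \<in> I" if "C - A \<in> I" for C by (rule sub[OF Un[OF that AB]]) blast
    then show "cone A \<subseteq> cone B" by (auto simp: cone_def)
  qed
  have cone_empty: "cone {} = {}" by (auto simp: cone_def)
  \<comment> \<open>The empty set is the least regular open set on both sides, so \<open>F\<close>
    preserves it.\<close>
  have "{} \<in> regular_open cr_cond cr_le" using cr_le_refl by (auto simp: regular_open_def)
  then obtain V where "V \<in> ?RO" "F V = {}" unfolding F[symmetric] by auto
  then have F_empty: "F {} = {}" using mono[of "{}" V] cone[of "{}"] cone_empty by auto
  interpret dense_cr_embedding \<kappa> I "\<lambda>A. F (cone A)"
  proof
    show "A \<subseteq> \<kappa>" if "A \<in> I" for A using that by (rule carrier)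
    show "B \<in> I" if "A \<in> I" "B \<subseteq> A" for A B using that by (rule sub)
    show "\<Union>\<F> \<in> I" if "countable \<F>" "\<F> \<subseteq> I" for \<F> using I(2) that by (simp add: omega1_complete_def)
    show "F (cone A) \<in> regular_open cr_cond cr_le" if "A \<subseteq> \<kappa>" for A using cone[OF that] F by blast
    show "F (cone A) \<subseteq> F (cone B) \<longleftrightarrow> A - B \<in> I" if "A \<subseteq> \<kappa>" "B \<subseteq> \<kappa>" for A B
      using mono[OF cone[OF that(1)] cone[OF that(2)]] cone_mono[OF that] by simp
    show "F (cone {}) = {}" by (simp add: cone_empty F_empty)
    show "\<exists>A. A \<subseteq> \<kappa> \<and> A \<notin> I \<and> F (cone A) \<subseteq> W" if W: "W \<in> regular_open cr_cond cr_le" "W \<noteq> {}" for W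
    proof -
      \<comment> \<open>\<open>W\<close> is \<open>F V\<close> for a nonempty \<open>V\<close>, and
        with any member \<open>A\<close> the set \<open>V\<close> contains all of
        \<open>cone A\<close>.\<close>
      obtain V where V: "V \<in> ?RO" "F V = W" using W(1) unfolding F[symmetric] by auto
      then have "V \<noteq> {}" using F_empty W(2) by auto
      then obtain A where A: "A \<in> V" by blast
      then have AD: "A \<in> Pow \<kappa> - I" using V(1) by (auto simp: regular_open_def)
      have "cone A \<subseteq> V"
      proof
        fix B assume B: "B \<in> cone A"
        then have BD: "B \<in> Pow \<kappa> - I" and BA: "B - A \<in> I" by (auto simp: cone_def)
        have "\<exists>u\<in>V. u - C \<in> I" if C: "C \<in> Pow \<kappa> - I" "C - B \<in> I" for C
        proof -
          have "C - A \<in> I" by (rule sub[OF Un[OF C(2) BA]]) blast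
          then show ?thesis using V(1) A AD C(1) unfolding regular_open_def by blast
        qed
        then show "B \<in> V" using V(1) BD unfolding regular_open_def by blast
      qed
      then have "F (cone A) \<subseteq> W" using mono[OF cone[of A] V(1)] AD V(2) by auto
      then show ?thesis using AD by blast
    qed
  qed
  show False by (rule no_embedding)
qed

theorem theorem3p1:
  fixes \<kappa> :: "'a set" and I :: "'a set set"
  assumes "ideal_over \<kappa> I" and "omega1_complete I"
  shows "\<not> forcing_isomorphic (ideal_forcing \<kappa> I) (prod_forcing cohen_forcing random_forcing) \<and>
         \<not> forcing_isomorphic (ideal_forcing \<kappa> I) (prod_forcing random_forcing cohen_forcing)"
  using not_isomorphic_presented[OF assms presents_cohen_random(1)]
    not_isomorphic_presented[OF assms presents_cohen_random(2)] by blast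

end
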